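(* Let $\Delta_d$ be the $d$-dimensional simplex. Then the toric morphism $f\colon X_{\mathcal{R}(\Delta_d,m)}\to X_{\mathcal{Q}(\Delta_d,m)}$ is flat with reduced fibers for all $d\ge1$ (and all $m\ge1$).
   Context: Toric varieties are over $\mathbb{C}$. $\Delta_d=\mathrm{Conv}(0,e_1,\ldots,e_d)\subseteq\mathbb{R}^d$ is the standard simplex. Its inner normal fan $\Sigma$ in $\mathbb{R}^d$ (lattice $\mathbb{Z}^d$) has as maximal cones the cones generated by $d$ of the $d+1$ vectors $e_1,\ldots,e_d,-(e_1+\cdots+e_d)$. Let $\Sigma^m$ be the fan in $(\mathbb{R}^d)^m$ of all products $\tau_1\times\cdots\times\tau_m$ with $\tau_i\in\Sigma$. Embed $\mathbb{R}^d$ diagonally in $(\mathbb{R}^d)^m$ and let $q\colon(\mathbb{R}^d)^m\to(\mathbb{R}^d)^m/\mathbb{R}^d$ be the quotient map, the target having lattice $(\mathbb{Z}^d)^m/\mathbb{Z}^d$. The quotient fan $\mathcal{Q}(\Delta_d,m)$ in $(\mathbb{R}^d)^m/\mathbb{R}^d$ is the common refinement of the cones $q(\tau)$, $\tau\in\Sigma^m$: its cones are the closures of the classes of the equivalence relation $[\mathbf v]\sim[\mathbf w]$ iff for every $\tau\in\Sigma^m$ one has $[\mathbf v]\in q(\tau)\Leftrightarrow[\mathbf w]\in q(\tau)$. The fan $\mathcal{R}(\Delta_d,m)$ in $(\mathbb{R}^d)^m$ (lattice $(\mathbb{Z}^d)^m$) is $\{q^{-1}(\xi)\cap\tau\mid\xi\in\mathcal{Q}(\Delta_d,m),\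 \tau\in\Sigma^m\}$. The map $q$ is a morphism of fans $\mathcal{R}(\Delta_d,m)\to\mathcal{Q}(\Delta_d,m)$, and $f$ is the induced toric morphism. *)

theory Defs
  imports
    "HOL-Analysis.Analysis"
    "HOL-Algebra.QuotRing"
    "HOL-Algebra.Module"
    "HOL-Algebra.Free_Abelian_Groups"
    "HOL-Library.Function_Algebras"
begin

section \<open>Commutative algebra\<close>

subsection \<open>Tensor products and flatness\<close>

definition lin_maps ::
  "('a, 'r) ring_scheme \<Rightarrow> ('a, 'n, 'x) module_scheme \<Rightarrow> ('a, 'k, 'y) module_scheme \<Rightarrow> ('n \<Rightarrow> 'k) set"
  where "lin_maps R N N' = {f \<in> carrier N \<rightarrow> carrier N'.
    (\<forall>x\<in>carrier N. \<forall>y\<in>carrier N. f (x \<oplus>\<^bsub>N\<^esub> y) = f x \<oplus>\<^bsub>N'\<^esub> f y) \<and>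
    (\<forall>r\<in>carrier R. \<forall>x\<in>carrier N. f (r \<odot>\<^bsub>N\<^esub> x) = r \<odot>\<^bsub>N'\<^esub> f x)}"

definition tensor_free ::
  "('a, 'm, 'x) module_scheme \<Rightarrow> ('a, 'n, 'y) module_scheme \<Rightarrow> ('m \<times> 'n \<Rightarrow>\<^sub>0 int) monoid"
  where "tensor_free M N = free_Abelian_group (carrier M \<times> carrier N)"

definition tensor_rels ::
  "('a, 'r) ring_scheme \<Rightarrow> ('a, 'm, 'x) module_scheme \<Rightarrow> ('a, 'n, 'y) module_scheme \<Rightarrow> ('m \<times> 'n \<Rightarrow>\<^sub>0 int) set"
  where "tensor_rels R M N = generate (tensor_free M N) (
      {frag_of (x \<oplus>\<^bsub>M\<^esub> x', y) - frag_of (x, y) - frag_of (x', y) | x x' y.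
         x \<in> carrier M \<and> x' \<in> carrier M \<and> y \<in> carrier N} \<union>
      {frag_of (x, y \<oplus>\<^bsub>N\<^esub> y') - frag_of (x, y) - frag_of (x, y') | x y y'.
         x \<in> carrier M \<and> y \<in> carrier N \<and> y' \<in> carrier N} \<union>
      {frag_of (r \<odot>\<^bsub>M\<^esub> x, y) - frag_of (x, r \<odot>\<^bsub>N\<^esub> y) | r x y.
         r \<in> carrier R \<and> x \<in> carrier M \<and> y \<in> carrier N})"

definition tensor_product ::
  "('a, 'r) ring_scheme \<Rightarrow> ('a, 'm, 'x) module_scheme \<Rightarrow> ('a, 'n, 'y) module_scheme \<Rightarrow> ('m \<times> 'n \<Rightarrow>\<^sub>0 int) set monoid"
  where "tensor_product R M N = tensor_free M N Mod tensor_rels R M N"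

text \<open>The map \<open>M \<otimes> N \<rightarrow> M \<otimes> N'\<close> induced by \<open>f\<close>; the elements of a tensor product are cosets, and the
  union below is the coset of the image of any representative.\<close>
definition tensor_map ::
  "('a, 'r) ring_scheme \<Rightarrow> ('a, 'm, 'x) module_scheme \<Rightarrow> ('a, 'k, 'y) module_scheme \<Rightarrow> ('n \<Rightarrow> 'k)
     \<Rightarrow> ('m \<times> 'n \<Rightarrow>\<^sub>0 int) set \<Rightarrow> ('m \<times> 'k \<Rightarrow>\<^sub>0 int) set"
  where "tensor_map R M N' f X =
    (\<Union>z\<in>X. tensor_rels R M N' #>\<^bsub>tensor_free M N'\<^esub> frag_extend (\<lambda>(x, y). frag_of (x, f y)) z)"

text \<open>\<open>M \<otimes> _\<close> preserves injectivity of all linear maps \<open>N \<rightarrow> N'\<close>. HOL cannot quantify over types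
  inside a formula, so the types in which the carriers of \<open>N\<close> and \<open>N'\<close> live are parameters; a theorem
  that concludes flatness for arbitrary type variables \<open>'n\<close>, \<open>'k\<close> covers all modules.\<close>
definition flat_module ::
  "'n itself \<Rightarrow> 'k itself \<Rightarrow> ('a, 'r) ring_scheme \<Rightarrow> ('a, 'm, 'x) module_scheme \<Rightarrow> bool"
  where "flat_module _ _ R M \<longleftrightarrow> Module.module R M \<and>
    (\<forall>(N :: ('a, 'n) module) (N' :: ('a, 'k) module) f.
       Module.module R N \<longrightarrow> Module.module R N' \<longrightarrow> f \<in> lin_maps R N N' \<longrightarrow> inj_on f (carrier N) \<longrightarrow>
       inj_on (tensor_map R M N' f) (carrier (tensor_product R M N)))"

definition restrict_scalars :: "('b, 's) ring_scheme \<Rightarrow> ('a \<Rightarrow> 'b) \<Rightarrow> ('a, 'b) module"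
  where "restrict_scalars S h =
    \<lparr>carrier = carrier S, monoid.mult = monoid.mult S, one = monoid.one S,
     ring.zero = ring.zero S, add = ring.add S,
     smult = (\<lambda>r x. h r \<otimes>\<^bsub>S\<^esub> x)\<rparr>"

definition flat_ring_hom ::
  "'n itself \<Rightarrow> 'k itself \<Rightarrow> ('a, 'r) ring_scheme \<Rightarrow> ('b, 's) ring_scheme \<Rightarrow> ('a \<Rightarrow> 'b) \<Rightarrow> bool"
  where "flat_ring_hom Tn Tk R S h \<longleftrightarrow>
    h \<in> ring_hom R S \<and> flat_module Tn Tk R (restrict_scalars S h)"

subsection \<open>Spectra and local rings\<close>

definition Spec :: "('a, 'r) ring_scheme \<Rightarrow> 'a set set"
  where "Spec R = {P. primeideal P R}"

definition spec_map :: "('a, 'r) ring_scheme \<Rightarrow> ('a \<Rightarrow> 'b) \<Rightarrow> 'b set \<Rightarrow> 'a set"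
  where "spec_map R h P = {a \<in> carrier R. h a \<in> P}"

definition local_frac_rel :: "('a, 'r) ring_scheme \<Rightarrow> 'a set \<Rightarrow> (('a \<times> 'a) \<times> ('a \<times> 'a)) set"
  where "local_frac_rel R P = {((a, s), (b, t)).
    a \<in> carrier R \<and> b \<in> carrier R \<and> s \<in> carrier R - P \<and> t \<in> carrier R - P \<and>
    (\<exists>u\<in>carrier R - P. u \<otimes>\<^bsub>R\<^esub> (a \<otimes>\<^bsub>R\<^esub> t \<ominus>\<^bsub>R\<^esub> b \<otimes>\<^bsub>R\<^esub> s) = \<zero>\<^bsub>R\<^esub>)}"

definition local_frac :: "('a, 'r) ring_scheme \<Rightarrow> 'a set \<Rightarrow> 'a \<Rightarrow> 'a \<Rightarrow> ('a \<times> 'a) set"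
  where "local_frac R P a s = local_frac_rel R P `` {(a, s)}"

text \<open>The localization of \<open>R\<close> at the prime \<open>P\<close>, i.e.\ the local ring of \<open>Spec R\<close> at \<open>P\<close>.\<close>
definition local_ring :: "('a, 'r) ring_scheme \<Rightarrow> 'a set \<Rightarrow> ('a \<times> 'a) set ring"
  where "local_ring R P =
    \<lparr>carrier = (carrier R \<times> (carrier R - P)) // local_frac_rel R P,
     monoid.mult = (\<lambda>X Y. \<Union>(a, s)\<in>X. \<Union>(b, t)\<in>Y. local_frac R P (a \<otimes>\<^bsub>R\<^esub> b) (s \<otimes>\<^bsub>R\<^esub> t)),
     one = local_frac R P \<one>\<^bsub>R\<^esub> \<one>\<^bsub>R\<^esub>,
     ring.zero = local_frac R P \<zero>\<^bsub>R\<^esub> \<one>\<^bsub>R\<^esub>,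
     add = (\<lambda>X Y. \<Union>(a, s)\<in>X. \<Union>(b, t)\<in>Y. local_frac R P (a \<otimes>\<^bsub>R\<^esub> t \<oplus>\<^bsub>R\<^esub> b \<otimes>\<^bsub>R\<^esub> s) (s \<otimes>\<^bsub>R\<^esub> t))\<rparr>"

definition local_max_ideal :: "('a, 'r) ring_scheme \<Rightarrow> 'a set \<Rightarrow> ('a \<times> 'a) set set"
  where "local_max_ideal R P = {local_frac R P a s | a s. a \<in> P \<and> s \<in> carrier R - P}"

text \<open>For \<open>h : R \<rightarrow> S\<close> and a prime \<open>P\<close> of \<open>S\<close>, the induced map from the local ring of \<open>R\<close> at
  \<open>spec_map R h P\<close> to the local ring of \<open>S\<close> at \<open>P\<close>.\<close>
definition local_hom ::
  "('b, 's) ring_scheme \<Rightarrow> ('a \<Rightarrow> 'b) \<Rightarrow> 'b set \<Rightarrow> ('a \<times> 'a) set \<Rightarrow> ('b \<times> 'b) set"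
  where "local_hom S h P X = (\<Union>(a, s)\<in>X. local_frac S P (h a) (h s))"

subsection \<open>Flat morphisms and reduced fibres\<close>

text \<open>Flatness of \<open>Spec S \<rightarrow> Spec R\<close> at every point: each stalk of the structure sheaf of the source is
  flat over the stalk at the image point.\<close>
definition flat_spec_map ::
  "'n itself \<Rightarrow> 'k itself \<Rightarrow> ('a, 'r) ring_scheme \<Rightarrow> ('b, 's) ring_scheme \<Rightarrow> ('a \<Rightarrow> 'b) \<Rightarrow> bool"
  where "flat_spec_map Tn Tk R S h \<longleftrightarrow>
    (\<forall>P\<in>Spec S. flat_ring_hom Tn Tk (local_ring R (spec_map R h P)) (local_ring S P) (local_hom S h P))"

definition reduced_ring :: "('a, 'r) ring_scheme \<Rightarrow> bool"
  where "reduced_ring R \<longleftrightarrow> (\<forall>x\<in>carrier R. \<forall>n::nat. x [^]\<^bsub>R\<^esub> n = \<zero>\<^bsub>R\<^esub> \<longrightarrow> x = \<zero>\<^bsub>R\<^esub>)"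

text \<open>Let \<open>x\<close> be the point \<open>P\<close> of \<open>X = Spec S\<close> and \<open>y\<close> its image in \<open>Y = Spec R\<close>. The local ring at \<open>x\<close>
  of the scheme-theoretic fibre \<open>X \<times>\<^sub>Y Spec \<kappa>(y)\<close> is \<open>O\<^sub>x \<otimes> \<kappa>(y) = O\<^sub>x / m\<^sub>y O\<^sub>x\<close>.\<close>
definition fibre_local_ring ::
  "('a, 'r) ring_scheme \<Rightarrow> ('b, 's) ring_scheme \<Rightarrow> ('a \<Rightarrow> 'b) \<Rightarrow> 'b set \<Rightarrow> ('b \<times> 'b) set set ring"
  where "fibre_local_ring R S h P =
    local_ring S P Quot
      (Idl\<^bsub>local_ring S P\<^esub> (local_hom S h P ` local_max_ideal R (spec_map R h P)))"

text \<open>The fibre over every point \<open>y\<close> of \<open>Spec R\<close> (not only over closed points) is a reduced scheme,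
  i.e.\ its local rings, at the points lying over \<open>y\<close>, are reduced.\<close>
definition reduced_fibres_spec_map ::
  "('a, 'r) ring_scheme \<Rightarrow> ('b, 's) ring_scheme \<Rightarrow> ('a \<Rightarrow> 'b) \<Rightarrow> bool"
  where "reduced_fibres_spec_map R S h \<longleftrightarrow>
    (\<forall>y\<in>Spec R. \<forall>P\<in>Spec S. spec_map R h P = y \<longrightarrow> reduced_ring (fibre_local_ring R S h P))"

section \<open>Toric varieties and toric morphisms\<close>

text \<open>A lattice is a subgroup \<open>L\<close> of a real vector space \<open>'v\<close> (spanning it), and a fan is a set of cones
  in \<open>'v\<close>. The dual lattice consists of the linear forms that are integral on \<open>L\<close>.\<close>

definition dual_lattice :: "'v::real_vector set \<Rightarrow> ('v \<Rightarrow> real) set"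
  where "dual_lattice L = {u. linear u \<and> (\<forall>v\<in>L. u v \<in> \<int>)}"

definition dual_semigroup :: "'v::real_vector set \<Rightarrow> 'v set \<Rightarrow> ('v \<Rightarrow> real) set"
  where "dual_semigroup L \<sigma> = {u \<in> dual_lattice L. \<forall>v\<in>\<sigma>. 0 \<le> u v}"

text \<open>The semigroup algebra of \<open>dual_semigroup L \<sigma>\<close> over the complex numbers, whose spectrum is the
  affine toric variety \<open>U\<^sub>\<sigma>\<close>; the character \<open>\<chi>\<^sup>u\<close> is \<open>Poly_Mapping.single u 1\<close>, and the product of the type
  \<open>\<Rightarrow>\<^sub>0\<close> is the convolution product for pointwise addition of linear forms.\<close>
definition toric_chart :: "'v::real_vector set \<Rightarrow> 'v set \<Rightarrow> (('v \<Rightarrow> real) \<Rightarrow>\<^sub>0 complex) ring"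
  where "toric_chart L \<sigma> =
    \<lparr>carrier = {p. Poly_Mapping.keys p \<subseteq> dual_semigroup L \<sigma>},
     monoid.mult = (*), one = 1, ring.zero = 0, add = (+)\<rparr>"

text \<open>The algebra map \<open>\<chi>\<^sup>u \<mapsto> \<chi>\<^bsup>u \<circ> \<phi>\<^esup>\<close>.\<close>
definition chart_pullback ::
  "('v \<Rightarrow> 'w) \<Rightarrow> (('w \<Rightarrow> real) \<Rightarrow>\<^sub>0 complex) \<Rightarrow> (('v \<Rightarrow> real) \<Rightarrow>\<^sub>0 complex)"
  where "chart_pullback \<phi> p =
    (\<Sum>u\<in>Poly_Mapping.keys p. Poly_Mapping.single (u \<circ> \<phi>) (Poly_Mapping.lookup p u))"

definition fan_morphism ::
  "'v::real_vector set \<Rightarrow> 'v set set \<Rightarrow> 'w::real_vector set \<Rightarrow> 'w set set \<Rightarrow> ('v \<Rightarrow> 'w) \<Rightarrow> bool"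
  where "fan_morphism L \<Sigma> L' \<Sigma>' \<phi> \<longleftrightarrow>
    linear \<phi> \<and> \<phi> ` L \<subseteq> L' \<and> (\<forall>\<sigma>\<in>\<Sigma>. \<exists>\<sigma>'\<in>\<Sigma>'. \<phi> ` \<sigma> \<subseteq> \<sigma>')"

text \<open>The toric variety \<open>X\<^sub>\<Sigma>\<close> is glued from the charts \<open>U\<^sub>\<sigma>\<close>, \<open>\<sigma> \<in> \<Sigma>\<close>, along open subsets, so every point of
  it is a prime of some \<open>toric_chart L \<sigma>\<close>, with local ring the localization there. The toric morphism of
  \<open>\<phi>\<close> is glued from the maps \<open>U\<^sub>\<sigma> \<rightarrow> U\<^sub>\<sigma>\<^sub>'\<close> given by \<open>chart_pullback \<phi>\<close>, for all \<open>\<sigma> \<in> \<Sigma>\<close>, \<open>\<sigma>' \<in> \<Sigma>'\<close> with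
  \<open>\<phi> ` \<sigma> \<subseteq> \<sigma>'\<close>. Flatness and reducedness of the fibres are conditions on the local rings at the points of the
  source, so they are imposed at all points of all charts.\<close>

definition flat_toric_morphism ::
  "'n itself \<Rightarrow> 'k itself \<Rightarrow>
   'v::real_vector set \<Rightarrow> 'v set set \<Rightarrow> 'w::real_vector set \<Rightarrow> 'w set set \<Rightarrow> ('v \<Rightarrow> 'w) \<Rightarrow> bool"
  where "flat_toric_morphism Tn Tk L \<Sigma> L' \<Sigma>' \<phi> \<longleftrightarrow>
    fan_morphism L \<Sigma> L' \<Sigma>' \<phi> \<and>
    (\<forall>\<sigma>\<in>\<Sigma>. \<forall>\<sigma>'\<in>\<Sigma>'. \<phi> ` \<sigma> \<subseteq> \<sigma>' \<longrightarrow>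
       flat_spec_map Tn Tk (toric_chart L' \<sigma>') (toric_chart L \<sigma>) (chart_pullback \<phi>))"

definition toric_morphism_reduced_fibres ::
  "'v::real_vector set \<Rightarrow> 'v set set \<Rightarrow> 'w::real_vector set \<Rightarrow> 'w set set \<Rightarrow> ('v \<Rightarrow> 'w) \<Rightarrow> bool"
  where "toric_morphism_reduced_fibres L \<Sigma> L' \<Sigma>' \<phi> \<longleftrightarrow>
    fan_morphism L \<Sigma> L' \<Sigma>' \<phi> \<and>
    (\<forall>\<sigma>\<in>\<Sigma>. \<forall>\<sigma>'\<in>\<Sigma>'. \<phi> ` \<sigma> \<subseteq> \<sigma>' \<longrightarrow>
       reduced_fibres_spec_map (toric_chart L' \<sigma>') (toric_chart L \<sigma>) (chart_pullback \<phi>))"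

section \<open>The quotient of \<open>(\<real>\<^sup>d)\<^sup>m\<close> by the diagonal\<close>

definition diag_rel :: "real^'d^'m \<Rightarrow> real^'d^'m \<Rightarrow> bool"
  where "diag_rel v w \<longleftrightarrow> (\<exists>u. \<forall>i. v $ i - w $ i = u)"

lemma equivp_diag_rel: "equivp (diag_rel :: real^'d^'m \<Rightarrow> real^'d^'m \<Rightarrow> bool)"
proof (rule equivpI)
  show "reflp (diag_rel :: real^'d^'m \<Rightarrow> _)"
    by (auto simp: reflp_def diag_rel_def)
  show "symp (diag_rel :: real^'d^'m \<Rightarrow> _)"
    unfolding symp_def diag_rel_def by (metis minus_diff_eq)
  show "transp (diag_rel :: real^'d^'m \<Rightarrow> _)"
    unfolding transp_def diag_rel_def by (metis diff_add_cancel add_diff_eq)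
qed

quotient_type ('d, 'm) diag_quot = "real^'d::finite^'m::finite" / diag_rel
  morphisms rep_diag_quot diag_proj
  by (rule equivp_diag_rel)

instantiation diag_quot :: (finite, finite) real_vector
begin

lift_definition zero_diag_quot :: "('a, 'b) diag_quot" is 0 .

lift_definition plus_diag_quot :: "('a, 'b) diag_quot \<Rightarrow> ('a, 'b) diag_quot \<Rightarrow> ('a, 'b) diag_quot"
  is "(+)"
  unfolding diag_rel_def by (metis (no_types, lifting) add_diff_add vector_add_component)

lift_definition minus_diag_quot :: "('a, 'b) diag_quot \<Rightarrow> ('a, 'b) diag_quot \<Rightarrow> ('a, 'b) diag_quot"
  is "(-)"
  unfolding diag_rel_def by (metis (no_types, lifting) diff_diff_eq2 diff_add_eq diff_diff_eq add.commute vector_minus_component)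

lift_definition uminus_diag_quot :: "('a, 'b) diag_quot \<Rightarrow> ('a, 'b) diag_quot"
  is "uminus"
  unfolding diag_rel_def by (metis minus_diff_minus vector_uminus_component)

lift_definition scaleR_diag_quot :: "real \<Rightarrow> ('a, 'b) diag_quot \<Rightarrow> ('a, 'b) diag_quot"
  is "scaleR"
  unfolding diag_rel_def by (metis scaleR_right_diff_distrib vector_scaleR_component)

instance
proof
  fix a b c :: "('a, 'b) diag_quot" and r s :: real
  have refl: "diag_rel x x" for x :: "real^'a^'b" by (simp add: diag_rel_def)
  show "a + b + c = a + (b + c)" by transfer (simp add: refl algebra_simps)
  show "a + b = b + a" by transfer (simp add: refl algebra_simps)
  show "0 + a = a" by transfer (simp add: refl)
  show "- a + a = 0" by transfer (simp add: refl)
  show "a - b = a + - b" by transfer (simp add: refl)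
  show "r *\<^sub>R (a + b) = r *\<^sub>R a + r *\<^sub>R b" by transfer (simp add: refl algebra_simps)
  show "(r + s) *\<^sub>R a = r *\<^sub>R a + s *\<^sub>R a" by transfer (simp add: refl algebra_simps)
  show "r *\<^sub>R s *\<^sub>R a = (r * s) *\<^sub>R a" by transfer (simp add: refl)
  show "1 *\<^sub>R a = a" by transfer (simp add: refl)
qed

end

text \<open>The quotient topology, which is the usual topology of this finite-dimensional space.\<close>
instantiation diag_quot :: (finite, finite) topological_space
begin

definition open_diag_quot :: "('a, 'b) diag_quot set \<Rightarrow> bool"
  where "open_diag_quot U \<longleftrightarrow> open (diag_proj -` U)"

instance
  by standard (auto simp: open_diag_quot_def vimage_Union)

end

lemma linear_diag_proj: "linear (diag_proj :: real^'d^'m \<Rightarrow> ('d::finite, 'm::finite) diag_quot)"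
  by (rule linearI) (simp_all add: plus_diag_quot.abs_eq scaleR_diag_quot.abs_eq)

section \<open>The fans \<open>\<Q>(P, m)\<close> and \<open>\<R>(P, m)\<close>\<close>

text \<open>The dimension \<open>d\<close> and the number \<open>m\<close> of factors are the sizes of the finite index types \<open>'d\<close> and
  \<open>'m\<close>; types are nonempty, so these are arbitrary integers \<open>\<ge> 1\<close>.\<close>

definition int_lattice :: "(real^'d^'m) set"
  where "int_lattice = {v. \<forall>i j. v $ i $ j \<in> \<int>}"

definition quotient_lattice :: "('d::finite, 'm::finite) diag_quot set"
  where "quotient_lattice = diag_proj ` int_lattice"

definition std_simplex :: "(real^'d) set"
  where "std_simplex = convex hull (insert 0 (range (\<lambda>i. axis i 1)))"

definition inner_normal_fan :: "'v::euclidean_space set \<Rightarrow> 'v set set"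
  where "inner_normal_fan P = {{v. \<forall>x\<in>F. \<forall>y\<in>P. v \<bullet> x \<le> v \<bullet> y} | F. F face_of P \<and> F \<noteq> {}}"

text \<open>The inner normal fan of the standard simplex consists of the cones generated by proper subsets of
  the \<open>d + 1\<close> vectors \<open>e\<^sub>1, \<dots>, e\<^sub>d, -(e\<^sub>1 + \<dots> + e\<^sub>d)\<close>.\<close>

definition simplex_vertex :: "'d option \<Rightarrow> real^'d"
  where "simplex_vertex k = (case k of None \<Rightarrow> 0 | Some i \<Rightarrow> axis i 1)"

definition simplex_ray :: "'d option \<Rightarrow> real^'d"
  where "simplex_ray k = (case k of None \<Rightarrow> - (\<Sum>i\<in>UNIV. axis i 1) | Some i \<Rightarrow> axis i 1)"

lemma std_simplex_vertices: "(std_simplex :: (real^'d) set) = convex hull (range simplex_vertex)"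
proof -
  have "range simplex_vertex = insert 0 (range (\<lambda>i. axis i 1 :: real^'d))"
    by (simp add: UNIV_option_conv image_image simplex_vertex_def)
  then show ?thesis by (simp add: std_simplex_def)
qed

lemma normal_cone_std_simplex:
  fixes c :: "'d::finite option set"
  assumes "c \<noteq> {}"
  shows "{v. \<forall>x\<in>convex hull (simplex_vertex ` c). \<forall>y\<in>std_simplex. v \<bullet> x \<le> v \<bullet> y}
    = convex_cone hull (simplex_ray ` (- c))" (is "?N = ?C")
proof -
  have N: "?N = {v. \<forall>k\<in>c. \<forall>l. v \<bullet> simplex_vertex k \<le> v \<bullet> simplex_vertex l}" (is "_ = ?M")
  proof (intro equalityI subsetI)
    fix v assume "v \<in> ?N"
    then show "v \<in> ?M"
      by (auto simp: std_simplex_vertices hull_inc)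
  next
    fix v :: "real^'d" assume v: "v \<in> ?M"
    have "v \<bullet> x \<le> v \<bullet> y"
      if x: "x \<in> convex hull (simplex_vertex ` c)" and y: "y \<in> std_simplex" for x y
    proof -
      obtain k where k: "k \<in> c" using assms by blast
      have "convex hull (simplex_vertex ` c) \<subseteq> {x. v \<bullet> x \<le> v \<bullet> simplex_vertex k}"
        by (rule hull_minimal) (use v k in \<open>auto simp: convex_halfspace_le\<close>)
      moreover have "std_simplex \<subseteq> {y. v \<bullet> y \<ge> v \<bullet> simplex_vertex k}"
        unfolding std_simplex_vertices
        by (rule hull_minimal) (use v k in \<open>auto simp: convex_halfspace_ge\<close>)
      ultimately show ?thesis using x y by fastforce
    qed
    then show "v \<in> ?N" by blast
  qed
  have axis_nth': "axis i (1::real) $ j = (if j = i then 1 else 0)" for i j :: 'd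
    by (simp add: axis_def)
  have ray_vertex: "simplex_ray k \<bullet> simplex_vertex l - simplex_ray k \<bullet> simplex_vertex l' =
      (if k = l then 1 else 0) - (if k = l' then 1 else (0::real))" for k l l' :: "'d option"
    by (auto simp: simplex_ray_def simplex_vertex_def inner_axis axis_nth' split: option.splits)
  have "?C \<subseteq> ?M"
  proof (rule hull_minimal)
    show "simplex_ray ` (- c) \<subseteq> ?M"
    proof clarify
      fix j k l assume "j \<notin> c" "k \<in> c"
      then show "simplex_ray j \<bullet> simplex_vertex k \<le> simplex_ray j \<bullet> simplex_vertex l"
        using ray_vertex[of j l k] by (auto split: if_splits)
    qed
    show "convex_cone ?M"
      unfolding convex_cone_iff
      by (auto simp: inner_add_left intro: add_mono mult_left_mono)
  qed
  moreover have "?M \<subseteq> ?C"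
  proof
    fix v :: "real^'d" assume v: "v \<in> ?M"
    obtain k where k: "k \<in> c" using assms by blast
    define \<mu> where "\<mu> = v \<bullet> simplex_vertex k"
    define a where "a l = v \<bullet> simplex_vertex l - \<mu>" for l
    have a0: "a l \<ge> 0" for l using v k by (auto simp: a_def \<mu>_def)
    have ac: "a l = 0" if "l \<in> c" for l
    proof -
      have "v \<bullet> simplex_vertex l \<le> \<mu>" using v that unfolding \<mu>_def by blast
      with a0[of l] show ?thesis by (simp add: a_def)
    qed
    have mem: "a l *\<^sub>R simplex_ray l \<in> ?C" for l
    proof (cases "l \<in> c")
      case True
      then show ?thesis by (simp add: ac convex_cone_hull_contains_0)
    next
      case False
      then show ?thesis by (intro convex_cone_hull_mul hull_inc a0) auto
    qed
    have "(\<Sum>l\<in>A. a l *\<^sub>R simplex_ray l) \<in> ?C" for A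
      by (induction A rule: infinite_finite_induct)
        (auto simp: convex_cone_hull_contains_0 intro: convex_cone_hull_add mem)
    moreover have "(\<Sum>l\<in>UNIV. a l *\<^sub>R simplex_ray l) = v"
    proof -
      have "(\<Sum>l\<in>UNIV. a l *\<^sub>R simplex_ray l) $ j = v $ j" for j
      proof -
        have "(\<Sum>l\<in>UNIV. a l *\<^sub>R simplex_ray l) =
            a None *\<^sub>R simplex_ray None + (\<Sum>i\<in>UNIV. a (Some i) *\<^sub>R simplex_ray (Some i))"
          by (simp add: UNIV_option_conv sum.reindex)
        also have "\<dots> $ j = v $ j"
          by (simp add: a_def simplex_ray_def simplex_vertex_def inner_axis axis_nth'
              if_distrib[of "(*) _"] cong: if_cong)
        finally show ?thesis .
      qed
      then show ?thesis by (simp add: vec_eq_iff)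
    qed
    ultimately show "v \<in> ?C" by metis
  qed
  ultimately show ?thesis using N by simp
qed

lemma inj_simplex_ray: "inj (simplex_ray :: 'd::finite option \<Rightarrow> real^'d)"
proof (rule injI)
  fix k l :: "'d option"
  assume "simplex_ray k = simplex_ray l"
  then have eq: "simplex_ray k $ j = (simplex_ray l :: real^'d) $ j" for j by simp
  show "k = l"
  proof (cases k; cases l)
    fix i assume "k = None" "l = Some i"
    then show ?thesis using eq[of i] by (simp add: simplex_ray_def axis_def)
  next
    fix i assume "k = Some i" "l = None"
    then show ?thesis using eq[of i] by (simp add: simplex_ray_def axis_def)
  next
    fix i i' assume "k = Some i" "l = Some i'"
    then show ?thesis using eq[of i] by (simp add: simplex_ray_def axis_def split: if_splits)
  qed auto
qed

lemma affine_independent_simplex_vertices: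
  "\<not> affine_dependent (range (simplex_vertex :: 'd::finite option \<Rightarrow> real^'d))"
proof -
  have "range (simplex_vertex :: 'd option \<Rightarrow> real^'d) = insert 0 Basis"
    by (auto simp: UNIV_option_conv image_image simplex_vertex_def Basis_vec_def)
  then show ?thesis
    using affine_dependent_iff_dependent[of 0 "Basis :: (real^'d) set"] independent_Basis by auto
qed

lemma inner_normal_fan_std_simplex:
  "inner_normal_fan (std_simplex :: (real^'d::finite) set) =
     {convex_cone hull A | A. A \<subset> range simplex_ray}"
proof -
  have F: "F face_of (std_simplex :: (real^'d) set) \<and> F \<noteq> {} \<longleftrightarrow>
      (\<exists>c. c \<noteq> {} \<and> F = convex hull (simplex_vertex ` c))" for F
    unfolding std_simplex_vertices
      face_of_convex_hull_affine_independent[OF affine_independent_simplex_vertices]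
    by (metis convex_hull_eq_empty image_is_empty subset_image_iff subset_UNIV)
  have A: "A \<subset> range (simplex_ray :: 'd option \<Rightarrow> real^'d) \<longleftrightarrow>
      (\<exists>c. c \<noteq> {} \<and> A = simplex_ray ` (- c))" for A
  proof
    assume "A \<subset> range (simplex_ray :: 'd option \<Rightarrow> real^'d)"
    then obtain B where B: "A = simplex_ray ` B" by (meson psubset_imp_subset subset_image_iff)
    then show "\<exists>c. c \<noteq> {} \<and> A = simplex_ray ` (- c)"
      using \<open>A \<subset> _\<close> by (intro exI[of _ "- B"]) auto
  next
    assume "\<exists>c. c \<noteq> {} \<and> A = simplex_ray ` (- c)"
    then obtain c where c: "c \<noteq> {}" "A = simplex_ray ` (- c)" by blast
    then have "- c \<noteq> UNIV" by blast
    then have "A \<noteq> range simplex_ray"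
      unfolding c inj_image_eq_iff[OF inj_simplex_ray] .
    with c show "A \<subset> range (simplex_ray :: 'd option \<Rightarrow> real^'d)" by blast
  qed
  show ?thesis
  proof (intro equalityI subsetI)
    fix C assume "C \<in> inner_normal_fan (std_simplex :: (real^'d) set)"
    then obtain F where "F face_of (std_simplex :: (real^'d) set) \<and> F \<noteq> {}"
      and C: "C = {v. \<forall>x\<in>F. \<forall>y\<in>std_simplex. v \<bullet> x \<le> v \<bullet> y}"
      unfolding inner_normal_fan_def by blast
    then obtain c where c: "c \<noteq> {}" "F = convex hull (simplex_vertex ` c)"
      unfolding F by blast
    have "C = convex_cone hull (simplex_ray ` (- c))"
      unfolding C c(2) by (rule normal_cone_std_simplex[OF c(1)])
    with c(1) show "C \<in> {convex_cone hull A | A. A \<subset> range simplex_ray}"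
      unfolding A by blast
  next
    fix C :: "(real^'d) set" assume "C \<in> {convex_cone hull A | A. A \<subset> range simplex_ray}"
    then obtain c where c: "c \<noteq> {}" "C = convex_cone hull (simplex_ray ` (- c))"
      unfolding A by blast
    have "C = {v. \<forall>x\<in>convex hull (simplex_vertex ` c). \<forall>y\<in>std_simplex. v \<bullet> x \<le> v \<bullet> y}"
      unfolding c(2) by (rule normal_cone_std_simplex[OF c(1), symmetric])
    moreover have "convex hull (simplex_vertex ` c) face_of (std_simplex :: (real^'d) set) \<and>
        convex hull (simplex_vertex ` c) \<noteq> {}"
      unfolding F using c(1) by blast
    ultimately show "C \<in> inner_normal_fan std_simplex"
      unfolding inner_normal_fan_def by blast
  qed
qed

definition product_fan :: "(real^'d) set set \<Rightarrow> (real^'d^'m) set set"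
  where "product_fan \<Sigma> = {{v. \<forall>i. v $ i \<in> \<tau> i} | \<tau>. \<forall>i. \<tau> i \<in> \<Sigma>}"

definition quot_equiv :: "(real^'d) set set \<Rightarrow> ('d::finite, 'm::finite) diag_quot \<Rightarrow> ('d, 'm) diag_quot \<Rightarrow> bool"
  where "quot_equiv \<Sigma> v w \<longleftrightarrow>
    (\<forall>\<tau>\<in>product_fan \<Sigma>. v \<in> diag_proj ` \<tau> \<longleftrightarrow> w \<in> diag_proj ` \<tau>)"

definition quotient_fan :: "(real^'d) set \<Rightarrow> ('d::finite, 'm::finite) diag_quot set set"
  where "quotient_fan P = {closure {w. quot_equiv (inner_normal_fan P) v w} | v. True}"

definition refined_fan :: "(real^'d) set \<Rightarrow> (real^'d::finite^'m::finite) set set"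
  where "refined_fan P = {diag_proj -` \<xi> \<inter> \<tau> | \<xi> \<tau>.
    \<xi> \<in> quotient_fan P \<and> \<tau> \<in> product_fan (inner_normal_fan P)}"

lemma fan_morphism_diag_proj:
  "fan_morphism int_lattice (refined_fan P) quotient_lattice (quotient_fan P)
     (diag_proj :: real^'d^'m \<Rightarrow> ('d::finite, 'm::finite) diag_quot)"
  unfolding fan_morphism_def quotient_lattice_def refined_fan_def
  using linear_diag_proj by blast

end

(*
  Describe a point y of (R^d)^m by the matrix V with entries V i k = <y_i, k-th vertex of the simplex>. A cone
  of the product fan is given by a set c of cells (i, k) at which V is minimal in row i. Hence the class
  [y] lies in its image iff, after adding some potential x k to each column k, all cells of c are minimal in
  their rows, i.e. iff c consists of cells used by optimal transport plans for the cost matrix V (linear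
  programming duality). So the cones of the quotient fan are the images of the sets
  {z. tight y <= tight z}, where tight y collects these c.

  Exponents on a chart of the refined fan are integer matrices with vanishing row sums. Shortest
  paths give integer optimal plans; therefore every exponent is e + (a o q) with a character a of the base
  and an exponent e which vanishes on a section of q over the cone. Such minimal exponents are
  unique modulo characters of the base that are invertible on the chart, and they span free
  modules over the base. Near a point of the chart the base may be localized at a face of its cone, and so
  the local ring is a directed union of free modules: f is flat. For reducedness, grade the chart by the
  cosets of the characters of the base. Multiples of minimal exponents are minimal, so the leading
  homogeneous part of an element of the fibre contributes its n-th power, without cancellation, to the
  n-th power of the element.
*)
theory Submission
  imports Defs
begin

subsection \<open>Shortest paths and potentials\<close>

text \<open>Two obstacles shape the argument. First, exponents form a lattice, so optimal plans must
  be integral: hence improving cycles of integer matrices and minima over integer matrices instead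
  of real duality, and hence the rounding up of real Farkas coefficients when a cone of the base is
  compared with a face. Second, the toric morphism is tested on every pair \<open>\<sigma>\<close>,
  \<open>\<sigma>'\<close> with \<open>\<sigma>\<close> mapped into \<open>\<sigma>'\<close>, not
  only on the smallest such \<open>\<sigma>'\<close>. A character that is nonnegative on the image
  of \<open>\<sigma>\<close> may be negative on \<open>\<sigma>'\<close>; adding a character of
  \<open>\<sigma>'\<close> that vanishes on the image repairs this. The added character pulls back
  to a unit of the chart upstairs, but how large it must be depends on the exponents at hand. In
  general no single basis serves the whole chart, and this is why freeness is only asked around
  finite sets of elements. The same units enter the proof of reducedness, where they are harmless
  because a unit lies in no prime ideal.\<close>

fun walk_weight :: "('k \<Rightarrow> 'k \<Rightarrow> real) \<Rightarrow> 'k list \<Rightarrow> real" where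
  "walk_weight W (x # y # zs) = W x y + walk_weight W (y # zs)"
| "walk_weight W _ = 0"

lemma walk_weight_append:
  "walk_weight W (xs @ l # ys) = walk_weight W (xs @ [l]) + walk_weight W (l # ys)"
  by (induction xs rule: induct_list012) auto

lemma walk_weight_snoc:
  "ks \<noteq> [] \<Longrightarrow> walk_weight W (ks @ [l]) = walk_weight W ks + W (last ks) l"
  by (induction ks rule: induct_list012) auto

text \<open>Shortest-path potentials: \<open>p l\<close> is the least weight of a path to
  \<open>l\<close> from any start. Edges are only taken out of vertices in \<open>A\<close>, so only
  cycles inside \<open>A\<close> have to be nonnegative; later \<open>A\<close> consists of the
  columns from which a unit can be removed.\<close>

lemma potential_exists:
  fixes W :: "'k::finite \<Rightarrow> 'k \<Rightarrow> real"
  assumes cycle: "\<And>x xs. distinct (x # xs) \<Longrightarrow> set (x # xs) \<subseteq> A \<Longrightarrow> 0 \<le> walk_weight W (x # xs @ [x])"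
  shows "\<exists>p. \<forall>k\<in>A. \<forall>l. p l \<le> p k + W k l"
proof -
  \<comment> \<open>Only the last vertex may lie outside \<open>A\<close>. The path
    \<open>[l]\<close> keeps the set nonempty and distinctness keeps it finite, so the minimum
    exists.\<close>
  define paths where "paths l = {ks. ks \<noteq> [] \<and> distinct ks \<and> set (butlast ks) \<subseteq> A \<and> last ks = l}" for l
  define p where "p l = Min (walk_weight W ` paths l)" for l
  have "paths l \<subseteq> {ks. set ks \<subseteq> UNIV \<and> length ks \<le> CARD('k)}" for l
    unfolding paths_def by (auto simp: card_mono simp flip: distinct_card)
  from this finite_lists_length_le[OF finite] have fin: "finite (paths l)" for l
    by (rule finite_subset)
  have ne: "paths l \<noteq> {}" for l
    unfolding paths_def by (auto intro!: exI[of _ "[l]"])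
  have p_le: "p l \<le> walk_weight W ks" if "ks \<in> paths l" for l ks
    unfolding p_def using fin that by auto
  have p_ex: "\<exists>ks\<in>paths l. p l = walk_weight W ks" for l
    using Min_in[of "walk_weight W ` paths l"] fin ne unfolding p_def by blast
  show ?thesis
  proof (intro exI ballI allI)
    fix k l assume k: "k \<in> A"
    obtain ks where ks: "ks \<in> paths k" "p k = walk_weight W ks" using p_ex by blast
    have ksA: "set ks \<subseteq> A"
    proof -
      have "ks = butlast ks @ [k]" using ks(1) unfolding paths_def by auto
      then have "set ks = insert k (set (butlast ks))"
        by (metis list.simps(15) rotate1.simps(2) set_append set_rotate1)
      then show ?thesis using ks(1) k unfolding paths_def by auto
    qed
    show "p l \<le> p k + W k l"
    proof (cases "l \<in> set ks")
      case False
      then have "ks @ [l] \<in> paths l"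
        using ks(1) ksA unfolding paths_def by auto
      then have "p l \<le> walk_weight W (ks @ [l])" by (rule p_le)
      then show ?thesis
        using ks walk_weight_snoc[of ks W l] unfolding paths_def by auto
    next
      \<comment> \<open>The extended path would revisit \<open>l\<close>. Cutting \<open>ks\<close>
        at \<open>l\<close> leaves a path to \<open>l\<close>, and what is cut off closes up,
        through the edge from \<open>k\<close> to \<open>l\<close>, to a cycle of nonnegative
        weight.\<close>
      case True
      then obtain xs ys where xy: "ks = xs @ l # ys" by (meson split_list)
      have "xs @ [l] \<in> paths l"
        using ks(1) ksA unfolding paths_def xy by auto
      then have "p l \<le> walk_weight W (xs @ [l])" by (rule p_le)
      moreover have "0 \<le> walk_weight W (l # ys @ [l])"
        using ks(1) ksA unfolding paths_def xy by (intro cycle) auto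
      moreover have "walk_weight W (l # ys @ [l]) = walk_weight W (l # ys) + W k l"
        using walk_weight_snoc[of "l # ys" W l] ks(1) unfolding paths_def xy by simp
      ultimately show ?thesis
        using ks(2) walk_weight_append[of W xs l ys] unfolding xy by linarith
    qed
  qed
qed

subsection \<open>Optimal transport and tight sets\<close>

text \<open>Dual feasibility with complementary slackness: \<open>x\<close> is the column part of a
  dual solution of the transport problem with costs \<open>V\<close>, its row part being the row
  minima of \<open>V i l + x l\<close>. As a family of sets of cells it records the combinatorial
  type of \<open>V\<close>.\<close>

definition tight :: "('m \<Rightarrow> 'k \<Rightarrow> real) \<Rightarrow> ('m \<times> 'k) set set"
  where "tight V = {c. \<exists>x. \<forall>(i, k)\<in>c. \<forall>l. V i k + x k \<le> V i l + x l}"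

definition cost :: "('m::finite \<Rightarrow> 'k::finite \<Rightarrow> int) \<Rightarrow> ('m \<Rightarrow> 'k \<Rightarrow> real) \<Rightarrow> real"
  where "cost e V = (\<Sum>i\<in>UNIV. \<Sum>k\<in>UNIV. of_int (e i k) * V i k)"

text \<open>Circulations: the differences of transport plans with equal marginals. As linear forms
  they are constant along the diagonal.\<close>

definition balanced :: "('m::finite \<Rightarrow> 'k::finite \<Rightarrow> int) \<Rightarrow> bool"
  where "balanced e \<longleftrightarrow> (\<forall>i. (\<Sum>k\<in>UNIV. e i k) = 0) \<and> (\<forall>k. (\<Sum>i\<in>UNIV. e i k) = 0)"

definition nonneg_off :: "('m \<times> 'k) set \<Rightarrow> ('m \<Rightarrow> 'k \<Rightarrow> int) \<Rightarrow> bool"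
  where "nonneg_off b e \<longleftrightarrow> (\<forall>i k. (i, k) \<notin> b \<longrightarrow> 0 \<le> e i k)"

definition pos_cells :: "('m \<Rightarrow> 'k \<Rightarrow> int) \<Rightarrow> ('m \<times> 'k) set"
  where "pos_cells e = {(i, k). 0 < e i k}"

lemma cost_add: "cost (e + e') V = cost e V + cost e' V"
  by (simp add: cost_def sum.distrib algebra_simps)

lemma cost_diff: "cost (e - e') V = cost e V - cost e' V"
  by (simp add: cost_def sum_subtractf algebra_simps)

lemma cost_add_right: "cost e (V + V') = cost e V + cost e V'"
  by (simp add: cost_def sum.distrib algebra_simps)

lemma balanced_add: "balanced e \<Longrightarrow> balanced e' \<Longrightarrow> balanced (e + e')"
  by (simp add: balanced_def sum.distrib)

lemma balanced_uminus: "balanced (- e) \<longleftrightarrow> balanced e"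
  by (simp add: balanced_def sum_negf)

lemma balanced_minus_commute: "balanced (e - e') \<longleftrightarrow> balanced (e' - e)"
  by (metis balanced_uminus minus_diff_eq)

lemma tight_mono: "c \<in> tight V \<Longrightarrow> c' \<subseteq> c \<Longrightarrow> c' \<in> tight V"
  unfolding tight_def by blast

text \<open>The matrix of the closed walk \<open>ks\<close>: the step from \<open>x\<close> to \<open>y\<close> moves one unit from column \<open>x\<close> to
  column \<open>y\<close> within row \<open>\<rho> x y\<close>.\<close>
fun walk_matrix :: "('k \<Rightarrow> 'k \<Rightarrow> 'm) \<Rightarrow> 'k list \<Rightarrow> 'm \<Rightarrow> 'k \<Rightarrow> int" where
  "walk_matrix \<rho> (x # y # zs) = (\<lambda>i k. (if \<rho> x y = i then of_bool (y = k) - of_bool (x = k) else 0) +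
     walk_matrix \<rho> (y # zs) i k)"
| "walk_matrix \<rho> _ = (\<lambda>i k. 0)"

lemma sum_of_bool_mult_UNIV: "(\<Sum>k\<in>UNIV. of_bool (x = k) * f k) = (f x :: 'a::semiring_1)" for x :: "'k::finite"
  by (simp add: of_bool_def if_distrib[of "\<lambda>t. t * _"] cong: if_cong)

lemma sum_of_bool_UNIV: "(\<Sum>k\<in>UNIV. of_bool (x = k)) = (1 :: 'a::semiring_1)" for x :: "'k::finite"
  by (simp add: of_bool_def)

lemma cost_walk_matrix:
  fixes V :: "'m::finite \<Rightarrow> 'k::finite \<Rightarrow> real"
  shows "cost (walk_matrix \<rho> ks) V = walk_weight (\<lambda>x y. V (\<rho> x y) y - V (\<rho> x y) x) ks"
proof (induction ks rule: induct_list012)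
  case (3 x y zs)
  have "cost (\<lambda>i k. if \<rho> x y = i then of_bool (y = k) - of_bool (x = k) else 0) V =
      (\<Sum>i\<in>UNIV. of_bool (\<rho> x y = i) * (\<Sum>k\<in>UNIV. (of_bool (y = k) - of_bool (x = k)) * V i k))"
    unfolding cost_def by (intro sum.cong refl) auto
  also have "\<dots> = V (\<rho> x y) y - V (\<rho> x y) x"
    unfolding sum_of_bool_mult_UNIV by (simp add: left_diff_distrib sum_subtractf sum_of_bool_mult_UNIV)
  finally show ?case
    using 3 cost_add[of "\<lambda>i k. if \<rho> x y = i then of_bool (y = k) - of_bool (x = k) else 0"
        "walk_matrix \<rho> (y # zs)" V]
    by (simp add: plus_fun_def)
qed (auto simp: cost_def)

lemma walk_matrix_row_sum:
  "(\<Sum>k\<in>UNIV. walk_matrix \<rho> ks i k) = 0" for ks :: "'k::finite list"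
proof (induction ks rule: induct_list012)
  case (3 x y zs)
  then show ?case
    by (cases "\<rho> x y = i") (simp_all add: sum.distrib sum_subtractf sum_of_bool_UNIV)
qed auto

lemma walk_matrix_column_sum:
  "ks \<noteq> [] \<Longrightarrow> (\<Sum>i\<in>UNIV. walk_matrix \<rho> ks i k) = of_bool (last ks = k) - of_bool (hd ks = k)"
  for \<rho> :: "'k \<Rightarrow> 'k \<Rightarrow> 'm::finite"
  by (induction ks rule: induct_list012) (auto simp: sum.distrib sum_subtractf sum_of_bool_UNIV)

text \<open>With \<open>butlast ks\<close> distinct each column is left at most once, so it loses at
  most one unit, in the row of that one step.\<close>

lemma walk_matrix_ge:
  assumes "distinct (butlast ks)"
  shows "(if k \<in> set (butlast ks) \<and> (\<exists>y. \<rho> k y = i) then - 1 else 0) \<le> walk_matrix \<rho> ks i k"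
  using assms
proof (induction ks rule: induct_list012)
  case (3 x y zs)
  then show ?case
    by (cases "x = k") (auto split: if_splits simp: of_bool_def)
qed auto

text \<open>Cycle cancelling: if the exchange costs \<open>W\<close> had a negative cycle, adding
  its matrix to \<open>e\<close> would give a cheaper admissible matrix. So \<open>W\<close> admits
  a potential, and this is the dual solution up to sign.\<close>

lemma tight_of_optimal:
  fixes V :: "'m::finite \<Rightarrow> 'k::finite \<Rightarrow> real"
  assumes e: "nonneg_off b e"
    and opt: "\<And>e'. nonneg_off b e' \<Longrightarrow> balanced (e' - e) \<Longrightarrow> cost e V \<le> cost e' V"
  shows "b \<union> pos_cells e \<in> tight V"
proof -
  define c where "c = b \<union> pos_cells e"
  \<comment> \<open>The cheapest row, among the cells of \<open>c\<close> in column
    \<open>k\<close>, in which to move a unit from column \<open>k\<close> to column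
    \<open>l\<close>.\<close>
  define \<rho> where "\<rho> k l = (ARG_MIN (\<lambda>i. V i l - V i k) i. (i, k) \<in> c)" for k l
  define W where "W x y = V (\<rho> x y) y - V (\<rho> x y) x" for x y
  have \<rho>: "(\<rho> k l, k) \<in> c \<and> W k l \<le> V i l - V i k" if "(i, k) \<in> c" for i k l
  proof -
    have "is_arg_min (\<lambda>i. V i l - V i k) (\<lambda>i. (i, k) \<in> c) (\<rho> k l)"
      unfolding \<rho>_def arg_min_def
    proof (rule someI_ex)
      have "{i. (i, k) \<in> c} \<noteq> {}" using that by blast
      from ex_is_arg_min_if_finite[OF finite this]
      obtain j where "is_arg_min (\<lambda>i. V i l - V i k) (\<lambda>i. (i, k) \<in> c) j" by auto
      then show "\<exists>j. is_arg_min (\<lambda>i. V i l - V i k) (\<lambda>i. (i, k) \<in> c) j" ..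
    qed
    then show ?thesis using that unfolding is_arg_min_linorder W_def by blast
  qed
  have "\<exists>p. \<forall>k\<in>snd ` c. \<forall>l. p l \<le> p k + W k l"
  proof (rule potential_exists, rule ccontr)
    fix x xs assume ks: "distinct (x # xs)" "set (x # xs) \<subseteq> snd ` c"
      and neg: "\<not> 0 \<le> walk_weight W (x # xs @ [x])"
    define r where "r = walk_matrix \<rho> (x # xs @ [x])"
    have bl: "butlast (x # xs @ [x]) = x # xs" by (simp add: butlast_append)
    have "balanced r"
      unfolding balanced_def r_def using walk_matrix_row_sum walk_matrix_column_sum[of "x # xs @ [x]" \<rho>]
      by auto
    moreover have "nonneg_off b (e + r)"
      unfolding nonneg_off_def
    proof (intro allI impI)
      fix i k assume ik: "(i, k) \<notin> b"
      have ge: "(if k \<in> set (x # xs) \<and> (\<exists>y. \<rho> k y = i) then - 1 else 0) \<le> r i k"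
        using walk_matrix_ge[of "x # xs @ [x]" k \<rho> i] ks(1) unfolding r_def bl by blast
      show "0 \<le> (e + r) i k"
      proof (cases "k \<in> set (x # xs) \<and> (\<exists>y. \<rho> k y = i)")
        \<comment> \<open>Cells of \<open>b\<close> may become negative, and \<open>e\<close> is at
          least 1 on the other cells of \<open>c\<close>, so losing one unit is allowed.\<close>
        case True
        then obtain j where "(j, k) \<in> c" using ks(2) by force
        then have "(i, k) \<in> c" using \<rho> True by blast
        then have "0 < e i k" using ik by (simp add: c_def pos_cells_def)
        then show ?thesis using ge True by simp
      next
        case False
        then have "0 \<le> r i k" using ge by (simp only: if_False)
        then show ?thesis using e ik by (simp add: nonneg_off_def)
      qed
    qed
    ultimately have "cost e V \<le> cost (e + r) V" by (intro opt) simp_all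
    also have "cost (e + r) V = cost e V + walk_weight W (x # xs @ [x])"
      unfolding cost_add r_def cost_walk_matrix W_def ..
    finally show False using neg by simp
  qed
  then obtain p where p: "\<And>k l. k \<in> snd ` c \<Longrightarrow> p l \<le> p k + W k l" by blast
  have "V i k + - p k \<le> V i l + - p l" if "(i, k) \<in> c" for i k l
    using p[of k l] \<rho>[OF that, of l] that by force
  then show ?thesis unfolding tight_def c_def[symmetric] by (intro CollectI exI[of _ "\<lambda>k. - p k"]) auto
qed

text \<open>Row and column potentials change the cost of no balanced matrix. Subtracting the dual
  solution therefore gives costs that are nonnegative and vanish on \<open>c\<close>, without
  affecting any comparison of plans with equal marginals.\<close>

lemma reduced_costs:
  fixes V :: "'m::finite \<Rightarrow> 'k::finite \<Rightarrow> real"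
  assumes c: "c \<in> tight V"
  obtains w where "\<And>i k. 0 \<le> w i k" "\<And>i k. (i, k) \<in> c \<Longrightarrow> w i k = 0"
    "\<And>d. balanced d \<Longrightarrow> cost d V = cost d w"
proof -
  obtain x where x: "\<And>i k l. (i, k) \<in> c \<Longrightarrow> V i k + x k \<le> V i l + x l"
    using c unfolding tight_def by blast
  define y where "y i = Min (range (\<lambda>l. V i l + x l))" for i
  have y: "y i \<le> V i l + x l" for i l unfolding y_def by auto
  have y_eq: "V i k + x k = y i" if "(i, k) \<in> c" for i k
    using x[OF that] unfolding y_def by (intro antisym) auto
  have "cost d V = cost d (\<lambda>i k. V i k + x k - y i)" if d: "balanced d" for d
  proof -
    have "(\<Sum>i\<in>UNIV. \<Sum>k\<in>UNIV. d i k * x k) = (\<Sum>k\<in>UNIV. of_int (\<Sum>i\<in>UNIV. d i k) * x k)"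
      by (subst sum.swap) (simp add: sum_distrib_right)
    also have "\<dots> = 0" using d by (simp add: balanced_def del: of_int_sum)
    finally have "(\<Sum>i\<in>UNIV. \<Sum>k\<in>UNIV. d i k * x k) = 0" .
    moreover have "(\<Sum>i\<in>UNIV. \<Sum>k\<in>UNIV. d i k * y i) = (\<Sum>i\<in>UNIV. of_int (\<Sum>k\<in>UNIV. d i k) * y i)"
      by (simp add: sum_distrib_right)
    then have "(\<Sum>i\<in>UNIV. \<Sum>k\<in>UNIV. d i k * y i) = 0"
      using d by (simp add: balanced_def del: of_int_sum)
    ultimately show ?thesis
      by (simp add: cost_def ring_distribs sum.distrib sum_subtractf)
  qed
  then show thesis
    using y y_eq by (intro that[of "\<lambda>i k. V i k + x k - y i"]) auto
qed

text \<open>The easy half of duality: after passing to reduced costs every summand is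
  nonnegative.\<close>

lemma cost_nonneg_of_tight:
  fixes V :: "'m::finite \<Rightarrow> 'k::finite \<Rightarrow> real"
  assumes c: "c \<in> tight V" and d: "balanced d" "nonneg_off c d"
  shows "0 \<le> cost d V"
proof -
  obtain w where w: "\<And>i k. 0 \<le> w i k" "\<And>i k. (i, k) \<in> c \<Longrightarrow> w i k = 0" "cost d V = cost d w"
    using reduced_costs[OF c] d(1) by metis
  have "0 \<le> d i k * w i k" for i k
    using d(2) w(1)[of i k] w(2)[of i k] by (cases "(i, k) \<in> c") (auto simp: nonneg_off_def)
  then have "0 \<le> cost d w" unfolding cost_def by (intro sum_nonneg)
  then show ?thesis unfolding w(3) .
qed

lemma finite_bounded_matrices:
  "finite {f :: 'm::finite \<Rightarrow> 'k::finite \<Rightarrow> int. \<forall>i k. f i k \<in> {0..B}}"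
proof -
  have 1: "finite {g :: 'k \<Rightarrow> int. \<forall>k. g k \<in> {0..B}}"
    using finite_set_of_finite_funs[of "UNIV :: 'k set" "{0..B}" 0] by simp
  show ?thesis
    using finite_set_of_finite_funs[of "UNIV :: 'm set" "{g :: 'k \<Rightarrow> int. \<forall>k. g k \<in> {0..B}}" undefined] 1 by simp
qed

text \<open>Nonnegativity and the prescribed row sums bound each entry by the total mass.\<close>

lemma finite_transport_polytope:
  fixes e :: "'m::finite \<Rightarrow> 'k::finite \<Rightarrow> int"
  shows "finite {f. nonneg_off {} f \<and> balanced (f - e)}" (is "finite ?F")
proof -
  define B where "B = (\<Sum>i\<in>UNIV. \<Sum>k\<in>UNIV. e i k)"
  have bound: "f i k \<in> {0..B}" if "f \<in> ?F" for f i k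
  proof -
    have nn: "0 \<le> f i k" for i k using that by (auto simp: nonneg_off_def)
    have row: "(\<Sum>k\<in>UNIV. f i k) = (\<Sum>k\<in>UNIV. e i k)" for i
      using that by (simp add: balanced_def sum_subtractf)
    have "f i k \<le> (\<Sum>k\<in>UNIV. f i k)" using nn by (intro member_le_sum) auto
    also have "\<dots> \<le> (\<Sum>i\<in>UNIV. \<Sum>k\<in>UNIV. f i k)"
      using nn by (intro member_le_sum[of i UNIV "\<lambda>i. \<Sum>k\<in>UNIV. f i k"]) (auto intro: sum_nonneg)
    finally show ?thesis using nn row by (simp add: B_def)
  qed
  show ?thesis by (rule finite_subset[OF _ finite_bounded_matrices[of B]]) (use bound in auto)
qed

text \<open>Minimize over the finitely many integral plans with the marginals of \<open>e\<close>.
  Because the support stays tight for every cost matrix whose type contains that of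
  \<open>V\<close>, one plan serves a whole closed chamber at once.\<close>

lemma optimal_transport_exists:
  fixes e :: "'m::finite \<Rightarrow> 'k::finite \<Rightarrow> int"
  assumes e: "nonneg_off {} e"
  obtains f where "nonneg_off {} f" "balanced (e - f)" "pos_cells f \<in> tight V"
proof -
  define F where "F = {f. nonneg_off {} f \<and> balanced (f - e)}"
  have fin: "finite F" unfolding F_def by (rule finite_transport_polytope)
  have "e \<in> F" using e unfolding F_def balanced_def by simp
  then have "F \<noteq> {}" by blast
  from ex_is_arg_min_if_finite[OF fin this, of "\<lambda>f. cost f V"]
  obtain f where f: "f \<in> F" "\<And>g. g \<in> F \<Longrightarrow> cost f V \<le> cost g V"
    unfolding is_arg_min_linorder by blast
  have "{} \<union> pos_cells f \<in> tight V"
  proof (rule tight_of_optimal)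
    show "nonneg_off {} f" using f unfolding F_def by simp
    fix g assume g: "nonneg_off {} g" "balanced (g - f)"
    have "balanced ((g - f) + (f - e))"
      using g f(1) by (intro balanced_add) (auto simp: F_def)
    then show "cost f V \<le> cost g V"
      by (intro f) (auto simp: F_def g)
  qed
  then show thesis using that[of f] f(1) unfolding F_def by (auto simp: balanced_minus_commute)
qed

section \<open>Tightness as optimality of a 0/1 plan\<close>

abbreviation cell_matrix :: "('m \<times> 'k) set \<Rightarrow> 'm \<Rightarrow> 'k \<Rightarrow> int"
  where "cell_matrix c \<equiv> \<lambda>i k. of_bool ((i, k) \<in> c)"

text \<open>Eliminates the potential: for each \<open>c\<close>, tightness becomes a system of
  linear inequalities in \<open>V\<close>, indexed by finitely many integral plans. Closedness of
  chambers and the Farkas argument both rest on this form.\<close>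

lemma tight_iff_optimal:
  "c \<in> tight V \<longleftrightarrow>
    (\<forall>g. nonneg_off {} g \<longrightarrow> balanced (g - cell_matrix c) \<longrightarrow> cost (cell_matrix c) V \<le> cost g V)"
proof
  assume c: "c \<in> tight V"
  show "\<forall>g. nonneg_off {} g \<longrightarrow> balanced (g - cell_matrix c) \<longrightarrow> cost (cell_matrix c) V \<le> cost g V"
  proof (intro allI impI)
    fix g assume g: "nonneg_off {} g" "balanced (g - cell_matrix c)"
    have "0 \<le> cost (g - cell_matrix c) V"
      by (rule cost_nonneg_of_tight[OF c g(2)]) (use g(1) in \<open>auto simp: nonneg_off_def\<close>)
    then show "cost (cell_matrix c) V \<le> cost g V" by (simp add: cost_diff)
  qed
next
  assume "\<forall>g. nonneg_off {} g \<longrightarrow> balanced (g - cell_matrix c) \<longrightarrow> cost (cell_matrix c) V \<le> cost g V"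
  then have "{} \<union> pos_cells (cell_matrix c) \<in> tight V"
    by (intro tight_of_optimal) (auto simp: nonneg_off_def)
  moreover have "pos_cells (cell_matrix c) = c" by (auto simp: pos_cells_def)
  ultimately show "c \<in> tight V" by simp
qed

text \<open>An optimal plan \<open>f\<close> for \<open>V\<close> with the marginals of
  \<open>c\<close> is also optimal for \<open>W\<close> and for \<open>W'\<close>. If
  \<open>c\<close> is optimal for the sum, it cannot beat \<open>f\<close> for either summand, so it
  must tie with \<open>f\<close> for both.\<close>

lemma tight_add:
  fixes V W W' :: "'m::finite \<Rightarrow> 'k::finite \<Rightarrow> real"
  assumes "tight V \<subseteq> tight W" "tight V \<subseteq> tight W'"
  shows "tight (W + W') = tight W \<inter> tight W'"
proof (intro equalityI subsetI IntI)
  fix c assume "c \<in> tight W \<inter> tight W'"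
  then obtain x x' where x:
    "\<And>i k l. (i, k) \<in> c \<Longrightarrow> W i k + x k \<le> W i l + x l"
    "\<And>i k l. (i, k) \<in> c \<Longrightarrow> W' i k + x' k \<le> W' i l + x' l"
    unfolding tight_def by blast
  then have "(W + W') i k + (x + x') k \<le> (W + W') i l + (x + x') l" if "(i, k) \<in> c" for i k l
    using add_mono[OF x(1)[OF that, of l] x(2)[OF that, of l]] by (simp add: algebra_simps)
  then show "c \<in> tight (W + W')" unfolding tight_def by (intro CollectI exI[of _ "x + x'"]) auto
next
  fix c assume c: "c \<in> tight (W + W')"
  obtain f where f: "nonneg_off {} f" "balanced (cell_matrix c - f)" "pos_cells f \<in> tight V"
    using optimal_transport_exists[of "cell_matrix c" V] by (auto simp: nonneg_off_def)
  have f_opt: "cost f U \<le> cost g U" if "tight V \<subseteq> tight U" "nonneg_off {} g" "balanced (g - cell_matrix c)" for U g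
  proof -
    have "0 \<le> cost (g - f) U"
    proof (rule cost_nonneg_of_tight)
      show "pos_cells f \<in> tight U" using that f by auto
      show "balanced (g - f)" using balanced_add[OF that(3) f(2)] by simp
      show "nonneg_off (pos_cells f) (g - f)"
        using that(2) f(1) by (auto simp: nonneg_off_def pos_cells_def not_less intro: order_trans)
    qed
    then show ?thesis by (simp add: cost_diff)
  qed
  have "cost (cell_matrix c) (W + W') \<le> cost f (W + W')"
    using c f unfolding tight_iff_optimal by (simp add: balanced_minus_commute)
  moreover have "cost f W \<le> cost (cell_matrix c) W" "cost f W' \<le> cost (cell_matrix c) W'"
    using f_opt[OF assms(1), of "cell_matrix c"] f_opt[OF assms(2), of "cell_matrix c"]
    by (auto simp: nonneg_off_def balanced_def)
  ultimately have "cost (cell_matrix c) W \<le> cost f W" "cost (cell_matrix c) W' \<le> cost f W'"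
    by (simp_all add: cost_add_right)
  then show "c \<in> tight W" "c \<in> tight W'"
    unfolding tight_iff_optimal using f_opt assms by (meson order_trans)+
qed


lemma tight_scale: "0 < r \<Longrightarrow> tight (\<lambda>i k. r * V i k) = tight V"
proof -
  have *: "tight V \<subseteq> tight (\<lambda>i k. r * V i k)" if "0 < r" for r :: real and V :: "'a \<Rightarrow> 'b \<Rightarrow> real"
  proof
    fix c assume "c \<in> tight V"
    then obtain x where x: "\<And>i k l. (i, k) \<in> c \<Longrightarrow> V i k + x k \<le> V i l + x l"
      unfolding tight_def by blast
    have "r * V i k + r * x k \<le> r * V i l + r * x l" if "(i, k) \<in> c" for i k l
      using mult_left_mono[OF x[OF that, of l], of r] \<open>0 < r\<close> by (simp add: ring_distribs)
    then show "c \<in> tight (\<lambda>i k. r * V i k)"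
      unfolding tight_def by (intro CollectI exI[of _ "\<lambda>k. r * x k"]) auto
  qed
  assume r: "0 < r"
  then have "tight (\<lambda>i k. r * V i k) \<subseteq> tight (\<lambda>i k. inverse r * (r * V i k))"
    by (intro *) simp
  with *[OF r, of V] r show ?thesis by (auto simp flip: mult.assoc)
qed

lemma tight_zero: "tight (\<lambda>i k. 0) = UNIV"
  unfolding tight_def by (auto intro!: exI[of _ "\<lambda>k. 0"])

text \<open>The matrix \<open>e\<close> of least cost exists although its entries on \<open>b\<close> are unbounded: in terms of reduced
  costs these entries are free, and only finitely many nonnegative integer values of the others can
  compete with a given matrix.\<close>
lemma tight_representative:
  fixes u :: "'m::finite \<Rightarrow> 'k::finite \<Rightarrow> int"
  assumes b: "b \<in> tight V" "(i0, k0) \<in> b"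
    and u: "\<And>i. (\<Sum>k\<in>UNIV. u i k) = 0" "\<And>k. k \<notin> snd ` b \<Longrightarrow> 0 \<le> (\<Sum>i\<in>UNIV. u i k)"
  obtains e where "nonneg_off b e" "balanced (e - u)" "b \<union> pos_cells e \<in> tight V"
proof -
  define F where "F = {e. nonneg_off b e \<and> balanced (e - u)}"
  obtain w where w: "\<And>i k. 0 \<le> w i k" "\<And>i k. (i, k) \<in> b \<Longrightarrow> w i k = 0"
    "\<And>d. balanced d \<Longrightarrow> cost d V = cost d w"
    using reduced_costs[OF b(1)] by metis
  obtain e0 where e0: "e0 \<in> F"
  proof -
    define t where "t k = (\<Sum>i\<in>UNIV. u i k)" for k
    define r where "r k = (if t k < 0 then SOME i. (i, k) \<in> b else i0)" for k
    have r: "(r k, k) \<in> b" if "t k < 0" for k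
      using that u(2)[of k] someI_ex[of "\<lambda>i. (i, k) \<in> b"] unfolding r_def t_def by force
    \<comment> \<open>The column sum \<open>t l\<close> goes to the cell \<open>(r l, l)\<close> and
      is compensated in the same row in column \<open>k0\<close>. A negative \<open>t l\<close> is
      put on a cell of \<open>b\<close>; a nonnegative one goes to row \<open>i0\<close>, where the
      compensation falls on \<open>(i0, k0)\<close>, again in \<open>b\<close>.\<close>
    define e where "e i k = (\<Sum>l\<in>UNIV. of_bool (r l = i) * (of_bool (l = k) - of_bool (k0 = k)) * t l)" for i k
    have t0: "(\<Sum>l\<in>UNIV. t l) = 0" unfolding t_def by (subst sum.swap) (simp add: u(1))
    have "nonneg_off b e"
      unfolding nonneg_off_def e_def
    proof (intro allI impI sum_nonneg)
      fix i k l assume ik: "(i, k) \<notin> b"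
      show "0 \<le> of_bool (r l = i) * (of_bool (l = k) - of_bool (k0 = k)) * t l"
        using ik r[of l] b(2) by (cases "t l < 0") (auto simp: of_bool_def r_def)
    qed
    moreover have "(\<Sum>k\<in>UNIV. e i k) = 0" for i
      unfolding e_def by (subst sum.swap)
        (simp add: sum_subtractf sum_of_bool_UNIV flip: sum_distrib_left sum_distrib_right)
    moreover have "(\<Sum>i\<in>UNIV. e i k) = t k" for k
    proof -
      have "(\<Sum>i\<in>UNIV. e i k) = (\<Sum>l\<in>UNIV. (of_bool (k = l) - of_bool (k0 = k)) * t l)"
        unfolding e_def by (subst sum.swap)
          (simp add: sum_of_bool_UNIV eq_commute[of _ k] flip: sum_distrib_right)
      also have "\<dots> = t k"
        using t0 by (simp add: left_diff_distrib sum_subtractf sum_of_bool_mult_UNIV flip: sum_distrib_left)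
      finally show ?thesis .
    qed
    ultimately have "e \<in> F"
      using u(1) by (simp add: F_def balanced_def sum_subtractf t_def)
    then show thesis by (rule that)
  qed
  define cells where "cells = {p. 0 < w (fst p) (snd p)}"
  define B where "B = (\<Sum>p\<in>cells. \<lceil>cost e0 w / w (fst p) (snd p)\<rceil>)"
  \<comment> \<open>Cells of reduced cost zero do not affect the cost, so forgetting their unbounded
    entries keeps all costs and leaves finitely many candidates that are no dearer than
    \<open>e0\<close>.\<close>
  define trunc where "trunc e = (\<lambda>i k. if 0 < w i k then e i k else 0 :: int)" for e
  have cost_trunc: "cost e w = cost (trunc e) w" for e
    unfolding cost_def trunc_def using w(1) by (intro sum.cong refl) (auto simp: less_le)
  have nn: "0 \<le> e i k * w i k" if "e \<in> F" for e i k
    using that w(1)[of i k] w(2)[of i k] unfolding F_def nonneg_off_def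
    by (cases "(i, k) \<in> b") auto
  have e0_nn: "0 \<le> cost e0 w" unfolding cost_def by (intro sum_nonneg nn e0)
  \<comment> \<open>A number above -1 has a nonnegative ceiling, so each summand of \<open>B\<close>
    is nonnegative and hence at most \<open>B\<close>.\<close>
  have ratio: "- 1 < cost e0 w / w i k" for i k
    using divide_nonneg_nonneg[OF e0_nn w(1)[of i k]] by linarith
  have "trunc e i k \<in> {0..B}" if e: "e \<in> F" "cost e w \<le> cost e0 w" for e i k
  proof (cases "0 < w i k")
    case True
    then have ik: "(i, k) \<in> cells" by (simp add: cells_def)
    have "e i k * w i k \<le> (\<Sum>k\<in>UNIV. e i k * w i k)"
      by (intro member_le_sum[of k UNIV "\<lambda>k. e i k * w i k"] nn e) auto
    also have "\<dots> \<le> cost e w" unfolding cost_def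
      by (intro member_le_sum[of i UNIV "\<lambda>i. \<Sum>k\<in>UNIV. e i k * w i k"] sum_nonneg nn e) auto
    also note e(2)
    finally have "e i k \<le> cost e0 w / w i k" using True by (simp add: field_simps)
    then have "e i k \<le> \<lceil>cost e0 w / w i k\<rceil>" by linarith
    also have "\<dots> \<le> B"
      unfolding B_def using ik ratio
      by (intro member_le_sum[of "(i, k)" cells "\<lambda>p. \<lceil>cost e0 w / w (fst p) (snd p)\<rceil>", simplified])
        auto
    finally have "e i k \<le> B" .
    moreover have "0 \<le> e i k" using nn[OF e(1), of i k] True by (simp add: zero_le_mult_iff)
    ultimately show ?thesis using True by (simp add: trunc_def)
  next
    case False
    have "0 \<le> B" unfolding B_def using ratio by (intro sum_nonneg) auto
    then show ?thesis using False by (simp add: trunc_def)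
  qed
  then have "trunc ` {e \<in> F. cost e w \<le> cost e0 w} \<subseteq> {f. \<forall>i k. f i k \<in> {0..B}}" by blast
  then have fin: "finite (trunc ` {e \<in> F. cost e w \<le> cost e0 w})"
    by (rule finite_subset[OF _ finite_bounded_matrices])
  have "trunc ` {e \<in> F. cost e w \<le> cost e0 w} \<noteq> {}" using e0 by blast
  from ex_is_arg_min_if_finite[OF fin this, of "\<lambda>e. cost e w"]
  obtain g where g: "g \<in> trunc ` {e \<in> F. cost e w \<le> cost e0 w}"
    "\<And>h. h \<in> trunc ` {e \<in> F. cost e w \<le> cost e0 w} \<Longrightarrow> cost g w \<le> cost h w"
    unfolding is_arg_min_linorder by blast
  obtain e where e: "e \<in> F" "cost e w \<le> cost e0 w" "g = trunc e" using g(1) by blast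
  have e_le: "cost e w \<le> cost f w" if "f \<in> F" "cost f w \<le> cost e0 w" for f
    using g(2)[of "trunc f"] that unfolding e(3) cost_trunc[symmetric] by blast
  have min: "cost e w \<le> cost f w" if "f \<in> F" for f
    using e(2) e_le[OF that] by linarith
  have "b \<union> pos_cells e \<in> tight V"
  proof (rule tight_of_optimal)
    show "nonneg_off b e" using e(1) by (simp add: F_def)
    fix f assume f: "nonneg_off b f" "balanced (f - e)"
    have "balanced ((f - e) + (e - u))" using f(2) e(1) by (intro balanced_add) (auto simp: F_def)
    then have "f \<in> F" using f(1) by (simp add: F_def)
    then have "0 \<le> cost (f - e) w" using min[of f] by (simp add: cost_diff)
    then have "0 \<le> cost (f - e) V" using w(3)[OF f(2)] by simp
    then show "cost e V \<le> cost f V" by (simp add: cost_diff)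
  qed
  then show thesis using e(1) by (intro that) (auto simp: F_def)
qed

subsection \<open>Cones of the fans in coordinates\<close>

definition coords :: "real^'d^'m \<Rightarrow> 'm \<Rightarrow> 'd option \<Rightarrow> real"
  where "coords y i k = y $ i \<bullet> simplex_vertex k"

definition diag :: "real^'d \<Rightarrow> real^'d^'m"
  where "diag x = (\<chi> i. x)"

definition tight_cone :: "('m \<times> 'd option) set \<Rightarrow> (real^'d^'m) set"
  where "tight_cone b = {y. \<forall>(i, k)\<in>b. \<forall>l. coords y i k \<le> coords y i l}"

text \<open>The full preimage of a cone of the quotient fan: the closure of the class of
  \<open>[y]\<close>, as \<open>closure_quot_class\<close> shows.\<close>

definition chamber :: "real^'d::finite^'m::finite \<Rightarrow> (real^'d^'m) set"
  where "chamber y = {z. tight (coords y) \<subseteq> tight (coords z)}"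

lemma coords_add: "coords (y + z) = coords y + coords z"
  by (intro ext) (simp add: coords_def inner_add_left)

lemma coords_scaleR: "coords (r *\<^sub>R y) = (\<lambda>i k. r * coords y i k)"
  by (intro ext) (simp add: coords_def)

lemma coords_zero: "coords 0 = (\<lambda>i k. 0)"
  by (intro ext) (simp add: coords_def)

lemma coords_None: "coords y i None = 0"
  by (simp add: coords_def simplex_vertex_def)

lemma coords_Some: "coords y i (Some j) = y $ i $ j"
  by (simp add: coords_def simplex_vertex_def inner_axis)

lemma coords_diag: "coords (diag x) i k = x \<bullet> simplex_vertex k"
  by (simp add: coords_def diag_def)

lemma coords_add_diag: "coords (y + diag x) i k = coords y i k + x \<bullet> simplex_vertex k"
  by (simp add: coords_add coords_diag)

lemma diag_proj_eq_iff: "diag_proj y = diag_proj z \<longleftrightarrow> (\<exists>x. z = y + diag x)"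
proof -
  have "diag_proj y = diag_proj z \<longleftrightarrow> diag_rel z y"
    using diag_quot.abs_eq_iff[of z y] by metis
  also have "\<dots> \<longleftrightarrow> (\<exists>x. z = y + diag x)"
    unfolding diag_rel_def diag_def vec_eq_iff[of z] by (simp add: diff_eq_eq add.commute)
  finally show ?thesis .
qed

lemma diag_proj_add_diag: "diag_proj (y + diag x) = diag_proj y"
  using diag_proj_eq_iff by metis

lemma surj_diag_proj: "surj diag_proj"
proof (rule surjI)
  show "diag_proj (rep_diag_quot w) = w" for w :: "('a, 'b) diag_quot"
    by (rule Quotient3_abs_rep[OF Quotient3_diag_quot])
qed

text \<open>A column potential modulo constants is the same as a translation along the diagonal:
  both add one number per vertex, equal in all factors. Thus \<open>tight (coords y)\<close> lists
  the \<open>c\<close> for which the image of \<open>tight_cone c\<close> contains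
  \<open>[y]\<close>.\<close>

lemma tight_coords_iff:
  fixes y :: "real^'d::finite^'m::finite"
  shows "c \<in> tight (coords y) \<longleftrightarrow> (\<exists>x. y + diag x \<in> tight_cone c)"
proof
  assume "c \<in> tight (coords y)"
  then obtain x where x: "\<And>i k l. (i, k) \<in> c \<Longrightarrow> coords y i k + x k \<le> coords y i l + x l"
    unfolding tight_def by blast
  \<comment> \<open>The column \<open>None\<close> belongs to the vertex 0, where a translation adds
    nothing; subtracting \<open>x None\<close> normalizes the potential accordingly.\<close>
  define z :: "real^'d" where "z = (\<chi> j. x (Some j) - x None)"
  have z: "z \<bullet> simplex_vertex k = x k - x None" for k
    by (cases k) (simp_all add: z_def simplex_vertex_def inner_axis)
  have "coords (y + diag z) i k \<le> coords (y + diag z) i l" if "(i, k) \<in> c" for i k l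
    unfolding coords_add_diag z using x[OF that, of l] by simp
  then have "y + diag z \<in> tight_cone c" unfolding tight_cone_def by auto
  then show "\<exists>x. y + diag x \<in> tight_cone c" ..
next
  assume "\<exists>x. y + diag x \<in> tight_cone c"
  then obtain x where "y + diag x \<in> tight_cone c" by blast
  then show "c \<in> tight (coords y)"
    unfolding tight_def tight_cone_def
    by (intro CollectI exI[of _ "\<lambda>k. x \<bullet> simplex_vertex k"]) (simp add: coords_add_diag)
qed

lemma tight_coords_diag_proj:
  assumes "diag_proj y = diag_proj z"
  shows "tight (coords y) = tight (coords z)"
proof -
  have *: "tight (coords y) \<subseteq> tight (coords z)" if z: "diag_proj y = diag_proj z" for y z :: "real^'a^'b"
  proof
    fix c assume "c \<in> tight (coords y)"
    then obtain x where x: "y + diag x \<in> tight_cone c" using tight_coords_iff by blast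
    have "diag_proj z = diag_proj (y + diag x)" using z by (simp add: diag_proj_add_diag)
    then obtain x' where "y + diag x = z + diag x'" using diag_proj_eq_iff by blast
    with x show "c \<in> tight (coords z)" by (auto simp: tight_coords_iff)
  qed
  from *[OF assms] *[OF assms[symmetric]] show ?thesis by blast
qed

lemma mem_diag_proj_tight_cone: "diag_proj y \<in> diag_proj ` tight_cone c \<longleftrightarrow> c \<in> tight (coords y)"
proof
  assume "diag_proj y \<in> diag_proj ` tight_cone c"
  then obtain z where "diag_proj y = diag_proj z" "z \<in> tight_cone c" by (rule imageE)
  then show "c \<in> tight (coords y)" unfolding diag_proj_eq_iff tight_coords_iff by blast
next
  assume "c \<in> tight (coords y)"
  then obtain x where "y + diag x \<in> tight_cone c" unfolding tight_coords_iff by blast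
  then have "diag_proj (y + diag x) \<in> diag_proj ` tight_cone c" by (rule imageI)
  then show "diag_proj y \<in> diag_proj ` tight_cone c" unfolding diag_proj_add_diag .
qed

lemma normal_cone_face:
  assumes "c \<noteq> {}"
  shows "convex_cone hull (simplex_ray ` (- c)) =
    {v :: real^'d::finite. \<forall>k\<in>c. \<forall>l. v \<bullet> simplex_vertex k \<le> v \<bullet> simplex_vertex l}"
  unfolding normal_cone_std_simplex[OF assms, symmetric]
proof (intro equalityI subsetI CollectI)
  fix v :: "real^'d"
  assume "v \<in> {v. \<forall>x\<in>convex hull simplex_vertex ` c. \<forall>y\<in>std_simplex. v \<bullet> x \<le> v \<bullet> y}"
  then show "\<forall>k\<in>c. \<forall>l. v \<bullet> simplex_vertex k \<le> v \<bullet> simplex_vertex l"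
    by (auto simp: std_simplex_vertices hull_inc)
next
  fix v :: "real^'d"
  assume v: "v \<in> {v. \<forall>k\<in>c. \<forall>l. v \<bullet> simplex_vertex k \<le> v \<bullet> simplex_vertex l}"
  show "\<forall>x\<in>convex hull simplex_vertex ` c. \<forall>y\<in>std_simplex. v \<bullet> x \<le> v \<bullet> y"
  proof (intro ballI)
    fix x y assume x: "x \<in> convex hull (simplex_vertex ` c)" and y: "y \<in> (std_simplex :: (real^'d) set)"
    obtain k where k: "k \<in> c" using assms by blast
    have "convex hull (simplex_vertex ` c) \<subseteq> {x. v \<bullet> x \<le> v \<bullet> simplex_vertex k}"
      by (rule hull_minimal) (use v k in \<open>auto simp: convex_halfspace_le\<close>)
    moreover have "std_simplex \<subseteq> {y. v \<bullet> y \<ge> v \<bullet> simplex_vertex k}"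
      unfolding std_simplex_vertices
      by (rule hull_minimal) (use v k in \<open>auto simp: convex_halfspace_ge\<close>)
    ultimately show "v \<bullet> x \<le> v \<bullet> y" using x y by fastforce
  qed
qed

lemma inner_normal_fan_std_simplex_cones:
  "inner_normal_fan (std_simplex :: (real^'d::finite) set) =
    {{v. \<forall>k\<in>c. \<forall>l. v \<bullet> simplex_vertex k \<le> v \<bullet> simplex_vertex l} | c. c \<noteq> {}}"
proof -
  have "A \<subset> range simplex_ray \<longleftrightarrow> (\<exists>c. c \<noteq> {} \<and> A = simplex_ray ` (- c))"
    for A :: "(real^'d) set"
  proof
    assume "A \<subset> range (simplex_ray :: 'd option \<Rightarrow> real^'d)"
    then obtain B where B: "A = simplex_ray ` B" by (meson psubset_imp_subset subset_image_iff)
    then show "\<exists>c. c \<noteq> {} \<and> A = simplex_ray ` (- c)"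
      using \<open>A \<subset> _\<close> by (intro exI[of _ "- B"]) auto
  next
    assume "\<exists>c. c \<noteq> {} \<and> A = simplex_ray ` (- c)"
    then obtain c :: "'d option set" where c: "c \<noteq> {}" "A = simplex_ray ` (- c)" by blast
    then have "- c \<noteq> UNIV" by blast
    then have "A \<noteq> range simplex_ray"
      unfolding c inj_image_eq_iff[OF inj_simplex_ray] .
    with c show "A \<subset> range simplex_ray" by blast
  qed
  then have "{A. A \<subset> range (simplex_ray :: 'd option \<Rightarrow> real^'d)} = (\<lambda>c. simplex_ray ` (- c)) ` {c. c \<noteq> {}}"
    unfolding image_def by (intro Collect_cong) simp
  then have "inner_normal_fan (std_simplex :: (real^'d::finite) set) =
      (\<lambda>c. convex_cone hull (simplex_ray ` (- c))) ` {c. c \<noteq> {}}"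
    unfolding inner_normal_fan_std_simplex by (simp add: setcompr_eq_image image_image)
  also have "\<dots> = (\<lambda>c. {v. \<forall>k\<in>c. \<forall>l. v \<bullet> simplex_vertex k \<le> v \<bullet> simplex_vertex l}) ` {c. c \<noteq> {}}"
    by (intro image_cong refl normal_cone_face) simp
  finally show ?thesis unfolding image_Collect .
qed

text \<open>Choosing a nonempty face in each factor means choosing a set of cells that meets every
  row.\<close>

lemma product_fan_std_simplex:
  "product_fan (inner_normal_fan std_simplex) =
    {tight_cone b | b :: ('m::finite \<times> 'd::finite option) set. \<forall>i. \<exists>k. (i, k) \<in> b}"
proof (intro equalityI subsetI)
  fix \<tau> :: "(real^'d^'m) set" assume "\<tau> \<in> product_fan (inner_normal_fan std_simplex)"
  then obtain \<tau>' where \<tau>': "\<tau> = {v. \<forall>i. v $ i \<in> \<tau>' i}" "\<And>i. \<tau>' i \<in> inner_normal_fan std_simplex"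
    unfolding product_fan_def by blast
  have "\<exists>c. \<tau>' i = {v. \<forall>k\<in>c. \<forall>l. v \<bullet> simplex_vertex k \<le> v \<bullet> simplex_vertex l} \<and> c \<noteq> {}" for i
    using \<tau>'(2)[of i] unfolding inner_normal_fan_std_simplex_cones by blast
  then have "\<forall>i. \<exists>c. \<tau>' i = {v. \<forall>k\<in>c. \<forall>l. v \<bullet> simplex_vertex k \<le> v \<bullet> simplex_vertex l} \<and> c \<noteq> {}" ..
  from choice[OF this] obtain c where
    c: "\<And>i. \<tau>' i = {v. \<forall>k\<in>c i. \<forall>l. v \<bullet> simplex_vertex k \<le> v \<bullet> simplex_vertex l}" "\<And>i. c i \<noteq> {}"
    by blast
  have "\<tau> = tight_cone {(i, k). k \<in> c i}"
    unfolding \<tau>'(1) c(1) tight_cone_def coords_def by (intro Collect_cong) auto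
  then show "\<tau> \<in> {tight_cone b | b. \<forall>i. \<exists>k. (i, k) \<in> b}" using c(2) by blast
next
  fix \<tau> :: "(real^'d^'m) set" assume "\<tau> \<in> {tight_cone b | b. \<forall>i. \<exists>k. (i, k) \<in> b}"
  then obtain b where b: "\<tau> = tight_cone b" "\<forall>i. \<exists>k. (i, k) \<in> b" by blast
  have "\<tau> = {v. \<forall>i. v $ i \<in> {v. \<forall>k\<in>{k. (i, k) \<in> b}. \<forall>l. v \<bullet> simplex_vertex k \<le> v \<bullet> simplex_vertex l}}"
    unfolding b(1) tight_cone_def coords_def by (intro Collect_cong) blast
  moreover have "{v. \<forall>k\<in>{k. (i, k) \<in> b}. \<forall>l. v \<bullet> simplex_vertex k \<le> v \<bullet> simplex_vertex l}
      \<in> inner_normal_fan (std_simplex :: (real^'d) set)" for i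
    unfolding inner_normal_fan_std_simplex_cones using b(2) by blast
  ultimately show "\<tau> \<in> product_fan (inner_normal_fan std_simplex)"
    unfolding product_fan_def by (intro CollectI exI[of _ "\<lambda>i. {v. \<forall>k\<in>{k. (i, k) \<in> b}. \<forall>l. v \<bullet> simplex_vertex k \<le> v \<bullet> simplex_vertex l}"]) blast
qed

text \<open>Only sets of cells meeting every row name cones of the product fan. Adding all row
  minima for the same potential shows that these sets already determine the whole family of tight
  sets, which is closed under subsets.\<close>

lemma tight_extend:
  fixes V :: "'m \<Rightarrow> 'k::finite \<Rightarrow> real"
  assumes "c \<in> tight V"
  obtains c' where "c \<subseteq> c'" "c' \<in> tight V" "\<forall>i. \<exists>k. (i, k) \<in> c'"
proof -
  obtain x where x: "\<And>i k l. (i, k) \<in> c \<Longrightarrow> V i k + x k \<le> V i l + x l"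
    using assms unfolding tight_def by blast
  define c' where "c' = {(i, k). \<forall>l. V i k + x k \<le> V i l + x l}"
  have "\<exists>k. (i, k) \<in> c'" for i
    using ex_is_arg_min_if_finite[of UNIV "\<lambda>k. V i k + x k"]
    unfolding c'_def is_arg_min_linorder by auto
  moreover have "c' \<in> tight V" unfolding tight_def c'_def by blast
  moreover have "c \<subseteq> c'" unfolding c'_def using x by blast
  ultimately show thesis using that by blast
qed

lemma quot_equiv_iff:
  "quot_equiv (inner_normal_fan std_simplex) (diag_proj y) (diag_proj z) \<longleftrightarrow>
    tight (coords y) = tight (coords (z :: real^'d::finite^'m::finite))"
proof
  assume L: "quot_equiv (inner_normal_fan std_simplex) (diag_proj y) (diag_proj z)"
  have eq: "c \<in> tight (coords y) \<longleftrightarrow> c \<in> tight (coords z)" if "\<forall>i. \<exists>k. (i, k) \<in> c" for c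
    using L that unfolding quot_equiv_def product_fan_std_simplex mem_diag_proj_tight_cone[symmetric] by blast
  show "tight (coords y) = tight (coords z)"
    by (metis eq tight_extend tight_mono subsetI subset_antisym)
next
  assume eq: "tight (coords y) = tight (coords z)"
  show "quot_equiv (inner_normal_fan std_simplex) (diag_proj y) (diag_proj z)"
    unfolding quot_equiv_def product_fan_std_simplex
  proof
    fix \<tau> :: "(real^'d^'m) set" assume "\<tau> \<in> {tight_cone b | b. \<forall>i. \<exists>k. (i, k) \<in> b}"
    then obtain b where "\<tau> = tight_cone b" by blast
    then show "diag_proj y \<in> diag_proj ` \<tau> \<longleftrightarrow> diag_proj z \<in> diag_proj ` \<tau>"
      using eq by (simp only: mem_diag_proj_tight_cone)
  qed
qed

lemma chamber_add:
  assumes "z \<in> chamber y" "z' \<in> chamber y"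
  shows "tight (coords (z + z')) = tight (coords z) \<inter> tight (coords z')"
  unfolding coords_add by (rule tight_add) (use assms in \<open>auto simp: chamber_def\<close>)

lemma chamber_diag_proj: "diag_proj z \<in> diag_proj ` chamber y \<longleftrightarrow> z \<in> chamber y"
proof
  assume "diag_proj z \<in> diag_proj ` chamber y"
  then obtain z' where "diag_proj z = diag_proj z'" "z' \<in> chamber y" by (rule imageE)
  then show "z \<in> chamber y" using tight_coords_diag_proj[of z z'] by (simp add: chamber_def)
qed (rule imageI)

lemma continuous_cost_coords: "continuous_on UNIV (\<lambda>z. cost e (coords z))"
  unfolding cost_def coords_def by (intro continuous_intros)

text \<open>The existential quantifier over potentials does not by itself give closedness; the
  optimality criterion writes the set as an intersection of closed half-spaces.\<close>

lemma closed_tight: "closed {z :: real^'d::finite^'m::finite. c \<in> tight (coords z)}"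
proof -
  have "{z :: real^'d^'m. c \<in> tight (coords z)} =
      (\<Inter>g\<in>{g. nonneg_off {} g \<and> balanced (g - cell_matrix c)}.
        {z. cost (cell_matrix c) (coords z) \<le> cost g (coords z)})"
    by (simp add: set_eq_iff tight_iff_optimal imp_conjL)
  also have "closed \<dots>"
    by (intro closed_INT ballI closed_Collect_le continuous_cost_coords)
  finally show ?thesis .
qed

lemma closed_chamber: "closed (chamber y)"
proof -
  have "chamber y = (\<Inter>c\<in>tight (coords y). {z. c \<in> tight (coords z)})"
    unfolding chamber_def by auto
  then show ?thesis by (auto intro: closed_tight)
qed

text \<open>For density, move from a point \<open>z\<close> of the chamber in the direction
  \<open>y\<close>: by additivity \<open>z + r y\<close> has exactly the type of \<open>y\<close>
  for every \<open>r > 0\<close>, and it tends to \<open>z\<close> as \<open>r\<close> tends to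
  0.\<close>

lemma closure_quot_class:
  "closure {w. quot_equiv (inner_normal_fan std_simplex) (diag_proj y) w} =
    diag_proj ` chamber (y :: real^'d::finite^'m::finite)" (is "closure ?C = ?Q")
proof (intro equalityI)
  have C: "diag_proj z \<in> ?C \<longleftrightarrow> tight (coords y) = tight (coords z)" for z
    by (simp add: quot_equiv_iff)
  have "closed ?Q"
    unfolding closed_def open_diag_quot_def
    using closed_chamber[of y] by (simp add: vimage_Compl closed_def) (simp add: vimage_def chamber_diag_proj)
  moreover have "?C \<subseteq> ?Q"
  proof
    fix w assume "w \<in> ?C"
    moreover obtain z where "w = diag_proj z" using surj_diag_proj by blast
    ultimately show "w \<in> ?Q" using C by (auto simp: chamber_diag_proj) (auto simp: chamber_def)
  qed
  ultimately show "closure ?C \<subseteq> ?Q" by (rule closure_minimal[rotated])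
  show "?Q \<subseteq> closure ?C"
  proof clarify
    fix z assume z: "z \<in> chamber y"
    show "diag_proj z \<in> closure ?C"
      unfolding closure_iff_nhds_not_empty
    proof (intro allI impI)
      fix A V assume AV: "V \<subseteq> A" "open V" "diag_proj z \<in> V"
      have "open (diag_proj -` V)" using AV by (simp add: open_diag_quot_def)
      moreover have "((\<lambda>r. z + r *\<^sub>R y) \<longlongrightarrow> z + 0 *\<^sub>R y) (at_right 0)"
        by (intro tendsto_intros)
      ultimately have "\<forall>\<^sub>F r in at_right 0. z + r *\<^sub>R y \<in> diag_proj -` V"
        using AV(3) by (intro topological_tendstoD) auto
      moreover have "\<forall>\<^sub>F r in at_right (0::real). 0 < r" by (simp add: eventually_at_right_less)
      ultimately have "\<forall>\<^sub>F r in at_right 0. 0 < r \<and> z + r *\<^sub>R y \<in> diag_proj -` V"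
        by eventually_elim simp
      then obtain r where r: "0 < r" "z + r *\<^sub>R y \<in> diag_proj -` V"
        using eventually_happens[of _ "at_right (0::real)"] by (auto simp: trivial_limit_at_right_real)
      have ry: "tight (coords (r *\<^sub>R y)) = tight (coords y)"
        unfolding coords_scaleR by (rule tight_scale[OF r(1)])
      have "tight (coords (z + r *\<^sub>R y)) = tight (coords z) \<inter> tight (coords (r *\<^sub>R y))"
        by (rule chamber_add) (use z ry in \<open>auto simp: chamber_def\<close>)
      also have "\<dots> = tight (coords y)" using z ry by (auto simp: chamber_def)
      finally have "diag_proj (z + r *\<^sub>R y) \<in> ?C" using C by simp
      then show "?C \<inter> A \<noteq> {}" using r(2) AV(1) by blast
    qed
  qed
qed

lemma quotient_fan_std_simplex:
  "quotient_fan std_simplex = {diag_proj ` chamber (y :: real^'d::finite^'m::finite) | y. True}"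
proof -
  have "quotient_fan std_simplex =
      (\<lambda>v. closure {w. quot_equiv (inner_normal_fan std_simplex) v w}) ` range (diag_proj :: real^'d^'m \<Rightarrow> _)"
    unfolding quotient_fan_def surj_diag_proj by (simp add: full_SetCompr_eq)
  also have "\<dots> = range (\<lambda>y :: real^'d^'m. diag_proj ` chamber y)"
    unfolding image_image closure_quot_class ..
  finally show ?thesis by (simp add: full_SetCompr_eq)
qed

text \<open>The cone \<open>\<xi>\<close> chosen in the definition of the fan may be larger than the
  image of \<open>\<sigma>\<close>, and then \<open>b\<close> need not be tight at its base point.
  Among the types in the chamber that contain \<open>b\<close> there is a least one; a base point of
  that type gives a chamber with the same image as \<open>\<sigma>\<close>.\<close>

lemma refined_fan_std_simplex:
  assumes "\<sigma> \<in> refined_fan (std_simplex :: (real^'d::finite) set)"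
  obtains y b where "\<sigma> = chamber y \<inter> tight_cone b" "b \<in> tight (coords y)"
    "\<forall>i :: 'm::finite. \<exists>k. (i, k) \<in> b" "diag_proj ` \<sigma> = diag_proj ` chamber y"
proof -
  obtain y b where y: "\<sigma> = diag_proj -` (diag_proj ` chamber y) \<inter> tight_cone b"
    and b: "\<forall>i :: 'm. \<exists>k. (i, k) \<in> b"
    using assms unfolding refined_fan_def quotient_fan_std_simplex product_fan_std_simplex by blast
  have \<sigma>: "\<sigma> = chamber y \<inter> tight_cone b" unfolding y by (simp add: set_eq_iff chamber_diag_proj)
  define T where "T = {tight (coords z) | z. z \<in> chamber y \<and> b \<in> tight (coords z)}"
  have closed: "t \<inter> t' \<in> T" if t: "t \<in> T" "t' \<in> T" for t t'
  proof -
    obtain z z' where z: "t = tight (coords z)" "z \<in> chamber y" "b \<in> tight (coords z)"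
      "t' = tight (coords z')" "z' \<in> chamber y" "b \<in> tight (coords z')"
      using t unfolding T_def by blast
    then have "t \<inter> t' = tight (coords (z + z'))" using chamber_add by blast
    moreover from this have "z + z' \<in> chamber y" "b \<in> tight (coords (z + z'))"
      using z by (auto simp: chamber_def)
    ultimately show ?thesis unfolding T_def by blast
  qed
  have zero: "tight (coords (0 :: real^'d^'m)) = UNIV" by (simp add: coords_zero tight_zero)
  have "UNIV \<in> T" unfolding T_def by (intro CollectI exI[of _ 0]) (simp add: zero chamber_def)
  then have "T \<noteq> {}" by blast
  \<comment> \<open>There are finitely many cells, so \<open>T\<close> is a finite family and its
    intersection is one of its members.\<close>
  moreover have "\<Inter>A \<in> T" if "finite A" "A \<noteq> {}" "A \<subseteq> T" for A
    using that by (induction rule: finite_ne_induct) (auto intro: closed)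
  ultimately have "\<Inter>T \<in> T" by simp
  then obtain z where z: "\<Inter>T = tight (coords z)" "z \<in> chamber y" "b \<in> tight (coords z)"
    unfolding T_def by blast
  have cz: "w \<in> chamber z \<longleftrightarrow> w \<in> chamber y \<and> b \<in> tight (coords w)" for w
  proof
    assume "w \<in> chamber z" then show "w \<in> chamber y \<and> b \<in> tight (coords w)"
      using z(2,3) by (auto simp: chamber_def)
  next
    assume "w \<in> chamber y \<and> b \<in> tight (coords w)"
    then have "tight (coords w) \<in> T" unfolding T_def by blast
    then show "w \<in> chamber z" unfolding chamber_def z(1)[symmetric] by blast
  qed
  have tb: "b \<in> tight (coords w)" if "w \<in> tight_cone b" for w
    using that by (intro iffD2[OF tight_coords_iff] exI[of _ 0]) (simp add: diag_def zero_vec_def[symmetric])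
  have "\<sigma> = chamber z \<inter> tight_cone b" unfolding \<sigma> using cz tb by blast
  moreover have "diag_proj ` chamber z \<subseteq> diag_proj ` \<sigma>"
  proof clarify
    fix w assume w: "w \<in> chamber z"
    then obtain x where x: "w + diag x \<in> tight_cone b" using cz tight_coords_iff by blast
    have "w + diag x \<in> chamber z"
      using w tight_coords_diag_proj[OF diag_proj_add_diag[of w x]] by (simp add: chamber_def)
    then show "diag_proj w \<in> diag_proj ` \<sigma>"
      using x \<open>\<sigma> = chamber z \<inter> tight_cone b\<close> by (metis IntI diag_proj_add_diag imageI)
  qed
  ultimately show thesis using b z(3) by (intro that[of z b]) auto
qed

subsection \<open>Localizations of domains\<close>

text \<open>All charts are domains, so the auxiliary factor in the definition of fractions cancels
  and equality of fractions becomes cross multiplication.\<close>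

locale local_domain = R?: domain R + P?: primeideal P R for P and R (structure)
begin

lemma prime_P: "primeideal P R"
  by (rule primeideal_axioms)

abbreviation D where "D \<equiv> carrier R - P"

lemma D_one: "\<one> \<in> D"
  using one_imp_carrier I_notcarr by auto

lemma D_mult: "s \<in> D \<Longrightarrow> t \<in> D \<Longrightarrow> s \<otimes> t \<in> D"
  using I_prime by auto

lemma D_carrier: "s \<in> D \<Longrightarrow> s \<in> carrier R"
  by simp

lemma D_nonzero: "s \<in> D \<Longrightarrow> s \<noteq> \<zero>"
  using additive_subgroup.zero_closed[OF is_additive_subgroup] by auto

lemma local_frac_rel_iff:
  "((a, s), (b, t)) \<in> local_frac_rel R P \<longleftrightarrow>
    a \<in> carrier R \<and> b \<in> carrier R \<and> s \<in> D \<and> t \<in> D \<and> a \<otimes> t = b \<otimes> s"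
proof -
  have "(\<exists>u\<in>D. u \<otimes> (a \<otimes> t \<ominus> b \<otimes> s) = \<zero>) \<longleftrightarrow> a \<otimes> t = b \<otimes> s"
    if "a \<in> carrier R" "b \<in> carrier R" "s \<in> D" "t \<in> D"
  proof
    assume "\<exists>u\<in>D. u \<otimes> (a \<otimes> t \<ominus> b \<otimes> s) = \<zero>"
    then obtain u where u: "u \<in> D" "u \<otimes> (a \<otimes> t \<ominus> b \<otimes> s) = \<zero>" by blast
    have "u \<in> carrier R" "a \<otimes> t \<ominus> b \<otimes> s \<in> carrier R" using u that by auto
    then have "a \<otimes> t \<ominus> b \<otimes> s = \<zero>" using integral[OF u(2)] D_nonzero[OF u(1)] by blast
    moreover have "a \<otimes> t = (a \<otimes> t \<ominus> b \<otimes> s) \<oplus> b \<otimes> s" using that D_carrier by algebra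
    ultimately show "a \<otimes> t = b \<otimes> s" using that by simp
  next
    assume "a \<otimes> t = b \<otimes> s"
    then have "a \<otimes> t \<ominus> b \<otimes> s = \<zero>" using that by (simp add: a_minus_def r_neg)
    then have "\<one> \<otimes> (a \<otimes> t \<ominus> b \<otimes> s) = \<zero>" by simp
    then show "\<exists>u\<in>D. u \<otimes> (a \<otimes> t \<ominus> b \<otimes> s) = \<zero>" using D_one by blast
  qed
  then show ?thesis unfolding local_frac_rel_def by auto
qed

lemma equiv_local_frac_rel: "equiv (carrier R \<times> D) (local_frac_rel R P)"
proof (rule equivI)
  show "local_frac_rel R P \<subseteq> (carrier R \<times> D) \<times> (carrier R \<times> D)"
    by (auto simp: local_frac_rel_iff)
  show "refl_on (carrier R \<times> D) (local_frac_rel R P)"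
    by (auto simp: refl_on_def local_frac_rel_iff)
  show "sym (local_frac_rel R P)"
    by (auto simp: sym_def local_frac_rel_iff)
  show "trans (local_frac_rel R P)"
  proof (rule transI, clarify)
    fix a s b t c w
    assume 1: "((a, s), (b, t)) \<in> local_frac_rel R P" and 2: "((b, t), (c, w)) \<in> local_frac_rel R P"
    have carr: "a \<in> carrier R" "s \<in> carrier R" "b \<in> carrier R" "t \<in> carrier R" "c \<in> carrier R" "w \<in> carrier R"
      and eq: "a \<otimes> t = b \<otimes> s" "b \<otimes> w = c \<otimes> t" and t: "t \<noteq> \<zero>"
      using 1 2 D_nonzero unfolding local_frac_rel_iff by auto
    have "(a \<otimes> w) \<otimes> t = (a \<otimes> t) \<otimes> w" using carr by algebra
    also have "\<dots> = (b \<otimes> w) \<otimes> s" unfolding eq(1) using carr by algebra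
    also have "\<dots> = (c \<otimes> s) \<otimes> t" unfolding eq(2) using carr by algebra
    finally have "a \<otimes> w = c \<otimes> s" using m_rcancel[OF t carr(4), of "a \<otimes> w" "c \<otimes> s"] carr by simp
    then show "((a, s), (c, w)) \<in> local_frac_rel R P" using 1 2 unfolding local_frac_rel_iff by simp
  qed
qed

abbreviation frac where "frac \<equiv> local_frac R P"

lemma frac_eq_iff:
  "a \<in> carrier R \<Longrightarrow> s \<in> D \<Longrightarrow> b \<in> carrier R \<Longrightarrow> t \<in> D \<Longrightarrow> frac a s = frac b t \<longleftrightarrow> a \<otimes> t = b \<otimes> s"
  unfolding local_frac_def
  using eq_equiv_class_iff[OF equiv_local_frac_rel, of "(a, s)" "(b, t)"] by (simp add: local_frac_rel_iff)

lemma mem_frac_iff: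
  "(b, t) \<in> frac a s \<longleftrightarrow> a \<in> carrier R \<and> b \<in> carrier R \<and> s \<in> D \<and> t \<in> D \<and> a \<otimes> t = b \<otimes> s"
  by (simp add: local_frac_def local_frac_rel_iff)

lemma frac_self: "a \<in> carrier R \<Longrightarrow> s \<in> D \<Longrightarrow> (a, s) \<in> frac a s"
  by (simp add: mem_frac_iff)

lemma carrier_local_ring: "carrier (local_ring R P) = {frac a s | a s. a \<in> carrier R \<and> s \<in> D}"
  unfolding local_ring_def local_frac_def quotient_def by auto

lemma frac_closed: "a \<in> carrier R \<Longrightarrow> s \<in> D \<Longrightarrow> frac a s \<in> carrier (local_ring R P)"
  unfolding carrier_local_ring by blast

text \<open>Evaluates an operation defined as a union over representatives: independence of the
  representative makes it a union of equal sets, over a nonempty class.\<close>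

lemma UN_frac:
  assumes "a \<in> carrier R" "s \<in> D" "\<And>b t. (b, t) \<in> frac a s \<Longrightarrow> f b t = C"
  shows "(\<Union>(b, t)\<in>frac a s. f b t) = C"
proof -
  have "(\<lambda>(b, t). f b t) ` frac a s = {C}"
    using assms(3) frac_self[OF assms(1,2)] by (force simp: image_iff)
  then show ?thesis by simp
qed

lemma mult_frac:
  assumes "a \<in> carrier R" "s \<in> D" "b \<in> carrier R" "t \<in> D"
  shows "frac a s \<otimes>\<^bsub>local_ring R P\<^esub> frac b t = frac (a \<otimes> b) (s \<otimes> t)"
proof -
  have "frac (a' \<otimes> b') (s' \<otimes> t') = frac (a \<otimes> b) (s \<otimes> t)"
    if "(a', s') \<in> frac a s" "(b', t') \<in> frac b t" for a' s' b' t'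
  proof -
    have carr: "a \<in> carrier R" "s \<in> carrier R" "b \<in> carrier R" "t \<in> carrier R"
      "a' \<in> carrier R" "s' \<in> carrier R" "b' \<in> carrier R" "t' \<in> carrier R"
      using that assms unfolding mem_frac_iff by auto
    have "a' \<otimes> b' \<otimes> (s \<otimes> t) = (a' \<otimes> s) \<otimes> (b' \<otimes> t)" using carr by algebra
    also have "\<dots> = (a \<otimes> s') \<otimes> (b \<otimes> t')" using that unfolding mem_frac_iff by simp
    also have "\<dots> = a \<otimes> b \<otimes> (s' \<otimes> t')" using carr by algebra
    finally show ?thesis using that assms D_mult unfolding mem_frac_iff by (subst frac_eq_iff) auto
  qed
  then show ?thesis
    unfolding local_ring_def using assms by (simp add: UN_frac)
qed

lemma add_frac:
  assumes "a \<in> carrier R" "s \<in> D" "b \<in> carrier R" "t \<in> D"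
  shows "frac a s \<oplus>\<^bsub>local_ring R P\<^esub> frac b t = frac (a \<otimes> t \<oplus> b \<otimes> s) (s \<otimes> t)"
proof -
  have "frac (a' \<otimes> t' \<oplus> b' \<otimes> s') (s' \<otimes> t') = frac (a \<otimes> t \<oplus> b \<otimes> s) (s \<otimes> t)"
    if "(a', s') \<in> frac a s" "(b', t') \<in> frac b t" for a' s' b' t'
  proof -
    have carr: "a \<in> carrier R" "s \<in> carrier R" "b \<in> carrier R" "t \<in> carrier R"
      "a' \<in> carrier R" "s' \<in> carrier R" "b' \<in> carrier R" "t' \<in> carrier R"
      using that assms unfolding mem_frac_iff by auto
    have "(a' \<otimes> t' \<oplus> b' \<otimes> s') \<otimes> (s \<otimes> t) = (a' \<otimes> s) \<otimes> (t \<otimes> t') \<oplus> (b' \<otimes> t) \<otimes> (s \<otimes> s')"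
      using carr by algebra
    also have "\<dots> = (a \<otimes> s') \<otimes> (t \<otimes> t') \<oplus> (b \<otimes> t') \<otimes> (s \<otimes> s')"
      using that unfolding mem_frac_iff by simp
    also have "\<dots> = (a \<otimes> t \<oplus> b \<otimes> s) \<otimes> (s' \<otimes> t')" using carr by algebra
    finally show ?thesis using that assms D_mult unfolding mem_frac_iff by (subst frac_eq_iff) auto
  qed
  then show ?thesis
    unfolding local_ring_def using assms by (simp add: UN_frac)
qed

lemma one_local_ring: "\<one>\<^bsub>local_ring R P\<^esub> = frac \<one> \<one>"
  and zero_local_ring: "\<zero>\<^bsub>local_ring R P\<^esub> = frac \<zero> \<one>"
  by (simp_all add: local_ring_def)

lemma local_ringE:
  assumes "x \<in> carrier (local_ring R P)"
  obtains a s where "x = frac a s" "a \<in> carrier R" "s \<in> D"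
  using assms unfolding carrier_local_ring by blast

lemma frac_eq_zero_iff: "a \<in> carrier R \<Longrightarrow> s \<in> D \<Longrightarrow> frac a s = \<zero>\<^bsub>local_ring R P\<^esub> \<longleftrightarrow> a = \<zero>"
  unfolding zero_local_ring using D_one by (subst frac_eq_iff) auto

lemma frac_cancel:
  "a \<in> carrier R \<Longrightarrow> s \<in> D \<Longrightarrow> t \<in> D \<Longrightarrow> frac (t \<otimes> a) (t \<otimes> s) = frac a s"
  using D_mult by (subst frac_eq_iff) (auto simp: m_ac)

lemma add_frac_same:
  assumes "a \<in> carrier R" "b \<in> carrier R" "s \<in> D"
  shows "frac a s \<oplus>\<^bsub>local_ring R P\<^esub> frac b s = frac (a \<oplus> b) s"
proof -
  have "a \<otimes> s \<oplus> b \<otimes> s = s \<otimes> (a \<oplus> b)" using assms D_carrier by algebra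
  then show ?thesis using assms frac_cancel[of "a \<oplus> b" s s] by (simp add: add_frac)
qed

lemma cring_local_ring: "cring (local_ring R P)"
proof (rule cringI)
  show "abelian_group (local_ring R P)"
  proof (rule abelian_groupI)
    fix x y z assume x: "x \<in> carrier (local_ring R P)" and y: "y \<in> carrier (local_ring R P)" and z: "z \<in> carrier (local_ring R P)"
    obtain a s where a: "x = frac a s" "a \<in> carrier R" "s \<in> D" using x by (rule local_ringE)
    obtain b t where b: "y = frac b t" "b \<in> carrier R" "t \<in> D" using y by (rule local_ringE)
    obtain c w where c: "z = frac c w" "c \<in> carrier R" "w \<in> D" using z by (rule local_ringE)
    note carr = a(2) b(2) c(2) D_carrier[OF a(3)] D_carrier[OF b(3)] D_carrier[OF c(3)]
    note dd = a(3) b(3) c(3) D_mult D_one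
    show "x \<oplus>\<^bsub>local_ring R P\<^esub> y \<in> carrier (local_ring R P)"
      unfolding a b using carr dd by (simp add: add_frac frac_closed)
    have e: "(a \<otimes> t \<oplus> b \<otimes> s) \<otimes> w \<oplus> c \<otimes> (s \<otimes> t) = a \<otimes> (t \<otimes> w) \<oplus> (b \<otimes> w \<oplus> c \<otimes> t) \<otimes> s"
      using carr by algebra
    have e': "s \<otimes> t \<otimes> w = s \<otimes> (t \<otimes> w)" using carr by algebra
    show "x \<oplus>\<^bsub>local_ring R P\<^esub> y \<oplus>\<^bsub>local_ring R P\<^esub> z = x \<oplus>\<^bsub>local_ring R P\<^esub> (y \<oplus>\<^bsub>local_ring R P\<^esub> z)"
      unfolding a b c using carr D_mult[OF a(3) b(3)] D_mult[OF b(3) c(3)] a(3) b(3) c(3)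
      by (simp only: add_frac m_closed R.a_closed e e')
    have f: "a \<otimes> t \<oplus> b \<otimes> s = b \<otimes> s \<oplus> a \<otimes> t" "s \<otimes> t = t \<otimes> s" using carr by algebra+
    show "x \<oplus>\<^bsub>local_ring R P\<^esub> y = y \<oplus>\<^bsub>local_ring R P\<^esub> x"
      unfolding a b using a(3) b(3) carr by (simp only: add_frac f)
    show "\<zero>\<^bsub>local_ring R P\<^esub> \<oplus>\<^bsub>local_ring R P\<^esub> x = x"
      unfolding a zero_local_ring using a(3) D_one carr by (simp add: add_frac)
    have "frac (\<ominus> a) s \<oplus>\<^bsub>local_ring R P\<^esub> x = \<zero>\<^bsub>local_ring R P\<^esub>"
      unfolding a using a(3) carr by (simp add: add_frac_same l_neg frac_eq_zero_iff)
    then show "\<exists>y\<in>carrier (local_ring R P). y \<oplus>\<^bsub>local_ring R P\<^esub> x = \<zero>\<^bsub>local_ring R P\<^esub>"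
      using a frac_closed[of "\<ominus> a" s] by blast
  next
    show "\<zero>\<^bsub>local_ring R P\<^esub> \<in> carrier (local_ring R P)"
      unfolding zero_local_ring using D_one frac_closed by simp
  qed
  show "comm_monoid (local_ring R P)"
  proof (rule comm_monoidI)
    fix x y z assume x: "x \<in> carrier (local_ring R P)" and y: "y \<in> carrier (local_ring R P)" and z: "z \<in> carrier (local_ring R P)"
    obtain a s where a: "x = frac a s" "a \<in> carrier R" "s \<in> D" using x by (rule local_ringE)
    obtain b t where b: "y = frac b t" "b \<in> carrier R" "t \<in> D" using y by (rule local_ringE)
    obtain c w where c: "z = frac c w" "c \<in> carrier R" "w \<in> D" using z by (rule local_ringE)
    note carr = a(2) b(2) c(2) D_carrier[OF a(3)] D_carrier[OF b(3)] D_carrier[OF c(3)]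
    show "x \<otimes>\<^bsub>local_ring R P\<^esub> y \<in> carrier (local_ring R P)"
      unfolding a b using carr D_mult a(3) b(3) by (simp add: mult_frac frac_closed)
    show "x \<otimes>\<^bsub>local_ring R P\<^esub> y \<otimes>\<^bsub>local_ring R P\<^esub> z = x \<otimes>\<^bsub>local_ring R P\<^esub> (y \<otimes>\<^bsub>local_ring R P\<^esub> z)"
      unfolding a b c using carr D_mult[OF a(3) b(3)] D_mult[OF b(3) c(3)] a(3) b(3) c(3)
      by (simp only: mult_frac m_closed m_assoc)
    show "x \<otimes>\<^bsub>local_ring R P\<^esub> y = y \<otimes>\<^bsub>local_ring R P\<^esub> x"
      unfolding a b using carr a(3) b(3) by (simp only: mult_frac m_comm)
    show "\<one>\<^bsub>local_ring R P\<^esub> \<otimes>\<^bsub>local_ring R P\<^esub> x = x"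
      unfolding a one_local_ring using a(3) D_one carr by (simp add: mult_frac)
  next
    show "\<one>\<^bsub>local_ring R P\<^esub> \<in> carrier (local_ring R P)"
      unfolding one_local_ring using D_one frac_closed by simp
  qed
  fix x y z assume x: "x \<in> carrier (local_ring R P)" and y: "y \<in> carrier (local_ring R P)" and z: "z \<in> carrier (local_ring R P)"
  obtain a s where a: "x = frac a s" "a \<in> carrier R" "s \<in> D" using x by (rule local_ringE)
  obtain b t where b: "y = frac b t" "b \<in> carrier R" "t \<in> D" using y by (rule local_ringE)
  obtain c w where c: "z = frac c w" "c \<in> carrier R" "w \<in> D" using z by (rule local_ringE)
  note carr = a(2) b(2) c(2) D_carrier[OF a(3)] D_carrier[OF b(3)] D_carrier[OF c(3)]
  \<comment> \<open>Adding the two products puts an extra factor \<open>w\<close> into numerator and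
    denominator, which \<open>frac_cancel\<close> removes.\<close>
  have e: "a \<otimes> c \<otimes> (t \<otimes> w) \<oplus> b \<otimes> c \<otimes> (s \<otimes> w) = w \<otimes> ((a \<otimes> t \<oplus> b \<otimes> s) \<otimes> c)"
    "s \<otimes> w \<otimes> (t \<otimes> w) = w \<otimes> (s \<otimes> t \<otimes> w)" using carr by algebra+
  show "(x \<oplus>\<^bsub>local_ring R P\<^esub> y) \<otimes>\<^bsub>local_ring R P\<^esub> z = x \<otimes>\<^bsub>local_ring R P\<^esub> z \<oplus>\<^bsub>local_ring R P\<^esub> y \<otimes>\<^bsub>local_ring R P\<^esub> z"
    unfolding a b c
    using carr D_mult[OF a(3) b(3)] D_mult[OF a(3) c(3)] D_mult[OF b(3) c(3)] D_mult[OF D_mult[OF a(3) b(3)] c(3)] a(3) b(3) c(3)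
    by (simp only: mult_frac add_frac m_closed R.a_closed e frac_cancel)
qed

lemma finsum_frac:
  assumes "finite E" "f \<in> E \<rightarrow> carrier R" "s \<in> D"
  shows "(\<Oplus>\<^bsub>local_ring R P\<^esub>e\<in>E. frac (f e) s) = frac (\<Oplus>e\<in>E. f e) s"
  using assms(1,2)
proof (induction E)
  case empty
  interpret L: cring "local_ring R P" by (rule cring_local_ring)
  show ?case using assms(3) frac_eq_zero_iff[of \<zero> s] by simp
next
  case (insert e E)
  interpret L: cring "local_ring R P" by (rule cring_local_ring)
  have "(\<Oplus>\<^bsub>local_ring R P\<^esub>e\<in>insert e E. frac (f e) s) =
      frac (f e) s \<oplus>\<^bsub>local_ring R P\<^esub> (\<Oplus>\<^bsub>local_ring R P\<^esub>e\<in>E. frac (f e) s)"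
    using insert assms(3) by (intro L.finsum_insert) (auto intro!: frac_closed)
  then show ?case using insert assms(3) by (simp add: add_frac_same finsum_closed Pi_def)
qed

lemma pow_frac:
  assumes "a \<in> carrier R" "s \<in> D"
  shows "frac a s [^]\<^bsub>local_ring R P\<^esub> (n::nat) = frac (a [^] n) (s [^] n) \<and> s [^] n \<in> D"
proof (induction n)
  case 0
  then show ?case by (simp add: one_local_ring D_one[simplified])
next
  case (Suc n)
  have "a [^] n \<in> carrier R" using assms by simp
  then show ?case using Suc assms D_mult[of "s [^] n" s] by (simp add: mult_frac)
qed

lemma common_denominator:
  assumes "finite A" "A \<subseteq> carrier (local_ring R P)"
  obtains w where "w \<in> D" "\<And>x. x \<in> A \<Longrightarrow> \<exists>a\<in>carrier R. x = frac a w"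
proof -
  have "\<exists>w\<in>D. \<forall>x\<in>A. \<exists>a\<in>carrier R. x = frac a w"
    using assms
  proof (induction A)
    case empty
    then show ?case using D_one by blast
  next
    case (insert x A)
    then obtain w where w: "w \<in> D" "\<forall>x\<in>A. \<exists>a\<in>carrier R. x = frac a w" by auto
    obtain a s where a: "x = frac a s" "a \<in> carrier R" "s \<in> D" using insert by (auto elim: local_ringE)
    have "x = frac (w \<otimes> a) (w \<otimes> s)" using a w(1) frac_cancel by simp
    moreover have "\<exists>b\<in>carrier R. y = frac b (w \<otimes> s)" if y: "y \<in> A" for y
    proof -
      obtain b where b: "b \<in> carrier R" "y = frac b w" using bspec[OF w(2) y] by (rule bexE)
      have "y = frac (s \<otimes> b) (w \<otimes> s)"
        using b a(3) w(1) frac_cancel[of b w s] by (simp add: m_comm)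
      then show ?thesis using b a(3) by auto
    qed
    ultimately show ?case using w(1) a(2,3) D_mult[of w s] by (intro bexI[of _ "w \<otimes> s"]) auto
  qed
  then obtain w where "w \<in> D" "\<forall>x\<in>A. \<exists>a\<in>carrier R. x = frac a w" by (rule bexE)
  then show thesis by (intro that) auto
qed

end

lemma primeideal_spec_map:
  assumes R: "cring R" and h: "h \<in> ring_hom R S" and P: "primeideal P S"
  shows "primeideal (spec_map R h P) R"
proof -
  interpret S: primeideal P S by (rule P)
  interpret h: ring_hom_cring R S h by (intro ring_hom_cring.intro ring_hom_cring_axioms.intro R S.is_cring h)
  show ?thesis
  proof (rule primeidealI)
    show "ideal (spec_map R h P) R"
    proof (rule idealI)
      show "ring R" by (rule h.R.ring_axioms)
      show "subgroup (spec_map R h P) (add_monoid R)"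
        by (rule subgroup.intro) (auto simp: spec_map_def additive_subgroup.a_closed[OF S.is_additive_subgroup]
            additive_subgroup.zero_closed[OF S.is_additive_subgroup] additive_subgroup.a_inv_closed[OF S.is_additive_subgroup] simp flip: a_inv_def)
    qed (auto simp: spec_map_def S.I_l_closed S.I_r_closed)
    show "cring R" by (rule R)
    have "\<one>\<^bsub>S\<^esub> \<notin> P" using S.one_imp_carrier S.I_notcarr by auto
    then have "\<one>\<^bsub>R\<^esub> \<notin> spec_map R h P" by (simp add: spec_map_def)
    then show "carrier R \<noteq> spec_map R h P" using h.R.one_closed by metis
    fix a b assume "a \<in> carrier R" "b \<in> carrier R" "a \<otimes>\<^bsub>R\<^esub> b \<in> spec_map R h P"
    then show "a \<in> spec_map R h P \<or> b \<in> spec_map R h P"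
      using S.I_prime[of "h a" "h b"] by (simp add: spec_map_def)
  qed
qed

lemma local_domain_spec_map:
  assumes "local_domain P S" "domain R" "h \<in> ring_hom R S"
  shows "local_domain (spec_map R h P) R"
proof -
  interpret R: domain R by fact
  interpret S: local_domain P S by fact
  show ?thesis
    by (rule local_domain.intro[OF R.domain_axioms primeideal_spec_map[OF R.is_cring assms(3) S.prime_P]])
qed

lemma local_hom_frac:
  assumes "local_domain P S" "domain R" "h \<in> ring_hom R S"
    and a: "a \<in> carrier R" "s \<in> carrier R - spec_map R h P"
  shows "local_hom S h P (local_frac R (spec_map R h P) a s) = local_frac S P (h a) (h s)"
proof -
  define Q where "Q = spec_map R h P"
  interpret S: local_domain P S by fact
  interpret Q: local_domain Q R unfolding Q_def by (rule local_domain_spec_map) fact+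
  interpret h: ring_hom_cring R S h
    by (rule ring_hom_cring.intro[OF Q.is_cring S.is_cring ring_hom_cring_axioms.intro[OF assms(3)]])
  have a: "a \<in> carrier R" "s \<in> Q.D" using a by (simp_all add: Q_def)
  have h_D: "h t \<in> S.D" if "t \<in> Q.D" for t 
    using that h.hom_closed[of t] unfolding Q_def spec_map_def by simp
  have "local_hom S h P (Q.frac a s) = S.frac (h a) (h s)"
    unfolding local_hom_def
  proof (rule Q.UN_frac[OF a])
    fix b t assume bt: "(b, t) \<in> Q.frac a s"
    have "h b \<otimes>\<^bsub>S\<^esub> h s = h a \<otimes>\<^bsub>S\<^esub> h t"
      using bt unfolding Q.mem_frac_iff by (metis DiffD1 h.hom_mult)
    then show "S.frac (h b) (h t) = S.frac (h a) (h s)"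
      using bt h_D unfolding Q.mem_frac_iff by (subst S.frac_eq_iff) auto
  qed
  then show ?thesis by (simp add: Q_def)
qed

lemma local_hom_ring_hom:
  assumes "local_domain P S" "domain R" "h \<in> ring_hom R S"
  shows "local_hom S h P \<in> ring_hom (local_ring R (spec_map R h P)) (local_ring S P)"
proof -
  define Q where "Q = spec_map R h P"
  interpret S: local_domain P S by fact
  interpret Q: local_domain Q R unfolding Q_def by (rule local_domain_spec_map) fact+
  interpret h: ring_hom_cring R S h
    by (rule ring_hom_cring.intro[OF Q.is_cring S.is_cring ring_hom_cring_axioms.intro[OF assms(3)]])
  have h_D: "h t \<in> S.D" if "t \<in> Q.D" for t 
    using that h.hom_closed[of t] unfolding Q_def spec_map_def by simp
  have local_hom_frac: "local_hom S h P (Q.frac a s) = S.frac (h a) (h s)"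
    if "a \<in> carrier R" "s \<in> Q.D" for a s
    using local_hom_frac[OF assms] that by (simp add: Q_def)
  have "local_hom S h P \<in> ring_hom (local_ring R Q) (local_ring S P)"
  proof (rule ring_hom_memI)
    fix x assume x: "x \<in> carrier (local_ring R Q)"
    obtain a s where a: "x = Q.frac a s" "a \<in> carrier R" "s \<in> Q.D" using x by (rule Q.local_ringE)
    show "local_hom S h P x \<in> carrier (local_ring S P)"
      unfolding a(1) local_hom_frac[OF a(2,3)] using a h_D by (intro S.frac_closed) auto
    fix y assume y: "y \<in> carrier (local_ring R Q)"
    obtain b t where b: "y = Q.frac b t" "b \<in> carrier R" "t \<in> Q.D" using y by (rule Q.local_ringE)
    have st: "s \<otimes>\<^bsub>R\<^esub> t \<in> Q.D" using a b Q.D_mult by blast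
    have hs: "h s \<in> S.D" "h t \<in> S.D" using a b h_D by blast+
    show "local_hom S h P (x \<otimes>\<^bsub>local_ring R Q\<^esub> y) = local_hom S h P x \<otimes>\<^bsub>local_ring S P\<^esub> local_hom S h P y"
      unfolding a(1) b(1) Q.mult_frac[OF a(2,3) b(2,3)] local_hom_frac[OF a(2,3)] local_hom_frac[OF b(2,3)]
        local_hom_frac[OF Q.m_closed[OF a(2) b(2)] st]
      using a b hs by (subst S.mult_frac) auto
    have "local_hom S h P (Q.frac (a \<otimes>\<^bsub>R\<^esub> t \<oplus>\<^bsub>R\<^esub> b \<otimes>\<^bsub>R\<^esub> s) (s \<otimes>\<^bsub>R\<^esub> t)) =
        S.frac (h (a \<otimes>\<^bsub>R\<^esub> t \<oplus>\<^bsub>R\<^esub> b \<otimes>\<^bsub>R\<^esub> s)) (h (s \<otimes>\<^bsub>R\<^esub> t))"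
      using a b by (intro local_hom_frac st) auto
    also have "\<dots> = S.frac (h a \<otimes>\<^bsub>S\<^esub> h t \<oplus>\<^bsub>S\<^esub> h b \<otimes>\<^bsub>S\<^esub> h s) (h s \<otimes>\<^bsub>S\<^esub> h t)" using a b by simp
    finally show "local_hom S h P (x \<oplus>\<^bsub>local_ring R Q\<^esub> y) = local_hom S h P x \<oplus>\<^bsub>local_ring S P\<^esub> local_hom S h P y"
      unfolding a(1) b(1) Q.add_frac[OF a(2,3) b(2,3)] local_hom_frac[OF a(2,3)] local_hom_frac[OF b(2,3)]
      using a b hs by (subst S.add_frac) auto
  next
    show "local_hom S h P \<one>\<^bsub>local_ring R Q\<^esub> = \<one>\<^bsub>local_ring S P\<^esub>"
      unfolding Q.one_local_ring S.one_local_ring using Q.D_one by (simp add: local_hom_frac)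
  qed
  then show ?thesis by (simp add: Q_def)
qed

subsection \<open>A criterion for flatness\<close>

definition lin_span :: "('a, 'r) ring_scheme \<Rightarrow> ('a, 'm, 'x) module_scheme \<Rightarrow> 'm set \<Rightarrow> 'm set"
  where "lin_span R M E = {\<Oplus>\<^bsub>M\<^esub>e\<in>E. c e \<odot>\<^bsub>M\<^esub> e | c. c \<in> E \<rightarrow> carrier R}"

definition lin_independent :: "('a, 'r) ring_scheme \<Rightarrow> ('a, 'm, 'x) module_scheme \<Rightarrow> 'm set \<Rightarrow> bool"
  where "lin_independent R M E \<longleftrightarrow> finite E \<and> E \<subseteq> carrier M \<and>
    (\<forall>c\<in>E \<rightarrow> carrier R. (\<Oplus>\<^bsub>M\<^esub>e\<in>E. c e \<odot>\<^bsub>M\<^esub> e) = \<zero>\<^bsub>M\<^esub> \<longrightarrow> (\<forall>e\<in>E. c e = \<zero>\<^bsub>R\<^esub>))"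

text \<open>Such a module is the directed union of its free submodules of finite rank, hence flat.\<close>
definition locally_free :: "('a, 'r) ring_scheme \<Rightarrow> ('a, 'm, 'x) module_scheme \<Rightarrow> bool"
  where "locally_free R M \<longleftrightarrow>
    (\<forall>A. finite A \<longrightarrow> A \<subseteq> carrier M \<longrightarrow> (\<exists>E. lin_independent R M E \<and> A \<subseteq> lin_span R M E))"

text \<open>Coefficients are chosen by \<open>SOME\<close>; linear independence makes them unique,
  and uniqueness makes them linear.\<close>

lemma free_coordinates:
  assumes M: "Module.module R M" and independent: "lin_independent R M E"
  defines "F \<equiv> lin_span R M E"
  obtains co where "\<And>x e. x \<in> F \<Longrightarrow> e \<in> E \<Longrightarrow> co e x \<in> carrier R"
    "\<And>x. x \<in> F \<Longrightarrow> x = (\<Oplus>\<^bsub>M\<^esub>e\<in>E. co e x \<odot>\<^bsub>M\<^esub> e)"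
    "\<And>x y e. x \<in> F \<Longrightarrow> y \<in> F \<Longrightarrow> e \<in> E \<Longrightarrow> x \<oplus>\<^bsub>M\<^esub> y \<in> F \<and> co e (x \<oplus>\<^bsub>M\<^esub> y) = co e x \<oplus>\<^bsub>R\<^esub> co e y"
    "\<And>r x e. r \<in> carrier R \<Longrightarrow> x \<in> F \<Longrightarrow> e \<in> E \<Longrightarrow> r \<odot>\<^bsub>M\<^esub> x \<in> F \<and> co e (r \<odot>\<^bsub>M\<^esub> x) = r \<otimes>\<^bsub>R\<^esub> co e x"
proof -
  interpret M: module R M by (rule M)
  have E: "finite E" "E \<subseteq> carrier M"
    and indep: "\<And>c. c \<in> E \<rightarrow> carrier R \<Longrightarrow> (\<Oplus>\<^bsub>M\<^esub>e\<in>E. c e \<odot>\<^bsub>M\<^esub> e) = \<zero>\<^bsub>M\<^esub> \<Longrightarrow> \<forall>e\<in>E. c e = \<zero>\<^bsub>R\<^esub>"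
    using independent unfolding lin_independent_def by simp_all
  define lc where "lc c = (\<Oplus>\<^bsub>M\<^esub>e\<in>E. c e \<odot>\<^bsub>M\<^esub> e)" for c
  have term_closed: "(\<lambda>e. c e \<odot>\<^bsub>M\<^esub> e) \<in> E \<rightarrow> carrier M" if "c \<in> E \<rightarrow> carrier R" for c
    using that E(2) by auto
  have lc_add: "lc c \<oplus>\<^bsub>M\<^esub> lc c' = lc (\<lambda>e. c e \<oplus>\<^bsub>R\<^esub> c' e)"
    if c: "c \<in> E \<rightarrow> carrier R" "c' \<in> E \<rightarrow> carrier R" for c c'
  proof -
    have "lc (\<lambda>e. c e \<oplus>\<^bsub>R\<^esub> c' e) = (\<Oplus>\<^bsub>M\<^esub>e\<in>E. c e \<odot>\<^bsub>M\<^esub> e \<oplus>\<^bsub>M\<^esub> c' e \<odot>\<^bsub>M\<^esub> e)"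
      unfolding lc_def using c E(2) by (intro M.M.finsum_cong') (auto simp: M.smult_l_distr Pi_def subset_iff)
    then show ?thesis
      unfolding lc_def using term_closed c by (simp add: M.M.finsum_addf)
  qed
  have lc_smult: "r \<odot>\<^bsub>M\<^esub> lc c = lc (\<lambda>e. r \<otimes>\<^bsub>R\<^esub> c e)"
    if c: "c \<in> E \<rightarrow> carrier R" "r \<in> carrier R" for c r
  proof -
    have "lc (\<lambda>e. r \<otimes>\<^bsub>R\<^esub> c e) = (\<Oplus>\<^bsub>M\<^esub>e\<in>E. r \<odot>\<^bsub>M\<^esub> (c e \<odot>\<^bsub>M\<^esub> e))"
      unfolding lc_def using c E(2) by (intro M.M.finsum_cong') (auto simp: M.smult_assoc1 Pi_def subset_iff)
    then show ?thesis
      unfolding lc_def using M.finsum_smult_ldistr[OF E(1) c(2) term_closed[OF c(1)]] by simp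
  qed
  have lc_unique: "c e = c' e"
    if c: "c \<in> E \<rightarrow> carrier R" "c' \<in> E \<rightarrow> carrier R" and eq: "lc c = lc c'" and e: "e \<in> E" for c c' e
  proof -
    have m: "\<ominus>\<^bsub>R\<^esub> \<one>\<^bsub>R\<^esub> \<in> carrier R" by simp
    have mc: "(\<lambda>e. \<ominus>\<^bsub>R\<^esub> \<one>\<^bsub>R\<^esub> \<otimes>\<^bsub>R\<^esub> c' e) \<in> E \<rightarrow> carrier R" using c by auto
    have cl: "lc c' \<in> carrier M" unfolding lc_def using term_closed[OF c(2)] by simp
    have "lc (\<lambda>e. c e \<oplus>\<^bsub>R\<^esub> \<ominus>\<^bsub>R\<^esub> \<one>\<^bsub>R\<^esub> \<otimes>\<^bsub>R\<^esub> c' e) = lc c' \<oplus>\<^bsub>M\<^esub> (\<ominus>\<^bsub>R\<^esub> \<one>\<^bsub>R\<^esub>) \<odot>\<^bsub>M\<^esub> lc c'"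
      unfolding lc_smult[OF c(2) m] using lc_add[OF c(1) mc] eq by simp
    also have "\<dots> = \<zero>\<^bsub>M\<^esub>"
      using cl by (simp add: M.smult_l_minus M.M.r_neg)
    finally have "lc (\<lambda>e. c e \<oplus>\<^bsub>R\<^esub> \<ominus>\<^bsub>R\<^esub> \<one>\<^bsub>R\<^esub> \<otimes>\<^bsub>R\<^esub> c' e) = \<zero>\<^bsub>M\<^esub>" .
    moreover have "(\<lambda>e. c e \<oplus>\<^bsub>R\<^esub> \<ominus>\<^bsub>R\<^esub> \<one>\<^bsub>R\<^esub> \<otimes>\<^bsub>R\<^esub> c' e) \<in> E \<rightarrow> carrier R"
      using c mc by (simp add: Pi_def)
    ultimately have "c e \<oplus>\<^bsub>R\<^esub> \<ominus>\<^bsub>R\<^esub> \<one>\<^bsub>R\<^esub> \<otimes>\<^bsub>R\<^esub> c' e = \<zero>\<^bsub>R\<^esub>"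
      using bspec[OF indep e] unfolding lc_def by blast
    moreover have ce: "c e \<in> carrier R" "c' e \<in> carrier R" using c e by auto
    ultimately have "c e \<oplus>\<^bsub>R\<^esub> \<ominus>\<^bsub>R\<^esub> c' e = \<zero>\<^bsub>R\<^esub>" by (simp add: M.R.l_minus)
    then show ?thesis
      using M.R.minus_equality[of "c e" "\<ominus>\<^bsub>R\<^esub> c' e"] ce by simp
  qed
  define co where "co e x = (SOME c. c \<in> E \<rightarrow> carrier R \<and> x = lc c) e" for e x
  have co: "(\<lambda>e. co e x) \<in> E \<rightarrow> carrier R \<and> x = lc (\<lambda>e. co e x)" if "x \<in> F" for x
    using someI_ex[of "\<lambda>c. c \<in> E \<rightarrow> carrier R \<and> x = lc c"] that
    unfolding F_def lin_span_def lc_def[symmetric] co_def by auto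
  have co_lc: "co e (lc c) = c e" if "c \<in> E \<rightarrow> carrier R" "e \<in> E" for c e
  proof -
    have "lc c \<in> F" unfolding F_def lin_span_def lc_def using that by blast
    from co[OF this] show ?thesis using lc_unique[of "\<lambda>e. co e (lc c)" c e] that by auto
  qed
  have lc_F: "lc c \<in> F" if "c \<in> E \<rightarrow> carrier R" for c
    unfolding F_def lin_span_def lc_def using that by blast
  show thesis
  proof (rule that[of co])
    fix x y e r assume x: "x \<in> F"
    show "x = (\<Oplus>\<^bsub>M\<^esub>e\<in>E. co e x \<odot>\<^bsub>M\<^esub> e)" using co[OF x] unfolding lc_def by blast
    assume e: "e \<in> E"
    show "co e x \<in> carrier R" using co[OF x] e by auto
    { assume y: "y \<in> F"
      have *: "(\<lambda>e. co e x \<oplus>\<^bsub>R\<^esub> co e y) \<in> E \<rightarrow> carrier R" using co[OF x] co[OF y] by (auto simp: Pi_def)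
      have "x \<oplus>\<^bsub>M\<^esub> y = lc (\<lambda>e. co e x \<oplus>\<^bsub>R\<^esub> co e y)"
        using lc_add[of "\<lambda>e. co e x" "\<lambda>e. co e y"] co[OF x] co[OF y] by simp
      then show "x \<oplus>\<^bsub>M\<^esub> y \<in> F \<and> co e (x \<oplus>\<^bsub>M\<^esub> y) = co e x \<oplus>\<^bsub>R\<^esub> co e y"
        using lc_F[OF *] co_lc[OF * e] by simp }
    { assume r: "r \<in> carrier R"
      have *: "(\<lambda>e. r \<otimes>\<^bsub>R\<^esub> co e x) \<in> E \<rightarrow> carrier R" using co[OF x] r by (auto simp: Pi_def)
      have "r \<odot>\<^bsub>M\<^esub> x = lc (\<lambda>e. r \<otimes>\<^bsub>R\<^esub> co e x)"
        using lc_smult[of "\<lambda>e. co e x" r] co[OF x] r by simp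
      then show "r \<odot>\<^bsub>M\<^esub> x \<in> F \<and> co e (r \<odot>\<^bsub>M\<^esub> x) = r \<otimes>\<^bsub>R\<^esub> co e x"
        using lc_F[OF *] co_lc[OF * e] by simp }
  qed
qed

section \<open>Tensor relations and coordinates\<close>

locale tensor = M?: module R M + N: module R N for R and M (structure) and N
begin

abbreviation rels where "rels \<equiv> tensor_rels R M N"

lemma carrier_tensor_free: "z \<in> carrier (tensor_free M N) \<longleftrightarrow> Poly_Mapping.keys z \<subseteq> carrier M \<times> carrier N"
  by (simp add: tensor_free_def)

lemma frag_diff_closed:
  "a \<in> carrier M \<times> carrier N \<Longrightarrow> b \<in> carrier M \<times> carrier N \<Longrightarrow> frag_of a - frag_of b \<in> carrier (tensor_free M N)"
  unfolding carrier_tensor_free using keys_diff[of "frag_of a" "frag_of b"] by auto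

lemma frag_diff2_closed:
  "a \<in> carrier M \<times> carrier N \<Longrightarrow> b \<in> carrier M \<times> carrier N \<Longrightarrow> c \<in> carrier M \<times> carrier N \<Longrightarrow>
    frag_of a - frag_of b - frag_of c \<in> carrier (tensor_free M N)"
  using frag_diff_closed[of a b] unfolding carrier_tensor_free
  using keys_diff[of "frag_of a - frag_of b" "frag_of c"] by auto

lemma group_tensor_free: "group (tensor_free M N)"
  by (simp add: tensor_free_def)

lemma subgroup_rels: "subgroup rels (tensor_free M N)"
  unfolding tensor_rels_def
  by (rule group.generate_is_subgroup[OF group_tensor_free])
    (use frag_diff2_closed frag_diff_closed in \<open>auto simp: M.add.m_closed\<close>)

lemma rels_carrier: "z \<in> rels \<Longrightarrow> Poly_Mapping.keys z \<subseteq> carrier M \<times> carrier N"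
  using subgroup.mem_carrier[OF subgroup_rels] carrier_tensor_free by blast

lemma rels_zero: "0 \<in> rels"
  using subgroup.one_closed[OF subgroup_rels] by (simp add: tensor_free_def)

lemma rels_add: "z \<in> rels \<Longrightarrow> z' \<in> rels \<Longrightarrow> z + z' \<in> rels"
  using subgroup.m_closed[OF subgroup_rels] by (simp add: tensor_free_def)

lemma rels_minus: "z \<in> rels \<Longrightarrow> - z \<in> rels"
  using subgroup.m_inv_closed[OF subgroup_rels, of z] rels_carrier[of z] by (simp add: tensor_free_def)

lemma rels_diff: "z \<in> rels \<Longrightarrow> z' \<in> rels \<Longrightarrow> z - z' \<in> rels"
  using rels_add[of z "- z'"] rels_minus by simp

lemma rels_sum: "(\<And>i. i \<in> I \<Longrightarrow> f i \<in> rels) \<Longrightarrow> sum f I \<in> rels"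
  by (induction I rule: infinite_finite_induct) (auto intro: rels_zero rels_add)

lemma rels_add_left:
  "x \<in> carrier M \<Longrightarrow> x' \<in> carrier M \<Longrightarrow> y \<in> carrier N \<Longrightarrow>
    frag_of (x \<oplus> x', y) - frag_of (x, y) - frag_of (x', y) \<in> rels"
  unfolding tensor_rels_def by (rule generate.incl) blast

lemma rels_add_right:
  "x \<in> carrier M \<Longrightarrow> y \<in> carrier N \<Longrightarrow> y' \<in> carrier N \<Longrightarrow>
    frag_of (x, y \<oplus>\<^bsub>N\<^esub> y') - frag_of (x, y) - frag_of (x, y') \<in> rels"
  unfolding tensor_rels_def by (rule generate.incl) blast

lemma rels_smult:
  "r \<in> carrier R \<Longrightarrow> x \<in> carrier M \<Longrightarrow> y \<in> carrier N \<Longrightarrow>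
    frag_of (r \<odot> x, y) - frag_of (x, r \<odot>\<^bsub>N\<^esub> y) \<in> rels"
  unfolding tensor_rels_def by (rule generate.incl) blast

lemma rels_zero_left: "y \<in> carrier N \<Longrightarrow> frag_of (\<zero>, y) \<in> rels"
  using rels_minus[OF rels_add_left[of \<zero> \<zero> y]] by simp

lemma rels_zero_right: "x \<in> carrier M \<Longrightarrow> frag_of (x, \<zero>\<^bsub>N\<^esub>) \<in> rels"
  using rels_minus[OF rels_add_right[of x "\<zero>\<^bsub>N\<^esub>" "\<zero>\<^bsub>N\<^esub>"]] by simp

lemma rels_sum_left:
  assumes "finite E" "g \<in> E \<rightarrow> carrier M" "y \<in> carrier N"
  shows "frag_of (\<Oplus>e\<in>E. g e, y) - (\<Sum>e\<in>E. frag_of (g e, y)) \<in> rels"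
  using assms(1,2)
proof (induction E)
  case empty
  then show ?case using rels_zero_left assms(3) by simp
next
  case (insert e E)
  have "frag_of (\<Oplus>e\<in>E. g e, y) - (\<Sum>e\<in>E. frag_of (g e, y)) \<in> rels" using insert by auto
  moreover have "frag_of (g e \<oplus> (\<Oplus>e\<in>E. g e), y) - frag_of (g e, y) - frag_of (\<Oplus>e\<in>E. g e, y) \<in> rels"
    using insert(4) assms(3) by (intro rels_add_left M.finsum_closed) auto
  ultimately show ?case
    using rels_add insert by (force simp: Pi_def M.finsum_insert algebra_simps dest: rels_add)
qed

lemma hom_diff:
  assumes "abelian_group G" "\<theta> \<in> hom (tensor_free M N) (add_monoid G)"
    and ab: "a \<in> carrier (tensor_free M N)" "b \<in> carrier (tensor_free M N)"
  shows "\<theta> (a - b) = \<theta> a \<ominus>\<^bsub>G\<^esub> \<theta> b" "a - b \<in> carrier (tensor_free M N)"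
proof -
  interpret G: abelian_group G by fact
  interpret \<theta>: group_hom "tensor_free M N" "add_monoid G" \<theta>
    by (rule group_hom.intro[OF group_tensor_free G.a_group group_hom_axioms.intro[OF assms(2)]])
  have "a - b = a \<otimes>\<^bsub>tensor_free M N\<^esub> inv\<^bsub>tensor_free M N\<^esub> b"
    using ab(2) by (simp add: tensor_free_def)
  then show "\<theta> (a - b) = \<theta> a \<ominus>\<^bsub>G\<^esub> \<theta> b" "a - b \<in> carrier (tensor_free M N)"
    using ab by (simp_all add: a_minus_def a_inv_def)
qed

lemma hom_zero:
  assumes "abelian_group G" "\<theta> \<in> hom (tensor_free M N) (add_monoid G)"
  shows "\<theta> 0 = \<zero>\<^bsub>G\<^esub>"
proof -
  interpret G: abelian_group G by fact
  interpret \<theta>: group_hom "tensor_free M N" "add_monoid G" \<theta>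
    by (rule group_hom.intro[OF group_tensor_free G.a_group group_hom_axioms.intro[OF assms(2)]])
  show ?thesis using \<theta>.hom_one by (simp add: tensor_free_def)
qed

text \<open>The map from \<open>F \<otimes> N\<close> to \<open>N\<close> induced by a linear
  coordinate \<open>c\<close> on a submodule \<open>F\<close>. It lives on the free group over all
  of \<open>M\<close> because relations are formed there, but its values on generators are
  prescribed only over \<open>F\<close>, since \<open>c\<close> need not extend linearly to
  \<open>M\<close>.\<close>

definition coordinate_hom :: "'c set \<Rightarrow> ('c \<Rightarrow> 'a) \<Rightarrow> (('c \<times> 'e \<Rightarrow>\<^sub>0 int) \<Rightarrow> 'e) \<Rightarrow> bool"
  where "coordinate_hom F c \<theta> \<longleftrightarrow> F \<subseteq> carrier M \<and> c \<in> F \<rightarrow> carrier R \<and>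
      (\<forall>x\<in>F. \<forall>x'\<in>F. x \<oplus> x' \<in> F \<and> c (x \<oplus> x') = c x \<oplus>\<^bsub>R\<^esub> c x') \<and>
      (\<forall>r\<in>carrier R. \<forall>x\<in>F. r \<odot> x \<in> F \<and> c (r \<odot> x) = r \<otimes>\<^bsub>R\<^esub> c x) \<and>
      \<theta> \<in> hom (tensor_free M N) (add_monoid N) \<and>
      (\<forall>x\<in>F. \<forall>y\<in>carrier N. \<theta> (frag_of (x, y)) = c x \<odot>\<^bsub>N\<^esub> y)"

text \<open>A relation is a finite combination of basic relations, so it only involves finitely many elements
  of \<open>M\<close>.\<close>
lemma rels_finite_support:
  assumes "z \<in> rels"
  obtains A where "finite A" "A \<subseteq> carrier M"
    "\<And>F c \<theta>. A \<subseteq> F \<Longrightarrow> coordinate_hom F c \<theta> \<Longrightarrow> \<theta> z = \<zero>\<^bsub>N\<^esub>"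
proof -
  \<comment> \<open>The elements that satisfy the claim. The property is stable under differences,
    so it is enough to check the basic relations.\<close>
  define killed where "killed z \<longleftrightarrow> z \<in> carrier (tensor_free M N) \<and>
    (\<exists>A. finite A \<and> A \<subseteq> carrier M \<and> (\<forall>F c \<theta>. A \<subseteq> F \<longrightarrow> coordinate_hom F c \<theta> \<longrightarrow> \<theta> z = \<zero>\<^bsub>N\<^esub>))" for z
  note ab = N.M.abelian_group_axioms
  have \<theta>_hom: "\<theta> \<in> hom (tensor_free M N) (add_monoid N)" if "coordinate_hom F c \<theta>" for F c \<theta>
    using that unfolding coordinate_hom_def by blast
  have \<theta>_frag: "\<theta> (frag_of (x, y)) = c x \<odot>\<^bsub>N\<^esub> y" "c x \<in> carrier R"
    if "coordinate_hom F c \<theta>" "x \<in> F" "y \<in> carrier N" for F c \<theta> x y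
    using that unfolding coordinate_hom_def by auto
  have frag_carrier: "frag_of (x, y) \<in> carrier (tensor_free M N)" if "x \<in> carrier M" "y \<in> carrier N" for x y
    unfolding carrier_tensor_free using that by simp
  have killed_diff: "killed (z - z')" if z: "killed z" "killed z'" for z z'
  proof -
    obtain A A' where A: "finite A" "A \<subseteq> carrier M" "\<And>F c \<theta>. A \<subseteq> F \<Longrightarrow> coordinate_hom F c \<theta> \<Longrightarrow> \<theta> z = \<zero>\<^bsub>N\<^esub>"
      "finite A'" "A' \<subseteq> carrier M" "\<And>F c \<theta>. A' \<subseteq> F \<Longrightarrow> coordinate_hom F c \<theta> \<Longrightarrow> \<theta> z' = \<zero>\<^bsub>N\<^esub>"
      using z unfolding killed_def by (elim conjE exE) metis
    have zc: "z \<in> carrier (tensor_free M N)" "z' \<in> carrier (tensor_free M N)"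
      using z unfolding killed_def by blast+
    have "\<theta> (z - z') = \<zero>\<^bsub>N\<^esub>" if F: "A \<union> A' \<subseteq> F" "coordinate_hom F c \<theta>" for F c \<theta>
      unfolding hom_diff(1)[OF ab \<theta>_hom[OF F(2)] zc] using A(3)[of F c \<theta>] A(6)[of F c \<theta>] F
      by (simp add: a_minus_def)
    moreover have "z - z' \<in> carrier (tensor_free M N)"
      using zc keys_diff[of z z'] unfolding carrier_tensor_free by blast
    ultimately show ?thesis
      unfolding killed_def using A(1,2,4,5) by (intro conjI exI[of _ "A \<union> A'"]) auto
  qed
  have killed_zero: "killed 0"
    unfolding killed_def using hom_zero[OF ab \<theta>_hom]
    by (intro conjI exI[of _ "{}"]) (auto simp: carrier_tensor_free)
  have killedI: "killed z" if "z \<in> carrier (tensor_free M N)" "finite A" "A \<subseteq> carrier M"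
    "\<And>F c \<theta>. A \<subseteq> F \<Longrightarrow> coordinate_hom F c \<theta> \<Longrightarrow> \<theta> z = \<zero>\<^bsub>N\<^esub>" for z A
    unfolding killed_def using that by blast
  \<comment> \<open>The domain \<open>F\<close> of a coordinate is closed under sums and multiples,
    so it is enough that it contains \<open>x\<close> and \<open>x'\<close>.\<close>
  have add_left: "killed (frag_of (x \<oplus> x', y) - frag_of (x, y) - frag_of (x', y))"
    if c: "x \<in> carrier M" "x' \<in> carrier M" "y \<in> carrier N" for x x' y
  proof (rule killedI[of _ "{x, x'}"])
    show "frag_of (x \<oplus> x', y) - frag_of (x, y) - frag_of (x', y) \<in> carrier (tensor_free M N)"
      using c by (intro frag_diff2_closed) auto
    fix F c \<theta> assume F: "{x, x'} \<subseteq> F" "coordinate_hom F c \<theta>"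
    then have x: "x \<oplus> x' \<in> F" "c (x \<oplus> x') = c x \<oplus>\<^bsub>R\<^esub> c x'" unfolding coordinate_hom_def by auto
    have cx: "c x \<in> carrier R" "c x' \<in> carrier R" using F unfolding coordinate_hom_def by auto
    have "\<theta> (frag_of (x \<oplus> x', y) - frag_of (x, y) - frag_of (x', y)) =
        (c x \<oplus>\<^bsub>R\<^esub> c x') \<odot>\<^bsub>N\<^esub> y \<ominus>\<^bsub>N\<^esub> c x \<odot>\<^bsub>N\<^esub> y \<ominus>\<^bsub>N\<^esub> c x' \<odot>\<^bsub>N\<^esub> y"
      using F x that
      by (simp add: hom_diff[OF ab \<theta>_hom[OF F(2)]] frag_carrier \<theta>_frag(1)[OF F(2)])
    also have "\<dots> = \<zero>\<^bsub>N\<^esub>"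
      using cx that by (simp add: N.smult_l_distr a_minus_def N.M.a_ac N.M.r_neg N.M.r_neg1)
    finally show "\<theta> (frag_of (x \<oplus> x', y) - frag_of (x, y) - frag_of (x', y)) = \<zero>\<^bsub>N\<^esub>" .
  qed (use c in auto)
  have add_right: "killed (frag_of (x, y \<oplus>\<^bsub>N\<^esub> y') - frag_of (x, y) - frag_of (x, y'))"
    if c: "x \<in> carrier M" "y \<in> carrier N" "y' \<in> carrier N" for x y y'
  proof (rule killedI[of _ "{x}"])
    show "frag_of (x, y \<oplus>\<^bsub>N\<^esub> y') - frag_of (x, y) - frag_of (x, y') \<in> carrier (tensor_free M N)"
      using c by (intro frag_diff2_closed) auto
    fix F c \<theta> assume F: "{x} \<subseteq> F" "coordinate_hom F c \<theta>"
    have cx: "c x \<in> carrier R" using F unfolding coordinate_hom_def by auto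
    have "\<theta> (frag_of (x, y \<oplus>\<^bsub>N\<^esub> y') - frag_of (x, y) - frag_of (x, y')) =
        c x \<odot>\<^bsub>N\<^esub> (y \<oplus>\<^bsub>N\<^esub> y') \<ominus>\<^bsub>N\<^esub> c x \<odot>\<^bsub>N\<^esub> y \<ominus>\<^bsub>N\<^esub> c x \<odot>\<^bsub>N\<^esub> y'"
      using F that
      by (simp add: hom_diff[OF ab \<theta>_hom[OF F(2)]] frag_carrier \<theta>_frag(1)[OF F(2)])
    also have "\<dots> = \<zero>\<^bsub>N\<^esub>"
      using cx that by (simp add: N.smult_r_distr a_minus_def N.M.a_ac N.M.r_neg N.M.r_neg1)
    finally show "\<theta> (frag_of (x, y \<oplus>\<^bsub>N\<^esub> y') - frag_of (x, y) - frag_of (x, y')) = \<zero>\<^bsub>N\<^esub>" .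
  qed (use c in auto)
  have smult: "killed (frag_of (r \<odot> x, y) - frag_of (x, r \<odot>\<^bsub>N\<^esub> y))"
    if c: "r \<in> carrier R" "x \<in> carrier M" "y \<in> carrier N" for r x y
  proof (rule killedI[of _ "{x}"])
    show "frag_of (r \<odot> x, y) - frag_of (x, r \<odot>\<^bsub>N\<^esub> y) \<in> carrier (tensor_free M N)"
      using c by (intro frag_diff_closed) auto
    fix F c \<theta> assume F: "{x} \<subseteq> F" "coordinate_hom F c \<theta>"
    then have x: "r \<odot> x \<in> F" "c (r \<odot> x) = r \<otimes>\<^bsub>R\<^esub> c x" using that unfolding coordinate_hom_def by auto
    have cx: "c x \<in> carrier R" using F unfolding coordinate_hom_def by auto
    have "\<theta> (frag_of (r \<odot> x, y) - frag_of (x, r \<odot>\<^bsub>N\<^esub> y)) =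
        (r \<otimes>\<^bsub>R\<^esub> c x) \<odot>\<^bsub>N\<^esub> y \<ominus>\<^bsub>N\<^esub> c x \<odot>\<^bsub>N\<^esub> (r \<odot>\<^bsub>N\<^esub> y)"
      using F x that
      by (simp add: hom_diff[OF ab \<theta>_hom[OF F(2)]] frag_carrier \<theta>_frag(1)[OF F(2)])
    also have "\<dots> = \<zero>\<^bsub>N\<^esub>"
      using cx that N.smult_assoc1[of "c x" r y]
      by (simp add: M.R.m_comm[of r] a_minus_def N.M.r_neg)
    finally show "\<theta> (frag_of (r \<odot> x, y) - frag_of (x, r \<odot>\<^bsub>N\<^esub> y)) = \<zero>\<^bsub>N\<^esub>" .
  qed (use c in auto)
  have "killed z"
    using assms unfolding tensor_rels_def
  proof (induction rule: generate.induct)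
    case one
    then show ?case using killed_zero by (simp add: tensor_free_def)
  next
    case (incl h)
    then show ?case by (elim UnE CollectE exE conjE; simp only: add_left add_right smult)
  next
    case (inv h)
    then have h: "killed h" by (elim UnE CollectE exE conjE; simp only: add_left add_right smult)
    then have "inv\<^bsub>tensor_free M N\<^esub> h = 0 - h"
      unfolding killed_def by (simp add: tensor_free_def)
    then show ?case using killed_diff[OF killed_zero h] by simp
  next
    case (eng h h')
    have "h \<otimes>\<^bsub>tensor_free M N\<^esub> h' = h - (0 - h')" by (simp add: tensor_free_def)
    then show ?case using killed_diff[OF eng(3) killed_diff[OF killed_zero eng(4)]] by simp
  qed
  then obtain A where A: "finite A" "A \<subseteq> carrier M" "\<forall>F c \<theta>. A \<subseteq> F \<longrightarrow> coordinate_hom F c \<theta> \<longrightarrow> \<theta> z = \<zero>\<^bsub>N\<^esub>"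
    unfolding killed_def by blast
  then show thesis using that by blast
qed

end

text \<open>Let \<open>\<Phi> z\<close> be a relation over \<open>N'\<close>. The first components
  of \<open>z\<close> and the finitely many elements of \<open>M\<close> on which this relation
  depends lie in one free submodule. Its coordinate maps send \<open>\<Phi> z\<close> to zero in
  \<open>N'\<close>; injectivity of \<open>f\<close> moves this back to \<open>N\<close>, and
  \<open>z\<close> is recovered from its coordinates.\<close>

theorem flat_module_of_locally_free:
  fixes M :: "('a, 'm, 'x) module_scheme"
  assumes M: "Module.module R M" and free: "locally_free R M"
  shows "flat_module TYPE('n) TYPE('k) R M"
  unfolding flat_module_def
proof (intro conjI allI impI M)
  fix N :: "('a, 'n) module" and N' :: "('a, 'k) module" and f
  assume N: "Module.module R N" and N': "Module.module R N'" and f: "f \<in> lin_maps R N N'"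
    and inj: "inj_on f (carrier N)"
  interpret M: module R M by (rule M)
  interpret N: module R N by (rule N)
  interpret N': module R N' by (rule N')
  interpret T: tensor R M N by (intro tensor.intro M N)
  interpret T': tensor R M N' by (intro tensor.intro M N')
  define \<Phi> where "\<Phi> = frag_extend (\<lambda>(x :: 'm, y). frag_of (x, f y))"
  have f_closed: "f y \<in> carrier N'" if "y \<in> carrier N" for y
    using f that unfolding lin_maps_def by auto
  have f_add: "f (y \<oplus>\<^bsub>N\<^esub> y') = f y \<oplus>\<^bsub>N'\<^esub> f y'" if "y \<in> carrier N" "y' \<in> carrier N" for y y'
    using f that unfolding lin_maps_def by auto
  have f_smult: "f (r \<odot>\<^bsub>N\<^esub> y) = r \<odot>\<^bsub>N'\<^esub> f y" if "r \<in> carrier R" "y \<in> carrier N" for r y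
    using f that unfolding lin_maps_def by auto
  interpret f: group_hom "add_monoid N" "add_monoid N'" f
    by (rule group_hom.intro[OF N.M.a_group N'.M.a_group group_hom_axioms.intro])
      (auto simp: hom_def f_closed f_add)
  have f_zero: "f \<zero>\<^bsub>N\<^esub> = \<zero>\<^bsub>N'\<^esub>" using f.hom_one by simp
  have f_diff: "f (y \<ominus>\<^bsub>N\<^esub> y') = f y \<ominus>\<^bsub>N'\<^esub> f y'" if "y \<in> carrier N" "y' \<in> carrier N" for y y'
    using that f.hom_inv[of y'] by (simp add: a_minus_def f_add f_closed a_inv_def[symmetric])
  have \<Phi>_frag: "\<Phi> (frag_of (x, y)) = frag_of (x, f y)" for x y by (simp add: \<Phi>_def)
  have \<Phi>_diff: "\<Phi> (a - b) = \<Phi> a - \<Phi> b" for a b by (simp add: \<Phi>_def frag_extend_diff)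
  have \<Phi>_closed: "\<Phi> a \<in> carrier (tensor_free M N')" if a: "a \<in> carrier (tensor_free M N)" for a
    using a unfolding T.carrier_tensor_free
  proof (induction a rule: free_Abelian_group_induct[consumes 1, case_names zero diff frag])
    case zero then show ?case by (simp add: \<Phi>_def T'.carrier_tensor_free)
  next
    case (diff a b) then show ?case
      using keys_diff[of "\<Phi> a" "\<Phi> b"] unfolding \<Phi>_diff T'.carrier_tensor_free by blast
  next
    case (frag p) then show ?case
      by (cases p) (auto simp: \<Phi>_frag T'.carrier_tensor_free f_closed)
  qed
  have key: "z \<in> T.rels" if z: "z \<in> carrier (tensor_free M N)" and \<Phi>z: "\<Phi> z \<in> T'.rels" for z
  proof -
    obtain A where A: "finite A" "A \<subseteq> carrier M"
      and kill: "\<And>F c \<theta>. A \<subseteq> F \<Longrightarrow> T'.coordinate_hom F c \<theta> \<Longrightarrow> \<theta> (\<Phi> z) = \<zero>\<^bsub>N'\<^esub>"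
      using T'.rels_finite_support[OF \<Phi>z] by blast
    have zk: "Poly_Mapping.keys z \<subseteq> carrier M \<times> carrier N" using z T.carrier_tensor_free by blast
    define A' where "A' = A \<union> fst ` Poly_Mapping.keys z"
    have "finite A'" "A' \<subseteq> carrier M" using A zk unfolding A'_def by auto
    then obtain E where indep: "lin_independent R M E" and span: "A' \<subseteq> lin_span R M E"
      using free unfolding locally_free_def by blast
    have E: "finite E" "E \<subseteq> carrier M" using indep unfolding lin_independent_def by simp_all
    define F where "F = lin_span R M E"
    obtain co where co: "\<And>x e. x \<in> F \<Longrightarrow> e \<in> E \<Longrightarrow> co e x \<in> carrier R"
      and co_sum: "\<And>x. x \<in> F \<Longrightarrow> x = (\<Oplus>\<^bsub>M\<^esub>e\<in>E. co e x \<odot>\<^bsub>M\<^esub> e)"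
      and co_add: "\<And>x y e. x \<in> F \<Longrightarrow> y \<in> F \<Longrightarrow> e \<in> E \<Longrightarrow> x \<oplus>\<^bsub>M\<^esub> y \<in> F \<and> co e (x \<oplus>\<^bsub>M\<^esub> y) = co e x \<oplus>\<^bsub>R\<^esub> co e y"
      and co_smult: "\<And>r x e. r \<in> carrier R \<Longrightarrow> x \<in> F \<Longrightarrow> e \<in> E \<Longrightarrow> r \<odot>\<^bsub>M\<^esub> x \<in> F \<and> co e (r \<odot>\<^bsub>M\<^esub> x) = r \<otimes>\<^bsub>R\<^esub> co e x"
      unfolding F_def using free_coordinates[OF M indep] by blast
    have F: "F \<subseteq> carrier M" unfolding F_def lin_span_def using E(2) by (auto intro!: M.M.finsum_closed)
    have zF: "Poly_Mapping.keys z \<subseteq> F \<times> carrier N"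
    proof
      fix p assume p: "p \<in> Poly_Mapping.keys z"
      then have "fst p \<in> F" using span unfolding A'_def F_def[symmetric] by blast
      then show "p \<in> F \<times> carrier N" using zk p by (cases p) auto
    qed
    have "\<exists>\<theta>. \<theta> \<in> hom (tensor_free M N) (add_monoid N) \<and> \<theta> z = \<zero>\<^bsub>N\<^esub> \<and>
        (\<forall>x\<in>F. \<forall>y\<in>carrier N. \<theta> (frag_of (x, y)) = co e x \<odot>\<^bsub>N\<^esub> y)" if e: "e \<in> E" for e
    proof -
      have 1: "(\<lambda>(x, y). if x \<in> F then co e x \<odot>\<^bsub>N\<^esub> y else \<zero>\<^bsub>N\<^esub>) ` (carrier M \<times> carrier N) \<subseteq> carrier (add_monoid N)"
        using co e by auto
      obtain \<theta> where \<theta>: "\<theta> \<in> hom (tensor_free M N) (add_monoid N)"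
        "\<And>p. p \<in> carrier M \<times> carrier N \<Longrightarrow> \<theta> (frag_of p) = (\<lambda>(x, y). if x \<in> F then co e x \<odot>\<^bsub>N\<^esub> y else \<zero>\<^bsub>N\<^esub>) p"
        unfolding tensor_free_def
        by (rule comm_group.free_Abelian_group_universal[OF N.M.a_comm_group 1]) blast
      have 2: "(\<lambda>(x, y). if x \<in> F then co e x \<odot>\<^bsub>N'\<^esub> y else \<zero>\<^bsub>N'\<^esub>) ` (carrier M \<times> carrier N') \<subseteq> carrier (add_monoid N')"
        using co e by auto
      obtain \<theta>' where \<theta>': "\<theta>' \<in> hom (tensor_free M N') (add_monoid N')"
        "\<And>p. p \<in> carrier M \<times> carrier N' \<Longrightarrow> \<theta>' (frag_of p) = (\<lambda>(x, y). if x \<in> F then co e x \<odot>\<^bsub>N'\<^esub> y else \<zero>\<^bsub>N'\<^esub>) p"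
        unfolding tensor_free_def
        by (rule comm_group.free_Abelian_group_universal[OF N'.M.a_comm_group 2]) blast
      have \<theta>_frag: "\<theta> (frag_of (x, y)) = co e x \<odot>\<^bsub>N\<^esub> y" if "x \<in> F" "y \<in> carrier N" for x y
        using \<theta>(2)[of "(x, y)"] that F by auto
      have \<theta>'_frag: "\<theta>' (frag_of (x, y)) = co e x \<odot>\<^bsub>N'\<^esub> y" if "x \<in> F" "y \<in> carrier N'" for x y
        using \<theta>'(2)[of "(x, y)"] that F by auto
      have "\<theta>' (\<Phi> z) = \<zero>\<^bsub>N'\<^esub>"
        using span co co_add co_smult e F \<theta>'(1) \<theta>'_frag
        by (intro kill[of F "co e"]) (auto simp: T'.coordinate_hom_def A'_def F_def[symmetric])
      \<comment> \<open>Naturality of the coordinate maps in \<open>f\<close>: mapping to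
        \<open>N'\<close> before or after taking the coordinate gives the same result.\<close>
      moreover have "w \<in> carrier (tensor_free M N) \<and> f (\<theta> w) = \<theta>' (\<Phi> w)"
        if "Poly_Mapping.keys w \<subseteq> F \<times> carrier N" for w
        using that
      proof (induction w rule: free_Abelian_group_induct[consumes 1, case_names zero diff frag])
        case zero
        then show ?case
          using T.hom_zero[OF N.M.abelian_group_axioms \<theta>(1)] T'.hom_zero[OF N'.M.abelian_group_axioms \<theta>'(1)]
          by (simp add: \<Phi>_def T.carrier_tensor_free f_zero)
      next
        case (diff a b)
        have c: "a \<in> carrier (tensor_free M N)" "b \<in> carrier (tensor_free M N)" using diff by blast+
        have "\<theta> a \<in> carrier N" "\<theta> b \<in> carrier N"
          using hom_in_carrier[OF \<theta>(1) c(1)] hom_in_carrier[OF \<theta>(1) c(2)] by simp_all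
        then show ?case
          using diff T.hom_diff[OF N.M.abelian_group_axioms \<theta>(1) c]
            T'.hom_diff[OF N'.M.abelian_group_axioms \<theta>'(1) \<Phi>_closed[OF c(1)] \<Phi>_closed[OF c(2)]]
          by (simp add: \<Phi>_diff f_diff)
      next
        case (frag p)
        then show ?case
          using F co e by (cases p)
            (auto simp: \<Phi>_frag \<theta>_frag \<theta>'_frag f_closed f_smult T.carrier_tensor_free)
      qed
      ultimately have "f (\<theta> z) = f \<zero>\<^bsub>N\<^esub>" using zF f_zero by simp
      moreover have "\<theta> z \<in> carrier N" using hom_in_carrier[OF \<theta>(1) z] by simp
      ultimately have "\<theta> z = \<zero>\<^bsub>N\<^esub>" using inj by (auto dest: inj_onD)
      then show ?thesis using \<theta>(1) \<theta>_frag by blast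
    qed
    then obtain \<theta> where \<theta>: "\<And>e. e \<in> E \<Longrightarrow> \<theta> e \<in> hom (tensor_free M N) (add_monoid N)"
      "\<And>e. e \<in> E \<Longrightarrow> \<theta> e z = \<zero>\<^bsub>N\<^esub>"
      "\<And>e x y. e \<in> E \<Longrightarrow> x \<in> F \<Longrightarrow> y \<in> carrier N \<Longrightarrow> \<theta> e (frag_of (x, y)) = co e x \<odot>\<^bsub>N\<^esub> y"
      by metis
    \<comment> \<open>Modulo relations \<open>w\<close> is the sum of the
      \<open>e \<otimes> \<theta> e w\<close>, its expansion in the basis \<open>E\<close>.\<close>
    have "w \<in> carrier (tensor_free M N) \<and> w - (\<Sum>e\<in>E. frag_of (e, \<theta> e w)) \<in> T.rels"
      if "Poly_Mapping.keys w \<subseteq> F \<times> carrier N" for w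
      using that
    proof (induction w rule: free_Abelian_group_induct[consumes 1, case_names zero diff frag])
      case zero
      have "(\<Sum>e\<in>E. frag_of (e, \<theta> e 0)) \<in> T.rels"
        using T.hom_zero[OF N.M.abelian_group_axioms \<theta>(1)] E(2)
        by (intro T.rels_sum) (auto intro!: T.rels_zero_right)
      then show ?case using T.rels_minus by (auto simp: T.carrier_tensor_free)
    next
      case (diff a b)
      have c: "a \<in> carrier (tensor_free M N)" "b \<in> carrier (tensor_free M N)" using diff by blast+
      have "frag_of (e, \<theta> e a) - frag_of (e, \<theta> e (a - b)) - frag_of (e, \<theta> e b) \<in> T.rels" if e: "e \<in> E" for e
      proof -
        have cl: "\<theta> e a \<in> carrier N" "\<theta> e b \<in> carrier N"
          using hom_in_carrier[OF \<theta>(1)[OF e] c(1)] hom_in_carrier[OF \<theta>(1)[OF e] c(2)] by simp_all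
        have eq: "\<theta> e (a - b) = \<theta> e a \<ominus>\<^bsub>N\<^esub> \<theta> e b"
          by (rule T.hom_diff(1)[OF N.M.abelian_group_axioms \<theta>(1)[OF e] c])
        have "frag_of (e, \<theta> e (a - b) \<oplus>\<^bsub>N\<^esub> \<theta> e b) - frag_of (e, \<theta> e (a - b)) - frag_of (e, \<theta> e b) \<in> T.rels"
          using E(2) e cl unfolding eq by (intro T.rels_add_right) auto
        moreover have "\<theta> e (a - b) \<oplus>\<^bsub>N\<^esub> \<theta> e b = \<theta> e a"
          unfolding eq using cl by (simp add: a_minus_def N.M.a_assoc N.M.l_neg)
        ultimately show ?thesis by simp
      qed
      then have "(\<Sum>e\<in>E. frag_of (e, \<theta> e a) - frag_of (e, \<theta> e (a - b)) - frag_of (e, \<theta> e b)) \<in> T.rels"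
        by (rule T.rels_sum)
      moreover have "a - (\<Sum>e\<in>E. frag_of (e, \<theta> e a)) - (b - (\<Sum>e\<in>E. frag_of (e, \<theta> e b))) \<in> T.rels"
        using T.rels_diff[OF conjunct2[OF diff(3)] conjunct2[OF diff(4)]] .
      ultimately have "a - (\<Sum>e\<in>E. frag_of (e, \<theta> e a)) - (b - (\<Sum>e\<in>E. frag_of (e, \<theta> e b))) +
          (\<Sum>e\<in>E. frag_of (e, \<theta> e a) - frag_of (e, \<theta> e (a - b)) - frag_of (e, \<theta> e b)) \<in> T.rels"
        by (rule T.rels_add[rotated])
      then have "a - b - (\<Sum>e\<in>E. frag_of (e, \<theta> e (a - b))) \<in> T.rels"
      proof -
        have "p - q - (r - s) + (q - t - s) = p - r - t" for p q r s t :: "'m \<times> 'n \<Rightarrow>\<^sub>0 int"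
          by simp
        with \<open>_ + _ \<in> T.rels\<close> show ?thesis unfolding sum_subtractf by simp
      qed
      moreover have "a - b \<in> carrier (tensor_free M N)"
        using keys_diff[of a b] c unfolding T.carrier_tensor_free by blast
      ultimately show ?case by blast
    next
      case (frag p)
      obtain x y where p: "p = (x, y)" "x \<in> F" "y \<in> carrier N" using frag by (cases p) auto
      have "frag_of (x, y) - (\<Sum>e\<in>E. frag_of (co e x \<odot>\<^bsub>M\<^esub> e, y)) \<in> T.rels"
        using p co E T.rels_sum_left[of E "\<lambda>e. co e x \<odot>\<^bsub>M\<^esub> e" y] co_sum[OF p(2)] by auto
      moreover have "(\<Sum>e\<in>E. frag_of (co e x \<odot>\<^bsub>M\<^esub> e, y) - frag_of (e, co e x \<odot>\<^bsub>N\<^esub> y)) \<in> T.rels"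
        using p co E by (intro T.rels_sum T.rels_smult) auto
      ultimately have "frag_of (x, y) - (\<Sum>e\<in>E. frag_of (co e x \<odot>\<^bsub>M\<^esub> e, y)) +
          (\<Sum>e\<in>E. frag_of (co e x \<odot>\<^bsub>M\<^esub> e, y) - frag_of (e, co e x \<odot>\<^bsub>N\<^esub> y)) \<in> T.rels"
        by (rule T.rels_add)
      then have "frag_of (x, y) - (\<Sum>e\<in>E. frag_of (e, co e x \<odot>\<^bsub>N\<^esub> y)) \<in> T.rels"
        by (simp add: sum_subtractf)
      then show ?case
        using p F \<theta>(3) by (auto simp: T.carrier_tensor_free)
    qed
    from this[OF zF] have "z - (\<Sum>e\<in>E. frag_of (e, \<zero>\<^bsub>N\<^esub>)) \<in> T.rels" using \<theta>(2) by simp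
    moreover have "(\<Sum>e\<in>E. frag_of (e, \<zero>\<^bsub>N\<^esub>)) \<in> T.rels"
      using E(2) by (intro T.rels_sum T.rels_zero_right) auto
    ultimately have "z - (\<Sum>e\<in>E. frag_of (e, \<zero>\<^bsub>N\<^esub>)) + (\<Sum>e\<in>E. frag_of (e, \<zero>\<^bsub>N\<^esub>)) \<in> T.rels"
      by (rule T.rels_add)
    then show "z \<in> T.rels" by simp
  qed
  show "inj_on (tensor_map R M N' f) (carrier (tensor_product R M N))"
  proof (rule inj_onI)
    fix X Y assume X: "X \<in> carrier (tensor_product R M N)" and Y: "Y \<in> carrier (tensor_product R M N)"
      and eq: "tensor_map R M N' f X = tensor_map R M N' f Y"
    have coset: "T.rels #>\<^bsub>tensor_free M N\<^esub> a = {h + a | h. h \<in> T.rels}" for a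
      unfolding r_coset_def by (auto simp: tensor_free_def)
    have coset': "T'.rels #>\<^bsub>tensor_free M N'\<^esub> a = {h + a | h. h \<in> T'.rels}" for a
      unfolding r_coset_def by (auto simp: tensor_free_def)
    obtain a b where a: "X = {h + a | h. h \<in> T.rels}" "a \<in> carrier (tensor_free M N)"
      and b: "Y = {h + b | h. h \<in> T.rels}" "b \<in> carrier (tensor_free M N)"
      using X Y unfolding tensor_product_def FactGroup_def RCOSETS_def coset by auto
    have map: "tensor_map R M N' f Z = (\<Union>z\<in>Z. {h + \<Phi> z | h. h \<in> T'.rels})" for Z
      unfolding tensor_map_def coset' \<Phi>_def ..
    have "a \<in> X" unfolding a using T.rels_zero by force
    then have "\<Phi> a \<in> tensor_map R M N' f X" unfolding map using T'.rels_zero by force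
    then obtain h' h where h: "\<Phi> a = h' + \<Phi> (h + b)" "h' \<in> T'.rels" "h \<in> T.rels"
      unfolding eq unfolding map b by blast
    have c: "h + b \<in> carrier (tensor_free M N)"
      using T.rels_carrier[OF h(3)] b(2) keys_add[of h b] unfolding T.carrier_tensor_free by blast
    have "a - (h + b) \<in> carrier (tensor_free M N)"
      using c a(2) keys_diff[of a "h + b"] unfolding T.carrier_tensor_free by blast
    moreover have "\<Phi> (a - (h + b)) \<in> T'.rels" unfolding \<Phi>_diff h(1) using h(2) by simp
    ultimately have "a - (h + b) \<in> T.rels" by (rule key)
    from T.rels_add[OF this h(3)] have ab: "a - b \<in> T.rels" by simp
    have "{h + a | h. h \<in> T.rels} = {h + b | h. h \<in> T.rels}"
    proof (intro equalityI subsetI; clarify)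
      fix g assume "g \<in> T.rels"
      then show "\<exists>h. g + a = h + b \<and> h \<in> T.rels"
        using T.rels_add[OF _ ab] by (intro exI[of _ "g + (a - b)"]) auto
    next
      fix g assume "g \<in> T.rels"
      then show "\<exists>h. g + b = h + a \<and> h \<in> T.rels"
        using T.rels_diff[OF _ ab] by (intro exI[of _ "g - (a - b)"]) auto
    qed
    then show "X = Y" unfolding a(1) b(1) .
  qed
qed

section \<open>Restriction of scalars and localization of locally free modules\<close>

lemma restrict_scalars_simps [simp]:
  "carrier (restrict_scalars S h) = carrier S" "\<zero>\<^bsub>restrict_scalars S h\<^esub> = \<zero>\<^bsub>S\<^esub>"
  "x \<oplus>\<^bsub>restrict_scalars S h\<^esub> y = x \<oplus>\<^bsub>S\<^esub> y" "r \<odot>\<^bsub>restrict_scalars S h\<^esub> x = h r \<otimes>\<^bsub>S\<^esub> x"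
  "finsum (restrict_scalars S h) f A = finsum S f A"
  by (simp_all add: restrict_scalars_def finsum_def finprod_def)

lemma module_restrict_scalars:
  assumes "cring R" "cring S" "h \<in> ring_hom R S"
  shows "Module.module R (restrict_scalars S h)"
proof -
  interpret h: ring_hom_cring R S h
    by (rule ring_hom_cring.intro[OF assms(1,2) ring_hom_cring_axioms.intro[OF assms(3)]])
  show ?thesis
  proof (rule moduleI)
    show "abelian_group (restrict_scalars S h)"
    proof (rule abelian_groupI)
      fix x assume "x \<in> carrier (restrict_scalars S h)"
      then show "\<exists>y\<in>carrier (restrict_scalars S h). y \<oplus>\<^bsub>restrict_scalars S h\<^esub> x = \<zero>\<^bsub>restrict_scalars S h\<^esub>"
        using h.S.l_neg[of x] h.S.a_inv_closed[of x] unfolding restrict_scalars_simps by blast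
    qed (simp_all add: h.S.a_ac)
  qed (auto simp: h.S.l_distr h.S.r_distr h.S.m_assoc assms(1))
qed

text \<open>Write the given fractions over a common denominator \<open>w\<close>; if
  \<open>E\<close> is a basis of a free submodule containing the numerators, the fractions
  \<open>e / w\<close> serve over the local ring. A relation between them becomes a relation over
  \<open>R\<close> once the coefficients have a common denominator.\<close>

lemma locally_free_local_ring:
  assumes "domain R" "domain S" and h: "h \<in> ring_hom R S" and inj: "inj_on h (carrier R)"
    and free: "locally_free R (restrict_scalars S h)" and P: "primeideal P S"
  shows "locally_free (local_ring R (spec_map R h P)) (restrict_scalars (local_ring S P) (local_hom S h P))"
proof -
  define Q where "Q = spec_map R h P"
  have S: "local_domain P S" by (rule local_domain.intro) fact+
  interpret S: local_domain P S by (rule S)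
  interpret Q: local_domain Q R unfolding Q_def by (rule local_domain_spec_map) fact+
  interpret h: ring_hom_cring R S h
    by (rule ring_hom_cring.intro[OF Q.is_cring S.is_cring ring_hom_cring_axioms.intro[OF h]])
  interpret LS: cring "local_ring S P" by (rule S.cring_local_ring)
  interpret LR: cring "local_ring R Q" by (rule Q.cring_local_ring)
  have h_D: "h t \<in> S.D" if "t \<in> Q.D" for t
    using that h.hom_closed[of t] unfolding Q_def spec_map_def by simp
  have lh: "local_hom S h P (Q.frac a s) = S.frac (h a) (h s)" if "a \<in> carrier R" "s \<in> Q.D" for a s
    using local_hom_frac[OF S assms(1) h] that by (simp add: Q_def)
  have lh_ring: "local_hom S h P \<in> ring_hom (local_ring R Q) (local_ring S P)"
    using local_hom_ring_hom[OF S assms(1) h] by (simp add: Q_def)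
  have "locally_free (local_ring R Q) (restrict_scalars (local_ring S P) (local_hom S h P))"
    unfolding locally_free_def restrict_scalars_simps
  proof (intro allI impI)
    fix A assume A: "finite A" "A \<subseteq> carrier (local_ring S P)"
    obtain w where w: "w \<in> S.D" and ex: "\<And>x. x \<in> A \<Longrightarrow> \<exists>a\<in>carrier S. x = S.frac a w"
      using S.common_denominator[OF A] by blast
    obtain num where num: "\<And>x. x \<in> A \<Longrightarrow> num x \<in> carrier S" "\<And>x. x \<in> A \<Longrightarrow> x = S.frac (num x) w"
      using ex by metis
    have "finite (num ` A)" "num ` A \<subseteq> carrier (restrict_scalars S h)" using A num by auto
    then obtain E where indep: "lin_independent R (restrict_scalars S h) E"
      and span: "num ` A \<subseteq> lin_span R (restrict_scalars S h) E"
      using free unfolding locally_free_def by blast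
    have E: "finite E" "E \<subseteq> carrier S"
      and indep: "\<And>c. c \<in> E \<rightarrow> carrier R \<Longrightarrow> (\<Oplus>\<^bsub>S\<^esub>e\<in>E. h (c e) \<otimes>\<^bsub>S\<^esub> e) = \<zero>\<^bsub>S\<^esub> \<Longrightarrow> \<forall>e\<in>E. c e = \<zero>\<^bsub>R\<^esub>"
      using indep unfolding lin_independent_def by simp_all
    define q where "q e = S.frac e w" for e
    have inj_q: "inj_on q E"
    proof (rule inj_onI)
      fix e e' assume e: "e \<in> E" "e' \<in> E" "q e = q e'"
      then have "e \<otimes>\<^bsub>S\<^esub> w = e' \<otimes>\<^bsub>S\<^esub> w"
        using E(2) w S.frac_eq_iff[of e w e' w] unfolding q_def by auto
      then show "e = e'" using e E(2) w S.m_rcancel[OF S.D_nonzero[OF w], of e e'] by auto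
    qed
    have q_closed: "q e \<in> carrier (local_ring S P)" if "e \<in> E" for e
      unfolding q_def using that E(2) w by (intro S.frac_closed) auto
    have sum: "(\<Oplus>\<^bsub>local_ring S P\<^esub>x\<in>q ` E. local_hom S h P (c x) \<otimes>\<^bsub>local_ring S P\<^esub> x) =
        S.frac (\<Oplus>\<^bsub>S\<^esub>e\<in>E. h (r e) \<otimes>\<^bsub>S\<^esub> e) (h t \<otimes>\<^bsub>S\<^esub> w)"
      if c: "\<And>e. e \<in> E \<Longrightarrow> c (q e) = Q.frac (r e) t" and r: "\<And>e. e \<in> E \<Longrightarrow> r e \<in> carrier R" and t: "t \<in> Q.D"
      for c r t
    proof -
      have cl: "local_hom S h P (c (q e)) \<otimes>\<^bsub>local_ring S P\<^esub> q e \<in> carrier (local_ring S P)" if "e \<in> E" for e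
        using that q_closed c r t by (auto intro!: ring_hom_closed[OF lh_ring] Q.frac_closed)
      have "(\<Oplus>\<^bsub>local_ring S P\<^esub>x\<in>q ` E. local_hom S h P (c x) \<otimes>\<^bsub>local_ring S P\<^esub> x) =
          (\<Oplus>\<^bsub>local_ring S P\<^esub>e\<in>E. local_hom S h P (c (q e)) \<otimes>\<^bsub>local_ring S P\<^esub> q e)"
        using cl by (intro LS.finsum_reindex inj_q) auto
      also have "\<dots> = (\<Oplus>\<^bsub>local_ring S P\<^esub>e\<in>E. S.frac (h (r e) \<otimes>\<^bsub>S\<^esub> e) (h t \<otimes>\<^bsub>S\<^esub> w))"
      proof (rule LS.finsum_cong')
        fix e assume e: "e \<in> E"
        show "local_hom S h P (c (q e)) \<otimes>\<^bsub>local_ring S P\<^esub> q e = S.frac (h (r e) \<otimes>\<^bsub>S\<^esub> e) (h t \<otimes>\<^bsub>S\<^esub> w)"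
          unfolding c[OF e] lh[OF r[OF e] t] unfolding q_def
          using E(2) e w h_D[OF t] r[OF e] by (intro S.mult_frac) auto
      next
        show "(\<lambda>e. S.frac (h (r e) \<otimes>\<^bsub>S\<^esub> e) (h t \<otimes>\<^bsub>S\<^esub> w)) \<in> E \<rightarrow> carrier (local_ring S P)"
          using E(2) w h_D[OF t] r S.D_mult[OF h_D[OF t] w] by (intro Pi_I S.frac_closed) auto
      qed simp
      also have "\<dots> = S.frac (\<Oplus>\<^bsub>S\<^esub>e\<in>E. h (r e) \<otimes>\<^bsub>S\<^esub> e) (h t \<otimes>\<^bsub>S\<^esub> w)"
        using E r S.D_mult[OF h_D[OF t] w] by (intro S.finsum_frac) auto
      finally show ?thesis .
    qed
    have "lin_independent (local_ring R Q) (restrict_scalars (local_ring S P) (local_hom S h P)) (q ` E)"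
      unfolding lin_independent_def restrict_scalars_simps
    proof (intro conjI ballI impI)
      show "finite (q ` E)" "q ` E \<subseteq> carrier (local_ring S P)" using E(1) q_closed by auto
      fix c x
      assume c: "c \<in> q ` E \<rightarrow> carrier (local_ring R Q)" and x: "x \<in> q ` E"
        and zero: "(\<Oplus>\<^bsub>local_ring S P\<^esub>x\<in>q ` E. local_hom S h P (c x) \<otimes>\<^bsub>local_ring S P\<^esub> x) = \<zero>\<^bsub>local_ring S P\<^esub>"
      have "finite (c ` q ` E)" "c ` q ` E \<subseteq> carrier (local_ring R Q)" using E(1) c by auto
      then obtain t where t: "t \<in> Q.D" and ex: "\<And>y. y \<in> c ` q ` E \<Longrightarrow> \<exists>a\<in>carrier R. y = Q.frac a t"
        using Q.common_denominator by blast
      have "\<exists>r. r \<in> carrier R \<and> c (q e) = Q.frac r t" if "e \<in> E" for e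
        using ex[of "c (q e)"] that by blast
      then obtain r where r: "\<And>e. e \<in> E \<Longrightarrow> r e \<in> carrier R" "\<And>e. e \<in> E \<Longrightarrow> c (q e) = Q.frac (r e) t"
        by metis
      have "S.frac (\<Oplus>\<^bsub>S\<^esub>e\<in>E. h (r e) \<otimes>\<^bsub>S\<^esub> e) (h t \<otimes>\<^bsub>S\<^esub> w) = \<zero>\<^bsub>local_ring S P\<^esub>"
        using zero sum[of c r t, OF r(2) r(1) t] by simp
      moreover have "(\<Oplus>\<^bsub>S\<^esub>e\<in>E. h (r e) \<otimes>\<^bsub>S\<^esub> e) \<in> carrier S" using E r(1) by (intro S.finsum_closed) auto
      ultimately have "(\<Oplus>\<^bsub>S\<^esub>e\<in>E. h (r e) \<otimes>\<^bsub>S\<^esub> e) = \<zero>\<^bsub>S\<^esub>"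
        using S.frac_eq_zero_iff S.D_mult[OF h_D[OF t] w] by blast
      then have "\<forall>e\<in>E. r e = \<zero>\<^bsub>R\<^esub>" using r(1) by (intro indep) auto
      moreover obtain e where "e \<in> E" "x = q e" using x by blast
      ultimately have "c x = Q.frac \<zero>\<^bsub>R\<^esub> t" using r(2) by simp
      then show "c x = \<zero>\<^bsub>local_ring R Q\<^esub>"
        using Q.frac_eq_zero_iff[of "\<zero>\<^bsub>R\<^esub>" t] t by simp
    qed
    moreover have "A \<subseteq> lin_span (local_ring R Q) (restrict_scalars (local_ring S P) (local_hom S h P)) (q ` E)"
    proof
      fix x assume x: "x \<in> A"
      obtain c where c: "c \<in> E \<rightarrow> carrier R" "num x = (\<Oplus>\<^bsub>S\<^esub>e\<in>E. h (c e) \<otimes>\<^bsub>S\<^esub> e)"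
        using span x unfolding lin_span_def restrict_scalars_simps by blast
      define c' where "c' y = Q.frac (c (the_inv_into E q y)) \<one>\<^bsub>R\<^esub>" for y
      have c': "c' (q e) = Q.frac (c e) \<one>\<^bsub>R\<^esub>" if "e \<in> E" for e
        unfolding c'_def using the_inv_into_f_f[OF inj_q that] by simp
      have "(\<Oplus>\<^bsub>local_ring S P\<^esub>y\<in>q ` E. local_hom S h P (c' y) \<otimes>\<^bsub>local_ring S P\<^esub> y) =
          S.frac (num x) (h \<one>\<^bsub>R\<^esub> \<otimes>\<^bsub>S\<^esub> w)"
        unfolding c(2) using c' c(1) Q.D_one by (intro sum) auto
      also have "\<dots> = x" using w num(2)[OF x] by simp
      finally have "x = (\<Oplus>\<^bsub>local_ring S P\<^esub>y\<in>q ` E. local_hom S h P (c' y) \<otimes>\<^bsub>local_ring S P\<^esub> y)" ..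
      moreover have "c' \<in> q ` E \<rightarrow> carrier (local_ring R Q)"
        using c' c(1) Q.D_one by (auto intro!: Q.frac_closed)
      ultimately show "x \<in> lin_span (local_ring R Q) (restrict_scalars (local_ring S P) (local_hom S h P)) (q ` E)"
        unfolding lin_span_def restrict_scalars_simps by blast
    qed
    ultimately show "\<exists>E. lin_independent (local_ring R Q) (restrict_scalars (local_ring S P) (local_hom S h P)) E \<and>
        A \<subseteq> lin_span (local_ring R Q) (restrict_scalars (local_ring S P) (local_hom S h P)) E" by blast
  qed
  then show ?thesis by (simp add: Q_def)
qed

lemma flat_spec_map_of_locally_free:
  assumes "domain R" "domain S" "h \<in> ring_hom R S" "inj_on h (carrier R)"
    and "locally_free R (restrict_scalars S h)"
  shows "flat_spec_map TYPE('n) TYPE('k) R S h"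
  unfolding flat_spec_map_def flat_ring_hom_def
proof (intro ballI conjI)
  fix P assume "P \<in> Spec S"
  then have P: "primeideal P S" by (simp add: Spec_def)
  have S: "local_domain P S" by (rule local_domain.intro) fact+
  show hom: "local_hom S h P \<in> ring_hom (local_ring R (spec_map R h P)) (local_ring S P)"
    by (rule local_hom_ring_hom[OF S assms(1,3)])
  show "flat_module TYPE('n) TYPE('k) (local_ring R (spec_map R h P))
     (restrict_scalars (local_ring S P) (local_hom S h P))"
    by (intro flat_module_of_locally_free module_restrict_scalars hom locally_free_local_ring assms P
        local_domain.cring_local_ring[OF S] local_domain.cring_local_ring[OF local_domain_spec_map[OF S assms(1,3)]])
qed

subsection \<open>A criterion for reduced fibres\<close>

text \<open>Reducedness of the fibre at \<open>P\<close> says that the extended ideal of the local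
  ring is radical. That ideal consists of the fractions with numerator in \<open>J\<close>, so the
  condition can be tested in \<open>S\<close>, where \<open>a\<close> need only lie in
  \<open>J\<close> after multiplication by an element outside \<open>P\<close>.\<close>

lemma reduced_fibres_spec_mapI:
  assumes "domain R" "domain S" and h: "h \<in> ring_hom R S"
    and radical: "\<And>P a n. primeideal P S \<Longrightarrow> a \<in> carrier S \<Longrightarrow>
      a [^]\<^bsub>S\<^esub> (n::nat) \<in> Idl\<^bsub>S\<^esub> (h ` spec_map R h P) \<Longrightarrow> \<exists>w\<in>carrier S - P. w \<otimes>\<^bsub>S\<^esub> a \<in> Idl\<^bsub>S\<^esub> (h ` spec_map R h P)"
  shows "reduced_fibres_spec_map R S h"
  unfolding reduced_fibres_spec_map_def
proof (intro ballI impI)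
  fix y P assume "P \<in> Spec S"
  then have P: "primeideal P S" by (simp add: Spec_def)
  define Q where "Q = spec_map R h P"
  have S: "local_domain P S" by (rule local_domain.intro) fact+
  interpret S: local_domain P S by (rule S)
  interpret Q: local_domain Q R unfolding Q_def by (rule local_domain_spec_map) fact+
  interpret h: ring_hom_cring R S h
    by (rule ring_hom_cring.intro[OF Q.is_cring S.is_cring ring_hom_cring_axioms.intro[OF h]])
  interpret L: cring "local_ring S P" by (rule S.cring_local_ring)
  have h_D: "h t \<in> S.D" if "t \<in> Q.D" for t
    using that h.hom_closed[of t] unfolding Q_def spec_map_def by simp
  have Q_carrier: "Q \<subseteq> carrier R" unfolding Q_def spec_map_def by auto
  have lh: "local_hom S h P (Q.frac a s) = S.frac (h a) (h s)" if "a \<in> carrier R" "s \<in> Q.D" for a s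
    using local_hom_frac[OF S assms(1) h] that by (simp add: Q_def)
  define J where "J = Idl\<^bsub>S\<^esub> (h ` Q)"
  define I where "I = Idl\<^bsub>local_ring S P\<^esub> (local_hom S h P ` local_max_ideal R Q)"
  have hQ: "h ` Q \<subseteq> carrier S" using Q_carrier h.hom_closed by auto
  interpret J: ideal J S unfolding J_def by (rule S.genideal_ideal[OF hQ])
  have gens: "local_hom S h P ` local_max_ideal R Q = {S.frac (h a) (h s) | a s. a \<in> Q \<and> s \<in> Q.D}"
    unfolding local_max_ideal_def using lh Q_carrier by (auto simp: image_iff) (metis lh Q_carrier subsetD Diff_iff)+
  have gens_closed: "local_hom S h P ` local_max_ideal R Q \<subseteq> carrier (local_ring S P)"
    unfolding gens using Q_carrier h_D by (auto intro!: S.frac_closed)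
  interpret I: ideal I "local_ring S P" unfolding I_def by (rule L.genideal_ideal[OF gens_closed])
  define K where "K = {S.frac z w | z w. z \<in> J \<and> w \<in> S.D}"
  have K: "ideal K (local_ring S P)"
  proof (rule idealI)
    show "ring (local_ring S P)" by (rule L.ring_axioms)
    show "subgroup K (add_monoid (local_ring S P))"
    proof (rule group.subgroupI[OF L.a_group])
      show "K \<subseteq> carrier (add_monoid (local_ring S P))"
        unfolding K_def using J.Icarr by (auto intro!: S.frac_closed)
      show "K \<noteq> {}" unfolding K_def using S.D_one additive_subgroup.zero_closed[OF J.is_additive_subgroup] by blast
    next
      fix x assume "x \<in> K"
      then obtain z w where x: "x = S.frac z w" "z \<in> J" "w \<in> S.D" unfolding K_def by blast
      have mz: "\<ominus>\<^bsub>S\<^esub> z \<in> J" using additive_subgroup.a_inv_closed[OF J.is_additive_subgroup x(2)] .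
      have "S.frac (\<ominus>\<^bsub>S\<^esub> z) w \<oplus>\<^bsub>local_ring S P\<^esub> x = \<zero>\<^bsub>local_ring S P\<^esub>"
        using x J.Icarr[OF x(2)] by (simp add: S.add_frac_same S.l_neg S.frac_eq_zero_iff)
      then have "\<ominus>\<^bsub>local_ring S P\<^esub> x = S.frac (\<ominus>\<^bsub>S\<^esub> z) w"
        using x J.Icarr[OF x(2)] by (intro L.minus_equality) (auto intro!: S.frac_closed)
      then have "\<ominus>\<^bsub>local_ring S P\<^esub> x \<in> K" unfolding K_def using mz x(3) by blast
      then show "inv\<^bsub>add_monoid (local_ring S P)\<^esub> x \<in> K" by (simp add: a_inv_def)
    next
      fix x y assume "x \<in> K" "y \<in> K"
      then obtain z w z' w' where x: "x = S.frac z w" "z \<in> J" "w \<in> S.D"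
        and y: "y = S.frac z' w'" "z' \<in> J" "w' \<in> S.D" unfolding K_def by blast
      have "z \<otimes>\<^bsub>S\<^esub> w' \<oplus>\<^bsub>S\<^esub> z' \<otimes>\<^bsub>S\<^esub> w \<in> J"
        using x y by (intro additive_subgroup.a_closed[OF J.is_additive_subgroup] J.I_r_closed) auto
      moreover have "x \<oplus>\<^bsub>local_ring S P\<^esub> y = S.frac (z \<otimes>\<^bsub>S\<^esub> w' \<oplus>\<^bsub>S\<^esub> z' \<otimes>\<^bsub>S\<^esub> w) (w \<otimes>\<^bsub>S\<^esub> w')"
        unfolding x(1) y(1) using x y J.Icarr by (intro S.add_frac) auto
      ultimately show "x \<otimes>\<^bsub>add_monoid (local_ring S P)\<^esub> y \<in> K"
        unfolding K_def using S.D_mult[OF x(3) y(3)] by auto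
    qed
    have left: "x \<otimes>\<^bsub>local_ring S P\<^esub> k \<in> K" if k: "k \<in> K" and x: "x \<in> carrier (local_ring S P)" for k x
    proof -
      obtain z w where z: "k = S.frac z w" "z \<in> J" "w \<in> S.D" using k unfolding K_def by blast
      obtain a s where a: "x = S.frac a s" "a \<in> carrier S" "s \<in> S.D" using x by (rule S.local_ringE)
      have "x \<otimes>\<^bsub>local_ring S P\<^esub> k = S.frac (a \<otimes>\<^bsub>S\<^esub> z) (s \<otimes>\<^bsub>S\<^esub> w)"
        unfolding a(1) z(1) using a z J.Icarr by (intro S.mult_frac) auto
      then show ?thesis unfolding K_def using J.I_l_closed[OF z(2) a(2)] S.D_mult[OF a(3) z(3)] by blast
    qed
    fix k x assume k: "k \<in> K" and x: "x \<in> carrier (local_ring S P)"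
    show "x \<otimes>\<^bsub>local_ring S P\<^esub> k \<in> K" by (rule left[OF k x])
    have "k \<in> carrier (local_ring S P)" using k J.Icarr unfolding K_def by (auto intro!: S.frac_closed)
    then show "k \<otimes>\<^bsub>local_ring S P\<^esub> x \<in> K" using left[OF k x] L.m_comm[OF x] by simp
  qed
  have I_K: "I \<subseteq> K"
    unfolding I_def
  proof (rule L.genideal_minimal[OF K])
    show "local_hom S h P ` local_max_ideal R Q \<subseteq> K"
      unfolding gens K_def J_def using S.genideal_self[OF hQ] h_D by blast
  qed
  \<comment> \<open>The elements of \<open>S\<close> whose fractions over 1 lie in \<open>I\<close>
    form an ideal that contains the generators of \<open>J\<close>.\<close>
  have J_I: "S.frac z \<one>\<^bsub>S\<^esub> \<in> I" if "z \<in> J" for z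
  proof -
    have fr: "S.frac a \<one>\<^bsub>S\<^esub> \<in> carrier (local_ring S P)" if "a \<in> carrier S" for a
      using that S.D_one by (intro S.frac_closed)
    have "ideal {z \<in> carrier S. S.frac z \<one>\<^bsub>S\<^esub> \<in> I} S"
    proof (rule idealI)
      show "ring S" by (rule S.ring_axioms)
      show "subgroup {z \<in> carrier S. S.frac z \<one>\<^bsub>S\<^esub> \<in> I} (add_monoid S)"
      proof (rule group.subgroupI[OF S.a_group])
        show "{z \<in> carrier S. S.frac z \<one>\<^bsub>S\<^esub> \<in> I} \<noteq> {}"
          using additive_subgroup.zero_closed[OF I.is_additive_subgroup] unfolding S.zero_local_ring by blast
      next
        fix a assume a: "a \<in> {z \<in> carrier S. S.frac z \<one>\<^bsub>S\<^esub> \<in> I}"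
        have "S.frac (\<ominus>\<^bsub>S\<^esub> a) \<one>\<^bsub>S\<^esub> \<oplus>\<^bsub>local_ring S P\<^esub> S.frac a \<one>\<^bsub>S\<^esub> = \<zero>\<^bsub>local_ring S P\<^esub>"
          using a S.D_one by (simp add: S.add_frac_same S.l_neg S.zero_local_ring)
        then have "\<ominus>\<^bsub>local_ring S P\<^esub> S.frac a \<one>\<^bsub>S\<^esub> = S.frac (\<ominus>\<^bsub>S\<^esub> a) \<one>\<^bsub>S\<^esub>"
          using a fr by (intro L.minus_equality) auto
        then show "inv\<^bsub>add_monoid S\<^esub> a \<in> {z \<in> carrier S. S.frac z \<one>\<^bsub>S\<^esub> \<in> I}"
          using a additive_subgroup.a_inv_closed[OF I.is_additive_subgroup, of "S.frac a \<one>\<^bsub>S\<^esub>"]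
          by (simp flip: a_inv_def)
      next
        fix a b assume "a \<in> {z \<in> carrier S. S.frac z \<one>\<^bsub>S\<^esub> \<in> I}" "b \<in> {z \<in> carrier S. S.frac z \<one>\<^bsub>S\<^esub> \<in> I}"
        then show "a \<otimes>\<^bsub>add_monoid S\<^esub> b \<in> {z \<in> carrier S. S.frac z \<one>\<^bsub>S\<^esub> \<in> I}"
          using S.D_one additive_subgroup.a_closed[OF I.is_additive_subgroup, of "S.frac a \<one>\<^bsub>S\<^esub>" "S.frac b \<one>\<^bsub>S\<^esub>"]
          by (simp add: S.add_frac_same)
      qed auto
      fix a x assume a: "a \<in> {z \<in> carrier S. S.frac z \<one>\<^bsub>S\<^esub> \<in> I}" and x: "x \<in> carrier S"
      have "S.frac x \<one>\<^bsub>S\<^esub> \<otimes>\<^bsub>local_ring S P\<^esub> S.frac a \<one>\<^bsub>S\<^esub> = S.frac (x \<otimes>\<^bsub>S\<^esub> a) \<one>\<^bsub>S\<^esub>"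
        using a x S.D_one by (subst S.mult_frac) auto
      then have "S.frac (x \<otimes>\<^bsub>S\<^esub> a) \<one>\<^bsub>S\<^esub> \<in> I"
        using a I.I_l_closed[of "S.frac a \<one>\<^bsub>S\<^esub>" "S.frac x \<one>\<^bsub>S\<^esub>"] fr[OF x] by simp
      then show "x \<otimes>\<^bsub>S\<^esub> a \<in> {z \<in> carrier S. S.frac z \<one>\<^bsub>S\<^esub> \<in> I}" "a \<otimes>\<^bsub>S\<^esub> x \<in> {z \<in> carrier S. S.frac z \<one>\<^bsub>S\<^esub> \<in> I}"
        using a x by (simp_all add: S.m_comm)
    qed
    moreover have "h ` Q \<subseteq> {z \<in> carrier S. S.frac z \<one>\<^bsub>S\<^esub> \<in> I}"
    proof clarify
      fix a assume a: "a \<in> Q"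
      have "S.frac (h a) (h \<one>\<^bsub>R\<^esub>) \<in> local_hom S h P ` local_max_ideal R Q"
        unfolding gens using a Q.D_one by blast
      then have "S.frac (h a) (h \<one>\<^bsub>R\<^esub>) \<in> I"
        using L.genideal_self[OF gens_closed] unfolding I_def by blast
      then show "h a \<in> carrier S \<and> S.frac (h a) \<one>\<^bsub>S\<^esub> \<in> I" using a Q_carrier by auto
    qed
    ultimately have "J \<subseteq> {z \<in> carrier S. S.frac z \<one>\<^bsub>S\<^esub> \<in> I}" unfolding J_def by (rule S.genideal_minimal)
    with that show ?thesis by blast
  qed
  have K_I: "K \<subseteq> I"
  proof
    fix x assume "x \<in> K"
    then obtain z w where x: "x = S.frac z w" "z \<in> J" "w \<in> S.D" unfolding K_def by blast
    have "S.frac \<one>\<^bsub>S\<^esub> w \<otimes>\<^bsub>local_ring S P\<^esub> S.frac z \<one>\<^bsub>S\<^esub> = x"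
      unfolding x(1) using x S.D_one J.Icarr by (subst S.mult_frac) auto
    moreover have "S.frac \<one>\<^bsub>S\<^esub> w \<in> carrier (local_ring S P)" using x(3) by (intro S.frac_closed) auto
    ultimately show "x \<in> I" using I.I_l_closed[OF J_I[OF x(2)]] by metis
  qed
  have reduced: "x \<in> I" if x: "x \<in> carrier (local_ring S P)" and pow: "x [^]\<^bsub>local_ring S P\<^esub> (n::nat) \<in> I" for x n
  proof -
    obtain a w where a: "x = S.frac a w" "a \<in> carrier S" "w \<in> S.D" using x by (rule S.local_ringE)
    have wn: "x [^]\<^bsub>local_ring S P\<^esub> n = S.frac (a [^]\<^bsub>S\<^esub> n) (w [^]\<^bsub>S\<^esub> n)" "w [^]\<^bsub>S\<^esub> n \<in> S.D"
      using S.pow_frac[OF a(2,3), of n] unfolding a(1) by blast+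
    obtain z t where z: "S.frac (a [^]\<^bsub>S\<^esub> n) (w [^]\<^bsub>S\<^esub> n) = S.frac z t" "z \<in> J" "t \<in> S.D"
      using pow I_K unfolding wn K_def by blast
    have tc: "t \<in> carrier S" "w \<in> carrier S" using z(3) a(3) by auto
    have "(a [^]\<^bsub>S\<^esub> n) \<otimes>\<^bsub>S\<^esub> t = z \<otimes>\<^bsub>S\<^esub> w [^]\<^bsub>S\<^esub> n"
      using z(1) S.frac_eq_iff[OF S.nat_pow_closed[OF a(2)] wn(2) J.Icarr[OF z(2)] z(3)] by blast
    then have "(a [^]\<^bsub>S\<^esub> n) \<otimes>\<^bsub>S\<^esub> t \<in> J" using J.I_r_closed[OF z(2)] tc by simp
    \<comment> \<open>What is known to lie in \<open>J\<close> is \<open>a^n t\<close>. The exponent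
      is raised to \<open>n + 1\<close> so that the power of \<open>t a\<close> contains a factor
      \<open>t\<close> also for \<open>n = 0\<close>.\<close>
    then have "(t [^]\<^bsub>S\<^esub> n \<otimes>\<^bsub>S\<^esub> a) \<otimes>\<^bsub>S\<^esub> ((a [^]\<^bsub>S\<^esub> n) \<otimes>\<^bsub>S\<^esub> t) \<in> J" using J.I_l_closed a(2) tc by simp
    moreover have "(t \<otimes>\<^bsub>S\<^esub> a) [^]\<^bsub>S\<^esub> Suc n = (t [^]\<^bsub>S\<^esub> n \<otimes>\<^bsub>S\<^esub> a) \<otimes>\<^bsub>S\<^esub> ((a [^]\<^bsub>S\<^esub> n) \<otimes>\<^bsub>S\<^esub> t)"
      using a(2) tc by (simp add: S.nat_pow_distrib S.m_ac)
    ultimately have "(t \<otimes>\<^bsub>S\<^esub> a) [^]\<^bsub>S\<^esub> Suc n \<in> J" by simp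
    then obtain v where v: "v \<in> S.D" "v \<otimes>\<^bsub>S\<^esub> (t \<otimes>\<^bsub>S\<^esub> a) \<in> J"
      using radical[OF P, of "t \<otimes>\<^bsub>S\<^esub> a" "Suc n"] a(2) tc unfolding J_def Q_def by auto
    have "x = S.frac ((v \<otimes>\<^bsub>S\<^esub> t) \<otimes>\<^bsub>S\<^esub> a) ((v \<otimes>\<^bsub>S\<^esub> t) \<otimes>\<^bsub>S\<^esub> w)"
      unfolding a(1) using a S.D_mult[OF v(1) z(3)] by (intro S.frac_cancel[symmetric])
    moreover have "(v \<otimes>\<^bsub>S\<^esub> t) \<otimes>\<^bsub>S\<^esub> a = v \<otimes>\<^bsub>S\<^esub> (t \<otimes>\<^bsub>S\<^esub> a)" using v(1) a(2) tc by (simp add: S.m_assoc)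
    ultimately have "x \<in> K"
      unfolding K_def using v(2) S.D_mult[OF S.D_mult[OF v(1) z(3)] a(3)] by auto
    then show "x \<in> I" using K_I by blast
  qed
  have "reduced_ring (local_ring S P Quot I)"
    unfolding reduced_ring_def
  proof (intro ballI allI impI)
    fix X and n :: nat
    assume X: "X \<in> carrier (local_ring S P Quot I)" and pow: "X [^]\<^bsub>local_ring S P Quot I\<^esub> n = \<zero>\<^bsub>local_ring S P Quot I\<^esub>"
    obtain x where x: "X = I +>\<^bsub>local_ring S P\<^esub> x" "x \<in> carrier (local_ring S P)"
      using X unfolding FactRing_def A_RCOSETS_def' by auto
    have zero: "\<zero>\<^bsub>local_ring S P Quot I\<^esub> = I" by (simp add: FactRing_def)
    have hom: "(+>\<^bsub>local_ring S P\<^esub>) I \<in> ring_hom (local_ring S P) (local_ring S P Quot I)"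
      by (rule I.rcos_ring_hom)
    have "I +>\<^bsub>local_ring S P\<^esub> (x [^]\<^bsub>local_ring S P\<^esub> k) = (I +>\<^bsub>local_ring S P\<^esub> x) [^]\<^bsub>local_ring S P Quot I\<^esub> k" for k :: nat
      by (induction k) (simp_all add: nat_pow_def ring_hom_one[OF hom] ring_hom_mult[OF hom] x(2) L.nat_pow_closed[unfolded nat_pow_def])
    from this[of n] have "I +>\<^bsub>local_ring S P\<^esub> (x [^]\<^bsub>local_ring S P\<^esub> n) = I"
      using pow unfolding x(1) zero by simp
    then have "x [^]\<^bsub>local_ring S P\<^esub> n \<in> I" using I.rcos_const_imp_mem x(2) by simp
    then have "x \<in> I" by (rule reduced[OF x(2)])
    then show "X = \<zero>\<^bsub>local_ring S P Quot I\<^esub>" unfolding x(1) zero by (rule I.a_rcos_const)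
  qed
  then show "reduced_ring (fibre_local_ring R S h P)"
    unfolding fibre_local_ring_def I_def Q_def .
qed

subsection \<open>Semigroup algebras\<close>

lemma keys_uminus_complex: "Poly_Mapping.keys (- p) = Poly_Mapping.keys (p :: 'u \<Rightarrow>\<^sub>0 complex)"
  by (auto simp: in_keys_iff)

lemma poly_mapping_eq_sum_single:
  fixes p :: "'u \<Rightarrow>\<^sub>0 complex"
  assumes "finite A" "Poly_Mapping.keys p \<subseteq> A"
  shows "p = (\<Sum>u\<in>A. Poly_Mapping.single u (Poly_Mapping.lookup p u))"
proof (rule poly_mapping_eqI)
  fix k
  have "Poly_Mapping.lookup (\<Sum>u\<in>A. Poly_Mapping.single u (Poly_Mapping.lookup p u)) k =
      (\<Sum>u\<in>A. if u = k then Poly_Mapping.lookup p u else 0)"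
    unfolding lookup_sum by (intro sum.cong refl) (simp add: lookup_single when_def)
  also have "\<dots> = Poly_Mapping.lookup p k"
    using assms by (auto simp: in_keys_iff)
  finally show "Poly_Mapping.lookup p k =
      Poly_Mapping.lookup (\<Sum>u\<in>A. Poly_Mapping.single u (Poly_Mapping.lookup p u)) k" ..
qed

text \<open>For \<open>C\<close> a coset of the characters of the base this is a homogeneous
  component of \<open>p\<close>.\<close>

definition part :: "'u set \<Rightarrow> ('u \<Rightarrow>\<^sub>0 complex) \<Rightarrow> ('u \<Rightarrow>\<^sub>0 complex)"
  where "part C p = (\<Sum>u\<in>Poly_Mapping.keys p \<inter> C. Poly_Mapping.single u (Poly_Mapping.lookup p u))"

lemma lookup_part: "Poly_Mapping.lookup (part C p) k = (if k \<in> C then Poly_Mapping.lookup p k else 0)"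
proof -
  have "Poly_Mapping.lookup (part C p) k =
      (\<Sum>u\<in>Poly_Mapping.keys p \<inter> C. if u = k then Poly_Mapping.lookup p u else 0)"
    unfolding part_def lookup_sum by (intro sum.cong refl) (simp add: lookup_single when_def)
  then show ?thesis by (simp add: in_keys_iff)
qed

lemma keys_part: "Poly_Mapping.keys (part C p) = Poly_Mapping.keys p \<inter> C"
  by (auto simp: in_keys_iff lookup_part split: if_splits)

lemma part_add: "part C (p + q) = part C p + part C q"
  by (intro poly_mapping_eqI) (simp add: lookup_part lookup_add)

lemma part_sum: "part C (sum f A) = (\<Sum>a\<in>A. part C (f a))"
  by (intro poly_mapping_eqI) (simp add: lookup_part lookup_sum)

lemma part_zero: "part C 0 = 0"
  by (intro poly_mapping_eqI) (simp add: lookup_part)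

lemma part_eq: "Poly_Mapping.keys p \<subseteq> C \<Longrightarrow> part C p = p"
  by (intro poly_mapping_eqI) (auto simp: lookup_part in_keys_iff)

lemma part_eq_zero: "Poly_Mapping.keys p \<inter> C = {} \<Longrightarrow> part C p = 0"
  by (intro poly_mapping_eqI) (auto simp: lookup_part in_keys_iff)

text \<open>Translation by the exponents of \<open>p\<close> never moves an exponent of
  \<open>q\<close> into or out of \<open>C\<close>, so multiplication by \<open>p\<close> respects
  the splitting of \<open>q\<close> along \<open>C\<close>.\<close>

lemma part_mult:
  assumes "\<And>u v. u \<in> Poly_Mapping.keys p \<Longrightarrow> v \<in> Poly_Mapping.keys q \<Longrightarrow> u + v \<in> C \<longleftrightarrow> v \<in> C"
  shows "part C (p * q) = p * part C q"
proof -
  have "q = part C q + part (- C) q"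
    by (intro poly_mapping_eqI) (simp add: lookup_part lookup_add)
  then have "p * q = p * part C q + p * part (- C) q" by (metis distrib_left)
  moreover have "part C (p * part C q) = p * part C q"
    using assms keys_mult[of p "part C q"] by (intro part_eq) (auto simp: keys_part)
  moreover have "part C (p * part (- C) q) = 0"
    using assms keys_mult[of p "part (- C) q"] by (intro part_eq_zero) (auto simp: keys_part)
  ultimately show ?thesis by (simp add: part_add)
qed

text \<open>In the algebra over the whole additive group every monomial is a unit, even when its
  inverse lies outside the chart.\<close>

lemma single_mult_cancel:
  fixes p q :: "'u::ab_group_add \<Rightarrow>\<^sub>0 complex"
  assumes "p * Poly_Mapping.single u 1 = q * Poly_Mapping.single u 1"
  shows "p = q"
proof -
  have "p * Poly_Mapping.single u 1 * Poly_Mapping.single (- u) 1 =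
      q * Poly_Mapping.single u 1 * Poly_Mapping.single (- u) 1" using assms by simp
  then show ?thesis by (simp add: mult.assoc mult_single)
qed

text \<open>A pair of exponents whose sum has maximal Euclidean norm is determined by its sum, by the
  parallelogram law; so a product of nonzero elements has a coefficient that is a product of two
  nonzero coefficients.\<close>
lemma linear_keys_no_zero_divisors:
  fixes p q :: "('v::euclidean_space \<Rightarrow> real) \<Rightarrow>\<^sub>0 complex"
  assumes lin: "\<And>u. u \<in> Poly_Mapping.keys p \<union> Poly_Mapping.keys q \<Longrightarrow> linear u"
    and pq: "p \<noteq> 0" "q \<noteq> 0"
  shows "p * q \<noteq> 0"
proof -
  define N where "N u = (\<Sum>x\<in>Basis. (u x)\<^sup>2)" for u :: "'v \<Rightarrow> real"
  have fin: "finite (Poly_Mapping.keys p \<times> Poly_Mapping.keys q)" by simp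
  have ne: "Poly_Mapping.keys p \<times> Poly_Mapping.keys q \<noteq> {}" using pq by simp
  from ex_is_arg_min_if_finite[OF fin ne, of "\<lambda>(a, b). - N (a + b)"]
  obtain a b where ab: "a \<in> Poly_Mapping.keys p" "b \<in> Poly_Mapping.keys q"
    and max: "\<And>a' b'. a' \<in> Poly_Mapping.keys p \<Longrightarrow> b' \<in> Poly_Mapping.keys q \<Longrightarrow> N (a' + b') \<le> N (a + b)"
    unfolding is_arg_min_linorder by auto
  have unique: "a' = a" if "a' \<in> Poly_Mapping.keys p" "b' \<in> Poly_Mapping.keys q" "a' + b' = a + b" for a' b'
  proof -
    define d where "d = a' - a"
    have b': "b' x = b x - d x" for x
      using fun_cong[OF that(3), of x] by (simp add: d_def)
    have "N (a' + b) + N (a + b') = 2 * N (a + b) + 2 * N d"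
      unfolding N_def sum_distrib_left sum.distrib[symmetric]
      by (intro sum.cong refl) (simp add: b' d_def power2_eq_square algebra_simps)
    moreover have "N (a' + b) \<le> N (a + b)" "N (a + b') \<le> N (a + b)" using max that ab by blast+
    moreover have "0 \<le> N d" unfolding N_def by (intro sum_nonneg) simp
    ultimately have "N d = 0" by linarith
    then have "d x = 0" if "x \<in> Basis" for x
      using that unfolding N_def by (simp add: sum_nonneg_eq_0_iff)
    moreover have "linear a'" "linear a" using lin that(1) ab(1) by auto
    ultimately show "a' = a"
      using linear_eq_stdbasis[of a' a] by (simp add: d_def)
  qed
  define p0 p' where "p0 = Poly_Mapping.single a (Poly_Mapping.lookup p a)" and "p' = part (- {a}) p"
  define q0 q' where "q0 = Poly_Mapping.single b (Poly_Mapping.lookup q b)" and "q' = part (- {b}) q"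
  have p: "p = p0 + p'"
    unfolding p'_def p0_def by (intro poly_mapping_eqI) (simp add: lookup_add lookup_part lookup_single when_def)
  have q: "q = q0 + q'"
    unfolding q'_def q0_def by (intro poly_mapping_eqI) (simp add: lookup_add lookup_part lookup_single when_def)
  have "a + b \<notin> Poly_Mapping.keys (p' * q)"
    using keys_mult[of p' q] unique unfolding p'_def keys_part by fastforce
  moreover have "a + b \<notin> Poly_Mapping.keys (p0 * q')"
    using keys_mult[of p0 q'] unfolding q'_def p0_def keys_part
    by (auto split: if_splits)
  moreover have "p * q = Poly_Mapping.single (a + b) (Poly_Mapping.lookup p a * Poly_Mapping.lookup q b) + p0 * q' + p' * q"
  proof -
    have "p * q = p0 * q + p' * q" unfolding distrib_right[symmetric] p[symmetric] ..
    also have "p0 * q = p0 * q0 + p0 * q'" unfolding distrib_left[symmetric] q[symmetric] ..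
    finally show ?thesis unfolding p0_def q0_def mult_single .
  qed
  ultimately have "Poly_Mapping.lookup (p * q) (a + b) = Poly_Mapping.lookup p a * Poly_Mapping.lookup q b"
    by (simp add: lookup_add in_keys_iff)
  moreover have "\<dots> \<noteq> 0" using ab by (simp add: in_keys_iff)
  ultimately show ?thesis by auto
qed

subsection \<open>Affine charts\<close>

lemma dual_lattice_zero: "0 \<in> dual_lattice L"
  by (simp add: dual_lattice_def zero_fun_def linear_zero)

lemma dual_lattice_add: "u \<in> dual_lattice L \<Longrightarrow> v \<in> dual_lattice L \<Longrightarrow> u + v \<in> dual_lattice L"
  by (simp add: dual_lattice_def plus_fun_def linear_compose_add)

lemma dual_lattice_uminus: "u \<in> dual_lattice L \<Longrightarrow> - u \<in> dual_lattice L"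
  by (simp add: dual_lattice_def fun_Compl_def linear_compose_neg)

lemma dual_lattice_diff: "u \<in> dual_lattice L \<Longrightarrow> v \<in> dual_lattice L \<Longrightarrow> u - v \<in> dual_lattice L"
  unfolding diff_conv_add_uminus by (intro dual_lattice_add dual_lattice_uminus)

lemma dual_semigroup_zero: "0 \<in> dual_semigroup L \<sigma>"
  by (simp add: dual_semigroup_def dual_lattice_zero)

lemma dual_semigroup_add: "u \<in> dual_semigroup L \<sigma> \<Longrightarrow> v \<in> dual_semigroup L \<sigma> \<Longrightarrow> u + v \<in> dual_semigroup L \<sigma>"
  by (simp add: dual_semigroup_def dual_lattice_add)

lemma dual_semigroup_dual_lattice: "u \<in> dual_semigroup L \<sigma> \<Longrightarrow> u \<in> dual_lattice L"
  by (simp add: dual_semigroup_def)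

lemma toric_chart_simps [simp]:
  "p \<in> carrier (toric_chart L \<sigma>) \<longleftrightarrow> Poly_Mapping.keys p \<subseteq> dual_semigroup L \<sigma>"
  "p \<otimes>\<^bsub>toric_chart L \<sigma>\<^esub> q = p * q" "p \<oplus>\<^bsub>toric_chart L \<sigma>\<^esub> q = p + q"
  "\<one>\<^bsub>toric_chart L \<sigma>\<^esub> = 1" "\<zero>\<^bsub>toric_chart L \<sigma>\<^esub> = 0"
  by (simp_all add: toric_chart_def)

lemma toric_chart_add: "p \<in> carrier (toric_chart L \<sigma>) \<Longrightarrow> q \<in> carrier (toric_chart L \<sigma>) \<Longrightarrow> p + q \<in> carrier (toric_chart L \<sigma>)"
  using keys_add[of p q] by auto

lemma toric_chart_mult: "p \<in> carrier (toric_chart L \<sigma>) \<Longrightarrow> q \<in> carrier (toric_chart L \<sigma>) \<Longrightarrow> p * q \<in> carrier (toric_chart L \<sigma>)"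
  using keys_mult[of p q] dual_semigroup_add unfolding toric_chart_simps by blast

lemma toric_chart_uminus: "p \<in> carrier (toric_chart L \<sigma>) \<Longrightarrow> - p \<in> carrier (toric_chart L \<sigma>)"
  by (simp add: keys_uminus_complex)

lemma toric_chart_single: "u \<in> dual_semigroup L \<sigma> \<Longrightarrow> Poly_Mapping.single u c \<in> carrier (toric_chart L \<sigma>)"
  by simp

lemma toric_chart_sum: "(\<And>i. i \<in> I \<Longrightarrow> f i \<in> carrier (toric_chart L \<sigma>)) \<Longrightarrow> sum f I \<in> carrier (toric_chart L \<sigma>)"
proof (induction I rule: infinite_finite_induct)
  case (insert i I)
  then show ?case using toric_chart_add[of "f i" L \<sigma> "sum f I"] by simp
qed auto

lemma cring_toric_chart: "cring (toric_chart L \<sigma>)"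
proof (rule cringI)
  show "abelian_group (toric_chart L \<sigma>)"
  proof (rule abelian_groupI)
    fix p assume p: "p \<in> carrier (toric_chart L \<sigma>)"
    show "\<exists>q\<in>carrier (toric_chart L \<sigma>). q \<oplus>\<^bsub>toric_chart L \<sigma>\<^esub> p = \<zero>\<^bsub>toric_chart L \<sigma>\<^esub>"
      using toric_chart_uminus[OF p] by (intro bexI[of _ "- p"]) simp_all
  next
    fix p q assume "p \<in> carrier (toric_chart L \<sigma>)" "q \<in> carrier (toric_chart L \<sigma>)"
    then show "p \<oplus>\<^bsub>toric_chart L \<sigma>\<^esub> q \<in> carrier (toric_chart L \<sigma>)"
      unfolding toric_chart_simps(3) by (rule toric_chart_add)
  qed (simp_all add: algebra_simps)
  show "comm_monoid (toric_chart L \<sigma>)"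
  proof (rule comm_monoidI)
    fix p q assume "p \<in> carrier (toric_chart L \<sigma>)" "q \<in> carrier (toric_chart L \<sigma>)"
    then show "p \<otimes>\<^bsub>toric_chart L \<sigma>\<^esub> q \<in> carrier (toric_chart L \<sigma>)"
      unfolding toric_chart_simps(2) by (rule toric_chart_mult)
  qed (simp_all add: dual_semigroup_zero mult.assoc mult.commute)
qed (simp add: distrib_right)

lemma pow_toric_chart: "p [^]\<^bsub>toric_chart L \<sigma>\<^esub> (n::nat) = p ^ n"
  by (induction n) (simp_all add: mult.commute)

lemma finsum_toric_chart:
  assumes "f \<in> A \<rightarrow> carrier (toric_chart L \<sigma>)"
  shows "finsum (toric_chart L \<sigma>) f A = sum f A"
proof -
  interpret cring "toric_chart L \<sigma>" by (rule cring_toric_chart)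
  show ?thesis using assms
  proof (induction A rule: infinite_finite_induct)
    case (insert a A)
    then have "finsum (toric_chart L \<sigma>) f (insert a A) = f a \<oplus>\<^bsub>toric_chart L \<sigma>\<^esub> finsum (toric_chart L \<sigma>) f A"
      by (intro finsum_insert) (auto simp del: toric_chart_simps)
    then show ?case using insert by simp
  qed (simp_all add: finsum_infinite)
qed

lemma domain_toric_chart: "domain (toric_chart (L :: 'v::euclidean_space set) \<sigma>)"
proof -
  interpret cring "toric_chart L \<sigma>" by (rule cring_toric_chart)
  show ?thesis
  proof
    show "\<one>\<^bsub>toric_chart L \<sigma>\<^esub> \<noteq> \<zero>\<^bsub>toric_chart L \<sigma>\<^esub>" by simp
    fix p q assume "p \<otimes>\<^bsub>toric_chart L \<sigma>\<^esub> q = \<zero>\<^bsub>toric_chart L \<sigma>\<^esub>"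
      "p \<in> carrier (toric_chart L \<sigma>)" "q \<in> carrier (toric_chart L \<sigma>)"
    then show "p = \<zero>\<^bsub>toric_chart L \<sigma>\<^esub> \<or> q = \<zero>\<^bsub>toric_chart L \<sigma>\<^esub>"
      using linear_keys_no_zero_divisors[of p q] by (auto simp: dual_semigroup_def dual_lattice_def)
  qed
qed

lemma chart_pullback_eq:
  assumes "finite A" "Poly_Mapping.keys p \<subseteq> A"
  shows "chart_pullback \<phi> p = (\<Sum>u\<in>A. Poly_Mapping.single (u \<circ> \<phi>) (Poly_Mapping.lookup p u))"
  unfolding chart_pullback_def using assms
  by (intro sum.mono_neutral_left) (auto simp: in_keys_iff)

lemma chart_pullback_zero: "chart_pullback \<phi> 0 = 0"
  by (simp add: chart_pullback_def)

lemma chart_pullback_single: "chart_pullback \<phi> (Poly_Mapping.single u c) = Poly_Mapping.single (u \<circ> \<phi>) c"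
  by (subst chart_pullback_eq[of "{u}"]) auto

lemma chart_pullback_add: "chart_pullback \<phi> (p + q) = chart_pullback \<phi> p + chart_pullback \<phi> q"
proof -
  define A where "A = Poly_Mapping.keys p \<union> Poly_Mapping.keys q"
  have A: "finite A" "Poly_Mapping.keys p \<subseteq> A" "Poly_Mapping.keys q \<subseteq> A" "Poly_Mapping.keys (p + q) \<subseteq> A"
    using keys_add[of p q] by (auto simp: A_def)
  show ?thesis
    unfolding chart_pullback_eq[OF A(1,2)] chart_pullback_eq[OF A(1,3)] chart_pullback_eq[OF A(1,4)]
    by (simp add: lookup_add single_add sum.distrib)
qed

lemma chart_pullback_sum: "chart_pullback \<phi> (sum f A) = (\<Sum>a\<in>A. chart_pullback \<phi> (f a))"
  by (induction A rule: infinite_finite_induct) (simp_all add: chart_pullback_zero chart_pullback_add)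

lemma comp_add: "(u + v) \<circ> \<phi> = (u \<circ> \<phi>) + (v \<circ> \<phi>)"
  by (simp add: fun_eq_iff)

lemma chart_pullback_mult: "chart_pullback \<phi> (p * q) = chart_pullback \<phi> p * chart_pullback \<phi> q"
proof -
  have "p * q = (\<Sum>u\<in>Poly_Mapping.keys p. Poly_Mapping.single u (Poly_Mapping.lookup p u)) *
      (\<Sum>v\<in>Poly_Mapping.keys q. Poly_Mapping.single v (Poly_Mapping.lookup q v))"
    using poly_mapping_eq_sum_single[of "Poly_Mapping.keys p" p] poly_mapping_eq_sum_single[of "Poly_Mapping.keys q" q]
    by simp
  also have "chart_pullback \<phi> \<dots> = chart_pullback \<phi> p * chart_pullback \<phi> q"
    unfolding sum_product chart_pullback_sum mult_single chart_pullback_single comp_add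
    unfolding mult_single[symmetric] sum_product[symmetric] chart_pullback_def ..
  finally show ?thesis .
qed

lemma chart_pullback_one: "chart_pullback \<phi> 1 = 1"
proof -
  have "(0 :: 'b \<Rightarrow> real) \<circ> \<phi> = 0" by (simp add: fun_eq_iff)
  then show ?thesis using chart_pullback_single[of \<phi> 0 1] by simp
qed

lemma keys_chart_pullback: "Poly_Mapping.keys (chart_pullback \<phi> p) \<subseteq> (\<lambda>u. u \<circ> \<phi>) ` Poly_Mapping.keys p"
proof -
  have "Poly_Mapping.keys (chart_pullback \<phi> p) \<subseteq>
      (\<Union>u\<in>Poly_Mapping.keys p. Poly_Mapping.keys (Poly_Mapping.single (u \<circ> \<phi>) (Poly_Mapping.lookup p u)))"
    unfolding chart_pullback_def by (rule keys_sum)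
  then show ?thesis by (force split: if_splits)
qed

lemma lookup_chart_pullback:
  assumes "surj \<phi>"
  shows "Poly_Mapping.lookup (chart_pullback \<phi> p) (u \<circ> \<phi>) = Poly_Mapping.lookup p u"
proof -
  have inj: "v \<circ> \<phi> = u \<circ> \<phi> \<longleftrightarrow> v = u" for v
    using assms by (metis comp_surj surj_fun_eq fun.map_comp ext comp_eq_dest surjD)
  have "Poly_Mapping.lookup (chart_pullback \<phi> p) (u \<circ> \<phi>) =
      (\<Sum>v\<in>Poly_Mapping.keys p. if v = u then Poly_Mapping.lookup p v else 0)"
    unfolding chart_pullback_def lookup_sum by (intro sum.cong refl) (simp add: lookup_single when_def inj)
  then show ?thesis by (simp add: in_keys_iff)
qed

lemma inj_chart_pullback: "surj \<phi> \<Longrightarrow> inj (chart_pullback \<phi>)"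
  by (rule injI) (metis lookup_chart_pullback poly_mapping_eqI)

lemma dual_lattice_comp: "linear \<phi> \<Longrightarrow> \<phi> ` L \<subseteq> L' \<Longrightarrow> a \<in> dual_lattice L' \<Longrightarrow> a \<circ> \<phi> \<in> dual_lattice L"
  unfolding dual_lattice_def by (auto intro: linear_compose)

lemma dual_semigroup_comp:
  "linear \<phi> \<Longrightarrow> \<phi> ` L \<subseteq> L' \<Longrightarrow> \<phi> ` \<sigma> \<subseteq> \<sigma>' \<Longrightarrow> a \<in> dual_semigroup L' \<sigma>' \<Longrightarrow> a \<circ> \<phi> \<in> dual_semigroup L \<sigma>"
  using dual_lattice_comp[of \<phi> L L' a] unfolding dual_semigroup_def by auto

lemma chart_pullback_ring_hom:
  assumes "linear \<phi>" "\<phi> ` L \<subseteq> L'" "\<phi> ` \<sigma> \<subseteq> \<sigma>'"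
  shows "chart_pullback \<phi> \<in> ring_hom (toric_chart L' \<sigma>') (toric_chart L \<sigma>)"
proof (rule ring_hom_memI)
  fix p assume "p \<in> carrier (toric_chart L' \<sigma>')"
  then show "chart_pullback \<phi> p \<in> carrier (toric_chart L \<sigma>)"
    using keys_chart_pullback[of \<phi> p] dual_semigroup_comp[OF assms] by auto
qed (simp_all add: chart_pullback_mult chart_pullback_add chart_pullback_one)

lemma domain_of_injective_hom:
  assumes "cring R" "domain S" "h \<in> ring_hom R S" "inj_on h (carrier R)"
  shows "domain R"
proof -
  interpret S: domain S by fact
  interpret h: ring_hom_cring R S h
    by (rule ring_hom_cring.intro[OF assms(1) S.is_cring ring_hom_cring_axioms.intro[OF assms(3)]])
  have z: "a = \<zero>\<^bsub>R\<^esub>" if "a \<in> carrier R" "h a = \<zero>\<^bsub>S\<^esub>" for a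
    using inj_onD[OF assms(4), of a "\<zero>\<^bsub>R\<^esub>"] that by simp
  show ?thesis
  proof
    show "\<one>\<^bsub>R\<^esub> \<noteq> \<zero>\<^bsub>R\<^esub>" using h.hom_one h.hom_zero S.one_not_zero by metis
    fix a b assume ab: "a \<otimes>\<^bsub>R\<^esub> b = \<zero>\<^bsub>R\<^esub>" "a \<in> carrier R" "b \<in> carrier R"
    then have "h a \<otimes>\<^bsub>S\<^esub> h b = \<zero>\<^bsub>S\<^esub>" using h.hom_mult[of a b] h.hom_zero by simp
    then show "a = \<zero>\<^bsub>R\<^esub> \<or> b = \<zero>\<^bsub>R\<^esub>" using S.integral[of "h a" "h b"] ab z by auto
  qed
qed

subsection \<open>A criterion for toric morphisms\<close>

text \<open>The minimal exponents, one for each coset of the characters of the base, form bases of the chart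
  over the chart of the base. Multiples of \<open>e\<close> are included for the sake of reducedness.\<close>
definition minimal_exponent ::
  "'v::real_vector set \<Rightarrow> 'v set \<Rightarrow> 'w::real_vector set \<Rightarrow> ('v \<Rightarrow> 'w) \<Rightarrow> ('v \<Rightarrow> real) \<Rightarrow> bool"
  where "minimal_exponent L \<sigma> L' \<phi> e \<longleftrightarrow> e \<in> dual_semigroup L \<sigma> \<and>
    (\<forall>n::nat. \<forall>a\<in>dual_lattice L'.
      (\<lambda>v. real n * e v) - (a \<circ> \<phi>) \<in> dual_semigroup L \<sigma> \<longrightarrow> - (a \<circ> \<phi>) \<in> dual_semigroup L \<sigma>)"

lemma comp_uminus: "(- a) \<circ> \<phi> = - (a \<circ> \<phi> :: _ \<Rightarrow> real)"
  by (simp add: fun_eq_iff)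

lemma dual_lattice_factor:
  assumes \<phi>: "linear \<phi>" "surj \<phi>" and u: "u \<in> dual_lattice L" and ker: "\<forall>x. \<phi> x = 0 \<longrightarrow> u x = 0"
  shows "\<exists>a\<in>dual_lattice (\<phi> ` L). u = a \<circ> \<phi>"
proof -
  have lin: "linear u" using u by (simp add: dual_lattice_def)
  define a where "a = (\<lambda>y. u (inv_into UNIV \<phi> y))"
  have a: "a (\<phi> x) = u x" for x
  proof -
    have "u (inv_into UNIV \<phi> (\<phi> x) - x) = 0"
      by (rule ker[rule_format]) (simp add: linear_diff[OF \<phi>(1)] surj_f_inv_f[OF \<phi>(2)])
    then show ?thesis unfolding a_def linear_diff[OF lin] by linarith
  qed
  have ex: "\<exists>x. y = \<phi> x" for y using \<phi>(2) by blast
  have "linear a"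
  proof (rule linearI)
    fix y z and r :: real
    obtain x x' where "y = \<phi> x" "z = \<phi> x'" using ex by metis
    then show "a (y + z) = a y + a z" "a (r *\<^sub>R y) = r *\<^sub>R a y"
      using a linear_add[OF \<phi>(1), symmetric] linear_scale[OF \<phi>(1), symmetric] linear_add[OF lin] linear_scale[OF lin]
      by metis+
  qed
  then have "a \<in> dual_lattice (\<phi> ` L)" using u a unfolding dual_lattice_def by auto
  moreover have "u = a \<circ> \<phi>" by (simp add: fun_eq_iff a)
  ultimately show ?thesis by blast
qed

text \<open>\<open>decompose\<close> supplies generators over the base, and \<open>face\<close>
  handles a cone \<open>\<sigma>'\<close> larger than the image of \<open>\<sigma>\<close>: both
  \<open>h \<circ> \<phi>\<close> and its negative are exponents upstairs, so \<open>h\<close>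
  vanishes on that image and becomes a unit, and adding it makes \<open>a\<close> nonnegative on
  \<open>\<sigma>'\<close>.\<close>

locale toric_criterion =
  fixes L :: "'v::euclidean_space set" and \<sigma> and L' :: "'w::real_vector set" and \<sigma>' and \<phi>
  assumes linear: "linear \<phi>" and surj: "surj \<phi>" and L': "L' = \<phi> ` L" and \<sigma>': "\<phi> ` \<sigma> \<subseteq> \<sigma>'"
    and decompose: "\<And>u. u \<in> dual_semigroup L \<sigma> \<Longrightarrow>
      \<exists>e a. minimal_exponent L \<sigma> L' \<phi> e \<and> a \<in> dual_lattice L' \<and> u = e + (a \<circ> \<phi>)"
    and face: "\<And>a. a \<in> dual_lattice L' \<Longrightarrow> a \<circ> \<phi> \<in> dual_semigroup L \<sigma> \<Longrightarrow>
      \<exists>h\<in>dual_semigroup L' \<sigma>'. - (h \<circ> \<phi>) \<in> dual_semigroup L \<sigma> \<and> a + h \<in> dual_semigroup L' \<sigma>'"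
begin

abbreviation S where "S \<equiv> dual_semigroup L \<sigma>"
abbreviation S' where "S' \<equiv> dual_semigroup L' \<sigma>'"
abbreviation minimal where "minimal \<equiv> minimal_exponent L \<sigma> L' \<phi>"
abbreviation pull where "pull \<equiv> chart_pullback \<phi>"
abbreviation mon :: "('v \<Rightarrow> real) \<Rightarrow> ('v \<Rightarrow> real) \<Rightarrow>\<^sub>0 complex" where "mon u \<equiv> Poly_Mapping.single u 1"

lemma S'_comp: "a \<in> S' \<Longrightarrow> a \<circ> \<phi> \<in> S"
  using dual_semigroup_comp[OF linear _ \<sigma>'] L' by blast

text \<open>A linear form modulo forms pulled back along \<open>\<phi>\<close> amounts to its
  restriction to the kernel, hence to the tuple of its values on a finite spanning set.
  \<open>coset\<close> stores this tuple, so that cosets are compared by equality and have a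
  norm.\<close>

definition ker_basis :: "'v set"
  where "ker_basis = (SOME B. finite B \<and> B \<subseteq> {x. \<phi> x = 0} \<and> {x. \<phi> x = 0} \<subseteq> span B)"

lemma ker_basis: "finite ker_basis" "x \<in> ker_basis \<Longrightarrow> \<phi> x = 0" "{x. \<phi> x = 0} \<subseteq> span ker_basis"
proof -
  have "\<exists>B. finite B \<and> B \<subseteq> {x. \<phi> x = 0} \<and> {x. \<phi> x = 0} \<subseteq> span B"
    using maximal_independent_subset[of "{x. \<phi> x = 0}"] independent_imp_finite by metis
  from someI_ex[OF this] show "finite ker_basis" "x \<in> ker_basis \<Longrightarrow> \<phi> x = 0" "{x. \<phi> x = 0} \<subseteq> span ker_basis"
    unfolding ker_basis_def by auto
qed

definition coset :: "('v \<Rightarrow> real) \<Rightarrow> 'v \<Rightarrow> real"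
  where "coset u = (\<lambda>x. if x \<in> ker_basis then u x else 0)"

lemma coset_add_comp: "a \<in> dual_lattice L' \<Longrightarrow> coset ((a \<circ> \<phi>) + u) = coset u"
  by (auto simp: coset_def fun_eq_iff ker_basis(2) dual_lattice_def linear_0)

text \<open>The difference vanishes on the kernel, hence descends; it is integral below because
  \<open>L'\<close> is the image of \<open>L\<close>.\<close>

lemma coset_eqD:
  assumes u: "u \<in> dual_lattice L" "v \<in> dual_lattice L" "coset u = coset v"
  obtains a where "a \<in> dual_lattice L'" "u = v + (a \<circ> \<phi>)"
proof -
  have uv: "u - v \<in> dual_lattice L" using u by (intro dual_lattice_diff)
  have "(u - v) x = 0" if "\<phi> x = 0" for x
  proof (rule linear_eq_0_on_span[of "u - v"])
    show "linear (u - v)" using uv by (simp add: dual_lattice_def)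
    show "x \<in> span ker_basis" using ker_basis(3) that by blast
    show "(u - v) x = 0" if "x \<in> ker_basis" for x
      using fun_cong[OF u(3), of x] that by (simp add: coset_def)
  qed
  then obtain a where a: "a \<in> dual_lattice L'" "u - v = a \<circ> \<phi>"
    using dual_lattice_factor[OF linear surj uv] unfolding L' by blast
  have "u = v + (a \<circ> \<phi>)" unfolding a(2)[symmetric] by simp
  with a(1) show thesis by (rule that)
qed

text \<open>Sum the characters found for the single \<open>a i\<close>: the additional summands lie
  in \<open>S'\<close> and so keep \<open>a i + H\<close> in \<open>S'\<close>, and the sum is still
  invertible upstairs.\<close>

lemma finite_face:
  assumes "finite I" "\<And>i. i \<in> I \<Longrightarrow> a i \<in> dual_lattice L'" "\<And>i. i \<in> I \<Longrightarrow> a i \<circ> \<phi> \<in> S"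
  shows "\<exists>H\<in>S'. - (H \<circ> \<phi>) \<in> S \<and> (\<forall>i\<in>I. a i + H \<in> S')"
  using assms
proof (induction I)
  case empty
  have eq: "- (0 \<circ> \<phi>) = (0 :: 'v \<Rightarrow> real)" by (simp add: fun_eq_iff)
  have "- (0 \<circ> \<phi>) \<in> S" unfolding eq by (rule dual_semigroup_zero)
  then show ?case using dual_semigroup_zero by blast
next
  case (insert i I)
  have "\<exists>H\<in>S'. - (H \<circ> \<phi>) \<in> S \<and> (\<forall>i\<in>I. a i + H \<in> S')"
    using insert.prems by (intro insert.IH) blast+
  then obtain H where H: "H \<in> S'" "- (H \<circ> \<phi>) \<in> S" "\<And>j. j \<in> I \<Longrightarrow> a j + H \<in> S'" by blast
  obtain h where h: "h \<in> S'" "- (h \<circ> \<phi>) \<in> S" "a i + h \<in> S'"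
    using face[of "a i"] insert.prems by blast
  have "a j + (H + h) \<in> S'" if "j \<in> insert i I" for j
  proof (cases "j = i")
    case True
    then show ?thesis using dual_semigroup_add[OF h(3) H(1)] by (simp add: algebra_simps)
  next
    case False
    then show ?thesis using that dual_semigroup_add[OF H(3) h(1), of j] by (simp add: algebra_simps)
  qed
  moreover have "- ((H + h) \<circ> \<phi>) \<in> S"
    using dual_semigroup_add[OF H(2) h(2)] by (simp add: comp_add)
  ultimately show ?case using dual_semigroup_add[OF H(1) h(1)] by blast
qed

text \<open>Minimality, applied to the negative of the difference: \<open>n e\<close> is the lowest
  exponent in its coset, up to characters that are nonnegative on \<open>\<sigma>\<close>. With
  \<open>n = 1\<close> this yields bases, with general \<open>n\<close> it controls powers.\<close>

lemma minimal_multiple: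
  assumes e: "minimal e" and u: "u \<in> S" "coset u = coset (\<lambda>v. real n * e v)"
  obtains a where "a \<in> dual_lattice L'" "a \<circ> \<phi> \<in> S" "u = (\<lambda>v. real n * e v) + (a \<circ> \<phi>)"
proof -
  have "e \<in> dual_lattice L" using e by (simp add: minimal_exponent_def dual_semigroup_def)
  then have ne: "(\<lambda>v. real n * e v) \<in> dual_lattice L"
    by (auto simp: dual_lattice_def algebra_simps linear_add linear_scale intro!: linearI)
  obtain a where a: "a \<in> dual_lattice L'" "u = (\<lambda>v. real n * e v) + (a \<circ> \<phi>)"
    using coset_eqD[OF dual_semigroup_dual_lattice[OF u(1)] ne u(2)] .
  then have "(\<lambda>v. real n * e v) - ((- a) \<circ> \<phi>) \<in> S" using u(1) by (simp add: comp_uminus)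
  then have "- ((- a) \<circ> \<phi>) \<in> S"
    using e dual_lattice_uminus[OF a(1)] unfolding minimal_exponent_def by blast
  then show thesis using that[OF a(1) _ a(2)] by (simp add: comp_uminus)
qed

text \<open>The character left over beside a minimal exponent is only known to be nonnegative on
  \<open>\<sigma>\<close>; one common shift \<open>H\<close>, a unit upstairs, moves all of them
  into \<open>S'\<close>.\<close>

lemma finite_decomposition:
  assumes U: "finite U" "U \<subseteq> S"
  shows "\<exists>e b. \<exists>H\<in>S'. - (H \<circ> \<phi>) \<in> S \<and>
    (\<forall>u\<in>U. minimal (e u) \<and> b u \<in> S' \<and> u + (H \<circ> \<phi>) = e u + (b u \<circ> \<phi>)) \<and>
    (\<forall>u\<in>U. \<forall>v\<in>U. coset (e u) = coset (e v) \<longrightarrow> e u = e v)"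
proof -
  have "\<exists>e. minimal e \<and> coset e = coset u" if u: "u \<in> U" for u
  proof -
    obtain e a where e: "minimal e" "a \<in> dual_lattice L'" "u = e + (a \<circ> \<phi>)" using decompose U u by blast
    then have "coset u = coset e" using coset_add_comp[OF e(2), of e] by (simp add: add.commute)
    with e(1) show ?thesis by auto
  qed
  then obtain e0 where e0: "\<And>u. u \<in> U \<Longrightarrow> minimal (e0 u)" "\<And>u. u \<in> U \<Longrightarrow> coset (e0 u) = coset u"
    by metis
  \<comment> \<open>One minimal exponent per coset, so that distinct \<open>e u\<close> lie in
    distinct cosets; linear independence depends on this.\<close>
  define rep where "rep u = (SOME v. v \<in> U \<and> coset v = coset u)" for u
  have rep: "rep u \<in> U" "coset (rep u) = coset u" if "u \<in> U" for u
    using someI_ex[of "\<lambda>v. v \<in> U \<and> coset v = coset u"] that unfolding rep_def by blast+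
  define e where "e u = e0 (rep u)" for u
  have e: "minimal (e u)" "coset (e u) = coset u" if "u \<in> U" for u
    using e0[OF rep(1)[OF that]] rep(2)[OF that] unfolding e_def by auto
  have "\<exists>c. c \<in> dual_lattice L' \<and> c \<circ> \<phi> \<in> S \<and> u = e u + (c \<circ> \<phi>)" if u: "u \<in> U" for u
  proof -
    have eq: "(\<lambda>v. real 1 * e u v) = e u" by simp
    have "coset u = coset (\<lambda>v. real 1 * e u v)" unfolding eq using e(2)[OF u] by simp
    from minimal_multiple[OF e(1)[OF u] _ this] show ?thesis unfolding eq using U u by blast
  qed
  then obtain c where c: "\<And>u. u \<in> U \<Longrightarrow> c u \<in> dual_lattice L'" "\<And>u. u \<in> U \<Longrightarrow> c u \<circ> \<phi> \<in> S"
    "\<And>u. u \<in> U \<Longrightarrow> u = e u + (c u \<circ> \<phi>)" by metis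
  obtain H where H: "H \<in> S'" "- (H \<circ> \<phi>) \<in> S" "\<And>u. u \<in> U \<Longrightarrow> c u + H \<in> S'"
    using finite_face[OF U(1), of c] c by blast
  show ?thesis
  proof (intro exI[of _ e] exI[of _ "\<lambda>u. c u + H"] bexI[of _ H] conjI ballI impI)
    show "u + (H \<circ> \<phi>) = e u + ((c u + H) \<circ> \<phi>)" if "u \<in> U" for u
      using c(3)[OF that] by (simp add: comp_add add.assoc[symmetric])
    show "e u = e v" if "u \<in> U" "v \<in> U" "coset (e u) = coset (e v)" for u v
      using that e(2) unfolding e_def rep_def by simp
  qed (use H e in auto)
qed

section \<open>Freeness of a chart over the base\<close>

lemma domain_base: "domain (toric_chart L' \<sigma>')"
  using inj_chart_pullback[OF surj] L' \<sigma>' linear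
  by (intro domain_of_injective_hom[OF cring_toric_chart domain_toric_chart chart_pullback_ring_hom])
    (auto intro: inj_on_subset)

lemma keys_pull: "p \<in> carrier (toric_chart L' \<sigma>') \<Longrightarrow> k \<in> Poly_Mapping.keys (pull p) \<Longrightarrow> \<exists>a\<in>S'. k = a \<circ> \<phi>"
  using keys_chart_pullback[of \<phi> p] unfolding toric_chart_simps by blast

lemma pull_closed: "p \<in> carrier (toric_chart L' \<sigma>') \<Longrightarrow> pull p \<in> carrier (toric_chart L \<sigma>)"
  using keys_pull[of p] S'_comp unfolding toric_chart_simps(1)[of _ L] by blast

lemma coset_keys_pull_mult:
  assumes "p \<in> carrier (toric_chart L' \<sigma>')" "k \<in> Poly_Mapping.keys (pull p * mon u)"
  shows "coset k = coset u"
proof -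
  have "k \<in> {a + b | a b. a \<in> Poly_Mapping.keys (pull p) \<and> b \<in> Poly_Mapping.keys (mon u)}"
    using keys_mult assms(2) by blast
  then obtain v where "v \<in> Poly_Mapping.keys (pull p)" "k = v + u" by auto
  then obtain a where "a \<in> S'" "k = (a \<circ> \<phi>) + u" using keys_pull[OF assms(1)] by blast
  then show ?thesis using coset_add_comp dual_semigroup_dual_lattice by blast
qed

lemma part_pull_mult:
  assumes "p \<in> carrier (toric_chart L' \<sigma>')"
  shows "part {k. coset k = c} (pull p * q) = pull p * part {k. coset k = c} q"
proof (rule part_mult)
  fix u v assume "u \<in> Poly_Mapping.keys (pull p)"
  then obtain a where "a \<in> S'" "u = a \<circ> \<phi>" using keys_pull[OF assms] by blast
  then show "u + v \<in> {k. coset k = c} \<longleftrightarrow> v \<in> {k. coset k = c}"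
    using coset_add_comp[OF dual_semigroup_dual_lattice] by simp
qed

text \<open>Monomials in different cosets are independent over the base, because coefficients only
  contribute characters of the base. The finitely many exponents occurring in \<open>A\<close>
  decide which monomials and which shift \<open>H\<close> are taken.\<close>

lemma locally_free_chart: "locally_free (toric_chart L' \<sigma>') (restrict_scalars (toric_chart L \<sigma>) pull)"
  unfolding locally_free_def restrict_scalars_simps
proof (intro allI impI)
  fix A assume A: "finite A" "A \<subseteq> carrier (toric_chart L \<sigma>)"
  define U where "U = (\<Union>p\<in>A. Poly_Mapping.keys p)"
  have U: "finite U" "U \<subseteq> S" using A unfolding U_def by (auto simp: subset_iff)
  obtain e b H where H: "H \<in> S'" "- (H \<circ> \<phi>) \<in> S"
    and eb: "\<forall>u\<in>U. minimal (e u) \<and> b u \<in> S' \<and> u + (H \<circ> \<phi>) = e u + (b u \<circ> \<phi>)"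
    and e_inj: "\<forall>u\<in>U. \<forall>v\<in>U. coset (e u) = coset (e v) \<longrightarrow> e u = e v"
    using finite_decomposition[OF U] by blast
  have e: "minimal (e u)" and b: "b u \<in> S'" and eq: "u + (H \<circ> \<phi>) = e u + (b u \<circ> \<phi>)" if "u \<in> U" for u
    using eb that by simp_all
  \<comment> \<open>Shifting back by the unit keeps \<open>f u\<close> in \<open>S\<close>, and now
    \<open>u\<close> itself, not only \<open>u + (H \<circ> \<phi>)\<close>, is \<open>f u\<close>
    plus the pullback of a character in \<open>S'\<close>.\<close>
  define f where "f u = - (H \<circ> \<phi>) + e u" for u
  have f_S: "f u \<in> S" if "u \<in> U" for u
    using dual_semigroup_add[OF H(2)] e[OF that] unfolding f_def minimal_exponent_def by blast
  have f_coset: "coset (f u) = coset (e u)" for u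
    using coset_add_comp[OF dual_lattice_uminus[OF dual_semigroup_dual_lattice[OF H(1)]], of "e u"]
    by (simp add: f_def comp_uminus)
  have u_eq: "u = (b u \<circ> \<phi>) + f u" if "u \<in> U" for u
    using eq[OF that] unfolding f_def by (simp add: algebra_simps eq_diff_eq)
  define E where "E = (\<lambda>u. mon (f u)) ` U"
  have E: "finite E" "E \<subseteq> carrier (toric_chart L \<sigma>)"
    unfolding E_def using U(1) f_S by auto
  have finsum: "(\<Oplus>\<^bsub>toric_chart L \<sigma>\<^esub>g\<in>E. pull (c g) \<otimes>\<^bsub>toric_chart L \<sigma>\<^esub> g) = (\<Sum>g\<in>E. pull (c g) * g)"
    if c: "c \<in> E \<rightarrow> carrier (toric_chart L' \<sigma>')" for c
  proof -
    have "pull (c g) * g \<in> carrier (toric_chart L \<sigma>)" if "g \<in> E" for g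
      using that c E(2) pull_closed by (intro toric_chart_mult) blast+
    then show ?thesis unfolding toric_chart_simps(2) by (intro finsum_toric_chart) blast
  qed
  have "lin_independent (toric_chart L' \<sigma>') (restrict_scalars (toric_chart L \<sigma>) pull) E"
    unfolding lin_independent_def restrict_scalars_simps
  proof (intro conjI E ballI impI)
    fix c g assume c: "c \<in> E \<rightarrow> carrier (toric_chart L' \<sigma>')" and g: "g \<in> E"
      and zero: "(\<Oplus>\<^bsub>toric_chart L \<sigma>\<^esub>g\<in>E. pull (c g) \<otimes>\<^bsub>toric_chart L \<sigma>\<^esub> g) = \<zero>\<^bsub>toric_chart L \<sigma>\<^esub>"
    obtain u where u: "u \<in> U" "g = mon (f u)" using g unfolding E_def by blast
    \<comment> \<open>Projecting a linear relation to one coset leaves the single term of that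
      coset.\<close>
    define C where "C = {k. coset k = coset (f u)}"
    have "part C (pull (c g') * g') = (if g' = g then pull (c g) * g else 0)" if g': "g' \<in> E" for g'
    proof -
      obtain u' where u': "u' \<in> U" "g' = mon (f u')" using g' unfolding E_def by blast
      have keys: "coset k = coset (f u')" if "k \<in> Poly_Mapping.keys (pull (c g') * g')" for k
        using coset_keys_pull_mult[of "c g'" k "f u'"] c g' that unfolding u'(2) by blast
      show ?thesis
      proof (cases "g' = g")
        case True
        then have "Poly_Mapping.keys (mon (f u')) = Poly_Mapping.keys (mon (f u))" using u u' by simp
        then have "f u' = f u" by simp
        then show ?thesis using True keys by (auto simp: C_def intro!: part_eq)
      next
        case False
        then have "coset (f u') \<noteq> coset (f u)" using e_inj u u' unfolding f_coset by (auto simp: f_def)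
        then show ?thesis using False keys by (auto simp: C_def intro!: part_eq_zero)
      qed
    qed
    then have "part C (\<Sum>g\<in>E. pull (c g) * g) = pull (c g) * g"
      unfolding part_sum using g E(1) by (simp cong: sum.cong)
    then have "pull (c g) * mon (f u) = 0 * mon (f u)"
      using zero unfolding finsum[OF c] by (simp add: part_zero u(2))
    then have "pull (c g) = pull 0" unfolding chart_pullback_zero by (rule single_mult_cancel)
    then show "c g = \<zero>\<^bsub>toric_chart L' \<sigma>'\<^esub>" using inj_chart_pullback[OF surj] by (simp add: inj_eq)
  qed
  moreover have "A \<subseteq> lin_span (toric_chart L' \<sigma>') (restrict_scalars (toric_chart L \<sigma>) pull) E"
  proof
    fix p assume p: "p \<in> A"
    define c where "c g = (\<Sum>u\<in>{u\<in>Poly_Mapping.keys p. mon (f u) = g}. Poly_Mapping.single (b u) (Poly_Mapping.lookup p u))" for g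
    have pU: "u \<in> U" if "u \<in> Poly_Mapping.keys p" for u using that p unfolding U_def by blast
    have c: "c \<in> E \<rightarrow> carrier (toric_chart L' \<sigma>')"
      unfolding c_def using b pU by (intro Pi_I toric_chart_sum toric_chart_single) auto
    have "pull (c g) * g = (\<Sum>u\<in>{u\<in>Poly_Mapping.keys p. mon (f u) = g}. Poly_Mapping.single u (Poly_Mapping.lookup p u))" for g
    proof -
      have "pull (c g) * g = (\<Sum>u\<in>{u\<in>Poly_Mapping.keys p. mon (f u) = g}. Poly_Mapping.single (b u \<circ> \<phi>) (Poly_Mapping.lookup p u) * g)"
        unfolding c_def chart_pullback_sum chart_pullback_single sum_distrib_right ..
      also have "\<dots> = (\<Sum>u\<in>{u\<in>Poly_Mapping.keys p. mon (f u) = g}. Poly_Mapping.single u (Poly_Mapping.lookup p u))"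
      proof (intro sum.cong refl)
        fix u assume u: "u \<in> {u\<in>Poly_Mapping.keys p. mon (f u) = g}"
        have "Poly_Mapping.single (b u \<circ> \<phi>) (Poly_Mapping.lookup p u) * g = Poly_Mapping.single ((b u \<circ> \<phi>) + f u) (Poly_Mapping.lookup p u)"
          using u by (auto simp: mult_single)
        then show "Poly_Mapping.single (b u \<circ> \<phi>) (Poly_Mapping.lookup p u) * g = Poly_Mapping.single u (Poly_Mapping.lookup p u)"
          using u_eq[of u] pU u by simp
      qed
      finally show ?thesis .
    qed
    then have "(\<Sum>g\<in>E. pull (c g) * g) = (\<Sum>u\<in>Poly_Mapping.keys p. Poly_Mapping.single u (Poly_Mapping.lookup p u))"
      using E(1) pU by (simp add: sum.group E_def image_subset_iff)
    also have "\<dots> = p" using poly_mapping_eq_sum_single[of "Poly_Mapping.keys p" p] by simp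
    finally show "p \<in> lin_span (toric_chart L' \<sigma>') (restrict_scalars (toric_chart L \<sigma>) pull) E"
      unfolding lin_span_def restrict_scalars_simps using finsum[OF c] c by (intro CollectI exI[of _ c]) simp
  qed
  ultimately show "\<exists>E. lin_independent (toric_chart L' \<sigma>') (restrict_scalars (toric_chart L \<sigma>) pull) E \<and>
      A \<subseteq> lin_span (toric_chart L' \<sigma>') (restrict_scalars (toric_chart L \<sigma>) pull) E" by blast
qed

theorem flat_chart: "flat_spec_map TYPE('n) TYPE('k) (toric_chart L' \<sigma>') (toric_chart L \<sigma>) pull"
  using inj_chart_pullback[OF surj] L' \<sigma>' linear
  by (intro flat_spec_map_of_locally_free domain_base domain_toric_chart chart_pullback_ring_hom locally_free_chart)
    (auto intro: inj_on_subset)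

section \<open>Primes of the base and reducedness\<close>

inductive_set pull_span :: "(('w \<Rightarrow> real) \<Rightarrow>\<^sub>0 complex) set \<Rightarrow> (('v \<Rightarrow> real) \<Rightarrow>\<^sub>0 complex) set"
  for Q where
  zero: "0 \<in> pull_span Q"
| step: "p \<in> Q \<Longrightarrow> s \<in> carrier (toric_chart L \<sigma>) \<Longrightarrow> x \<in> pull_span Q \<Longrightarrow> pull p * s + x \<in> pull_span Q"

lemma ideal_pull_span:
  assumes Q: "Q \<subseteq> carrier (toric_chart L' \<sigma>')"
  shows "ideal (pull_span Q) (toric_chart L \<sigma>)"
proof -
  interpret cring "toric_chart L \<sigma>" by (rule cring_toric_chart)
  have closed: "x \<in> carrier (toric_chart L \<sigma>)" if "x \<in> pull_span Q" for x
    using that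
  proof induction
    case (step p s x)
    have "pull p * s \<in> carrier (toric_chart L \<sigma>)" using step(1,2) Q by (intro toric_chart_mult pull_closed) blast+
    then show ?case using step(4) by (rule toric_chart_add)
  qed simp
  have add: "x + y \<in> pull_span Q" if "x \<in> pull_span Q" "y \<in> pull_span Q" for x y
    using that(1)
  proof induction
    case (step p s x)
    then show ?case using pull_span.step[of p Q s "x + y"] by (simp add: add.assoc)
  qed (use that(2) in simp)
  have mult: "s * x \<in> pull_span Q" if "x \<in> pull_span Q" "s \<in> carrier (toric_chart L \<sigma>)" for x s
    using that(1)
  proof induction
    case (step p t x)
    then have "pull p * (s * t) + s * x \<in> pull_span Q"
      using that(2) by (intro pull_span.step toric_chart_mult)
    then show ?case by (simp add: algebra_simps)
  qed (simp add: pull_span.zero)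
  have neg: "- x \<in> pull_span Q" if "x \<in> pull_span Q" for x
  proof -
    have "- 1 \<in> carrier (toric_chart L \<sigma>)" using toric_chart_uminus[of 1] one_closed by simp
    from mult[OF that this] show ?thesis by simp
  qed
  show ?thesis
  proof (rule idealI)
    show "subgroup (pull_span Q) (add_monoid (toric_chart L \<sigma>))"
    proof (rule group.subgroupI[OF a_group])
      show "pull_span Q \<subseteq> carrier (add_monoid (toric_chart L \<sigma>))" using closed by auto
      show "pull_span Q \<noteq> {}" using pull_span.zero by blast
      fix x assume x: "x \<in> pull_span Q"
      have "\<ominus>\<^bsub>toric_chart L \<sigma>\<^esub> x = - x"
        using closed[OF x] closed[OF neg[OF x]] by (intro minus_equality) simp_all
      then show "inv\<^bsub>add_monoid (toric_chart L \<sigma>)\<^esub> x \<in> pull_span Q"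
        using neg[OF x] by (simp add: a_inv_def)
    qed (simp add: add)
    fix x s assume x: "x \<in> pull_span Q" and s: "s \<in> carrier (toric_chart L \<sigma>)"
    show "s \<otimes>\<^bsub>toric_chart L \<sigma>\<^esub> x \<in> pull_span Q" "x \<otimes>\<^bsub>toric_chart L \<sigma>\<^esub> s \<in> pull_span Q"
      using mult[OF x s] by (simp_all add: mult.commute[of x])
  qed (rule ring_axioms)
qed

text \<open>Represents elements of the generated ideal as finite sums, so that their homogeneous
  components can be treated by induction.\<close>

lemma Idl_pull:
  assumes Q: "Q \<subseteq> carrier (toric_chart L' \<sigma>')"
  shows "Idl\<^bsub>toric_chart L \<sigma>\<^esub> (pull ` Q) \<subseteq> pull_span Q"
proof -
  interpret cring "toric_chart L \<sigma>" by (rule cring_toric_chart)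
  show ?thesis
  proof (rule genideal_minimal[OF ideal_pull_span[OF Q]])
    show "pull ` Q \<subseteq> pull_span Q"
    proof clarify
      fix p assume "p \<in> Q"
      then have "pull p * 1 + 0 \<in> pull_span Q"
        using one_closed by (intro pull_span.intros) simp_all
      then show "pull p \<in> pull_span Q" by simp
    qed
  qed
qed

text \<open>Every exponent of \<open>s\<close> in the coset of \<open>m\<close> is \<open>m\<close>
  plus a character that is nonnegative on \<open>\<sigma>\<close>. Up to a unit the homogeneous
  component is therefore the monomial of \<open>m\<close> with a coefficient from the base.\<close>

lemma part_minimal_multiple:
  fixes n :: nat
  assumes e: "minimal e" and s: "s \<in> carrier (toric_chart L \<sigma>)"
  defines "m \<equiv> \<lambda>v. real n * e v"
  obtains H q where "H \<in> S'" "- (H \<circ> \<phi>) \<in> S" "q \<in> carrier (toric_chart L' \<sigma>')"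
    "mon (H \<circ> \<phi>) * part {k. coset k = coset m} s = pull q * mon m"
proof -
  define U where "U = Poly_Mapping.keys s \<inter> {k. coset k = coset m}"
  have US: "u \<in> S" "coset u = coset m" if "u \<in> U" for u using that s unfolding U_def by auto
  have "\<exists>a. a \<in> dual_lattice L' \<and> a \<circ> \<phi> \<in> S \<and> u = m + (a \<circ> \<phi>)" if u: "u \<in> U" for u
    using minimal_multiple[OF e US(1)[OF u], of n] US(2)[OF u] unfolding m_def by blast
  then obtain a where a: "\<And>u. u \<in> U \<Longrightarrow> a u \<in> dual_lattice L'" "\<And>u. u \<in> U \<Longrightarrow> a u \<circ> \<phi> \<in> S"
    "\<And>u. u \<in> U \<Longrightarrow> u = m + (a u \<circ> \<phi>)" by metis
  have "finite U" unfolding U_def by simp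
  then obtain H where H: "H \<in> S'" "- (H \<circ> \<phi>) \<in> S" "\<And>u. u \<in> U \<Longrightarrow> a u + H \<in> S'"
    using finite_face[of U a] a by blast
  define q where "q = (\<Sum>u\<in>U. Poly_Mapping.single (a u + H) (Poly_Mapping.lookup s u))"
  have "q \<in> carrier (toric_chart L' \<sigma>')" unfolding q_def using H(3) by (intro toric_chart_sum toric_chart_single)
  moreover have "mon (H \<circ> \<phi>) * part {k. coset k = coset m} s = pull q * mon m"
    unfolding q_def part_def U_def[symmetric] chart_pullback_sum chart_pullback_single sum_distrib_left sum_distrib_right mult_single
  proof (intro sum.cong refl)
    fix u assume u: "u \<in> U"
    have "(H \<circ> \<phi>) + u = ((a u + H) \<circ> \<phi>) + m"
      by (subst (1) a(3)[OF u]) (simp add: fun_eq_iff)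
    then show "Poly_Mapping.single ((H \<circ> \<phi>) + u) (1 * Poly_Mapping.lookup s u) =
        Poly_Mapping.single (((a u + H) \<circ> \<phi>) + m) (Poly_Mapping.lookup s u * 1)" by simp
  qed
  ultimately show thesis using H that by blast
qed

text \<open>Multiplication by elements of the base preserves cosets, so the component of a sum
  \<open>pull p * s + x\<close> can be taken in \<open>s\<close> and \<open>x\<close> separately.
  The factor \<open>p\<close> then puts the coefficient of the monomial of \<open>m\<close> into
  \<open>Q\<close>.\<close>

lemma part_pull_span:
  fixes n :: nat
  assumes Q: "ideal Q (toric_chart L' \<sigma>')" and e: "minimal e" and x: "x \<in> pull_span Q"
  defines "m \<equiv> \<lambda>v. real n * e v"
  shows "\<exists>H q. H \<in> S' \<and> - (H \<circ> \<phi>) \<in> S \<and> q \<in> Q \<and> mon (H \<circ> \<phi>) * part {k. coset k = coset m} x = pull q * mon m"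
  using x
proof induction
  interpret Q: ideal Q "toric_chart L' \<sigma>'" by (rule Q)
  case zero
  have eq: "(0 :: 'w \<Rightarrow> real) \<circ> \<phi> = 0" "- (0 :: 'v \<Rightarrow> real) = 0" by (simp_all add: fun_eq_iff)
  have "0 \<in> Q" using additive_subgroup.zero_closed[OF Q.is_additive_subgroup] by simp
  moreover have "- ((0 :: 'w \<Rightarrow> real) \<circ> \<phi>) \<in> S" unfolding eq by (rule dual_semigroup_zero)
  moreover have "mon ((0 :: 'w \<Rightarrow> real) \<circ> \<phi>) * part {k. coset k = coset m} 0 = pull 0 * mon m"
    by (simp add: part_zero chart_pullback_zero)
  ultimately show ?case using dual_semigroup_zero[of L' \<sigma>'] by blast
next
  interpret Q: ideal Q "toric_chart L' \<sigma>'" by (rule Q)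
  case (step p s x)
  obtain H q where H: "H \<in> S'" "- (H \<circ> \<phi>) \<in> S" "q \<in> Q"
    "mon (H \<circ> \<phi>) * part {k. coset k = coset m} x = pull q * mon m" using step.IH by blast
  obtain G r where G: "G \<in> S'" "- (G \<circ> \<phi>) \<in> S" "r \<in> carrier (toric_chart L' \<sigma>')"
    "mon (G \<circ> \<phi>) * part {k. coset k = coset m} s = pull r * mon m"
    using part_minimal_multiple[OF e step(2), of n] unfolding m_def by blast
  have p: "p \<in> carrier (toric_chart L' \<sigma>')" using Q.Icarr[OF step(1)] .
  \<comment> \<open>Each summand comes with its own unit; cross multiplication brings both to the
    common unit \<open>H + G\<close>.\<close>
  define q' where "q' = Poly_Mapping.single H 1 * (r * p) + Poly_Mapping.single G 1 * q"
  have "(Poly_Mapping.single H 1 * r) * p \<in> Q"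
    using Q.I_l_closed[OF step(1), of "Poly_Mapping.single H 1 * r"]
      toric_chart_mult[OF toric_chart_single[OF H(1)] G(3)] by simp
  moreover have "Poly_Mapping.single G 1 * q \<in> Q"
    using Q.I_l_closed[OF H(3) toric_chart_single[OF G(1)]] by simp
  ultimately have "q' \<in> Q"
    using additive_subgroup.a_closed[OF Q.is_additive_subgroup] unfolding q'_def by (simp add: mult.assoc)
  moreover have "mon ((H + G) \<circ> \<phi>) * part {k. coset k = coset m} (pull p * s + x) = pull q' * mon m"
  proof -
    have mon_add: "mon (u + v) = mon u * mon v" for u v by (simp add: mult_single)
    have distribute: "(a * b) * (c * d + f) = a * c * (b * d) + b * (a * f)"
      for a b c d f :: "('v \<Rightarrow> real) \<Rightarrow>\<^sub>0 complex" by (simp add: algebra_simps)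
    have collect: "a * c * (d * f) + b * (g * f) = (a * (d * c) + b * g) * f"
      for a b c d f g :: "('v \<Rightarrow> real) \<Rightarrow>\<^sub>0 complex" by (simp add: algebra_simps)
    have "mon ((H + G) \<circ> \<phi>) * part {k. coset k = coset m} (pull p * s + x) =
        mon (H \<circ> \<phi>) * pull p * (mon (G \<circ> \<phi>) * part {k. coset k = coset m} s) +
        mon (G \<circ> \<phi>) * (mon (H \<circ> \<phi>) * part {k. coset k = coset m} x)"
      unfolding part_add part_pull_mult[OF p] comp_add mon_add by (rule distribute)
    also have "\<dots> = pull q' * mon m"
      unfolding H(4) G(4) q'_def chart_pullback_add chart_pullback_mult chart_pullback_single
      by (rule collect)
    finally show ?thesis .
  qed
  moreover have "- ((H + G) \<circ> \<phi>) \<in> S" using dual_semigroup_add[OF H(2) G(2)] by (simp add: comp_add)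
  ultimately show ?case using dual_semigroup_add[OF H(1) G(1)] by blast
qed

lemma mon_unit_notin:
  assumes P: "primeideal P (toric_chart L \<sigma>)" and H: "H \<in> S'" "- (H \<circ> \<phi>) \<in> S"
  shows "mon (H \<circ> \<phi>) \<in> carrier (toric_chart L \<sigma>) - P"
proof -
  interpret P: primeideal P "toric_chart L \<sigma>" by (rule P)
  have "mon (H \<circ> \<phi>) \<notin> P"
  proof
    assume "mon (H \<circ> \<phi>) \<in> P"
    then have "mon (- (H \<circ> \<phi>)) \<otimes>\<^bsub>toric_chart L \<sigma>\<^esub> mon (H \<circ> \<phi>) \<in> P"
      by (rule P.I_l_closed) (rule toric_chart_single[OF H(2)])
    then have "\<one>\<^bsub>toric_chart L \<sigma>\<^esub> \<in> P" by (simp add: mult_single)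
    then show False using P.one_imp_carrier P.I_notcarr by blast
  qed
  then show ?thesis using toric_chart_single[OF S'_comp[OF H(1)]] by blast
qed

lemma single_power: "mon e ^ n = mon (\<lambda>v. real n * e v)"
proof (induction n)
  case 0
  then show ?case by (simp flip: zero_fun_def)
next
  case (Suc n)
  have "e + (\<lambda>v. real n * e v) = (\<lambda>v. real (Suc n) * e v)" by (simp add: fun_eq_iff algebra_simps)
  then show ?case by (simp add: Suc mult_single)
qed

lemma pull_power: "pull (r ^ n) = pull r ^ n"
  by (induction n) (simp_all add: chart_pullback_one chart_pullback_mult)

text \<open>The summand \<open>y\<^sub>0\<close> whose coset has maximal norm contributes \<open>y\<^sub>0\<^sup>n\<close> to \<open>(y\<^sub>0 + z)\<^sup>n\<close> with no
  interference from the other summands: the inner product with that coset separates them.\<close>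
lemma power_leading_part:
  fixes y z :: "('v \<Rightarrow> real) \<Rightarrow>\<^sub>0 complex" and \<theta> :: "('v \<Rightarrow> real) \<Rightarrow> real"
  assumes \<theta>: "\<And>u v. \<theta> (u + v) = \<theta> u + \<theta> v"
    and y: "\<And>k. k \<in> Poly_Mapping.keys y \<Longrightarrow> \<theta> k = t" and z: "\<And>k. k \<in> Poly_Mapping.keys z \<Longrightarrow> \<theta> k < t"
  shows "\<exists>w. (y + z) ^ n = y ^ n + w \<and> (\<forall>k\<in>Poly_Mapping.keys w. \<theta> k < real n * t) \<and>
    (\<forall>k\<in>Poly_Mapping.keys (y ^ n). \<theta> k = real n * t)"
proof (induction n)
  case 0
  have "\<theta> 0 = 0" using \<theta>[of 0 0] by simp
  moreover have "k = 0" if "k \<in> Poly_Mapping.keys (y ^ 0)" for k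
    using that unfolding power_0 keys_one by (rule singletonD)
  ultimately have "\<forall>k\<in>Poly_Mapping.keys (y ^ 0). \<theta> k = real 0 * t" by simp
  moreover have "(y + z) ^ 0 = y ^ 0 + 0" "\<forall>k\<in>Poly_Mapping.keys 0. \<theta> k < real 0 * t" by simp_all
  ultimately show ?case by blast
next
  case (Suc n)
  then obtain w where w: "(y + z) ^ n = y ^ n + w" "\<And>k. k \<in> Poly_Mapping.keys w \<Longrightarrow> \<theta> k < real n * t"
    "\<And>k. k \<in> Poly_Mapping.keys (y ^ n) \<Longrightarrow> \<theta> k = real n * t" by blast
  have "(y + z) ^ Suc n = y ^ Suc n + (z * y ^ n + (y * w + z * w))"
    using w(1) by (simp add: algebra_simps)
  moreover have mult: "\<exists>a\<in>Poly_Mapping.keys p. \<exists>b\<in>Poly_Mapping.keys q. \<theta> k = \<theta> a + \<theta> b"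
    if "k \<in> Poly_Mapping.keys (p * q)" for p q :: "('v \<Rightarrow> real) \<Rightarrow>\<^sub>0 complex" and k
    using keys_mult[of p q] that \<theta> by blast
  moreover have "\<theta> k < real (Suc n) * t" if "k \<in> Poly_Mapping.keys (z * y ^ n + (y * w + z * w))" for k
  proof -
    have "k \<in> Poly_Mapping.keys (z * y ^ n) \<union> Poly_Mapping.keys (y * w) \<union> Poly_Mapping.keys (z * w)"
      using that keys_add[of "z * y ^ n" "y * w + z * w"] keys_add[of "y * w" "z * w"] by blast
    then obtain p q where pq: "k \<in> Poly_Mapping.keys (p * q)" "(p, q) \<in> {(z, y ^ n), (y, w), (z, w)}" by auto
    obtain a b where ab: "a \<in> Poly_Mapping.keys p" "b \<in> Poly_Mapping.keys q" "\<theta> k = \<theta> a + \<theta> b"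
      using mult[OF pq(1)] by blast
    have "\<theta> a + \<theta> b < t + real n * t"
      using pq(2) ab(1,2) w(2,3)[of b] y[of a] z[of a] by force
    then show ?thesis using ab(3) by (simp add: algebra_simps)
  qed
  moreover have "\<theta> k = real (Suc n) * t" if k: "k \<in> Poly_Mapping.keys (y ^ Suc n)" for k
  proof -
    have "k \<in> Poly_Mapping.keys (y * y ^ n)" using k by simp
    from mult[OF this] show ?thesis using y w(3) by (force simp: algebra_simps)
  qed
  ultimately show ?case by blast
qed

text \<open>Up to a unit, \<open>a\<close> is a combination of monomials of minimal exponents with
  coefficients \<open>r g\<close> from the base. If some \<open>r g\<close> were outside the prime
  \<open>Q\<close>, a leading one would contribute its \<open>n\<close>-th power undisturbed, and
  this power would lie in \<open>Q\<close> up to a unit. So all coefficients lie in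
  \<open>Q\<close>.\<close>

lemma radical_chart:
  assumes P: "primeideal P (toric_chart L \<sigma>)" and a: "a \<in> carrier (toric_chart L \<sigma>)"
    and an: "a ^ n \<in> Idl\<^bsub>toric_chart L \<sigma>\<^esub> (pull ` spec_map (toric_chart L' \<sigma>') pull P)"
  shows "\<exists>w\<in>carrier (toric_chart L \<sigma>) - P.
    w * a \<in> Idl\<^bsub>toric_chart L \<sigma>\<^esub> (pull ` spec_map (toric_chart L' \<sigma>') pull P)"
proof -
  define Q where "Q = spec_map (toric_chart L' \<sigma>') pull P"
  define J where "J = Idl\<^bsub>toric_chart L \<sigma>\<^esub> (pull ` Q)"
  interpret T: cring "toric_chart L \<sigma>" by (rule cring_toric_chart)
  have pull_hom: "pull \<in> ring_hom (toric_chart L' \<sigma>') (toric_chart L \<sigma>)"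
    using L' \<sigma>' linear by (intro chart_pullback_ring_hom) auto
  interpret Q: primeideal Q "toric_chart L' \<sigma>'"
    unfolding Q_def by (rule primeideal_spec_map[OF cring_toric_chart pull_hom P])
  have Q_carrier: "Q \<subseteq> carrier (toric_chart L' \<sigma>')" using Q.Icarr by blast
  have pQ: "pull ` Q \<subseteq> carrier (toric_chart L \<sigma>)" using Q_carrier pull_closed by blast
  interpret J: ideal J "toric_chart L \<sigma>" unfolding J_def by (rule T.genideal_ideal[OF pQ])
  have J_add: "x + y \<in> J" if "x \<in> J" "y \<in> J" for x y
    using additive_subgroup.a_closed[OF J.is_additive_subgroup that] by simp
  have J_mult: "s * x \<in> J" if "s \<in> carrier (toric_chart L \<sigma>)" "x \<in> J" for s x
    using J.I_l_closed[OF that(2,1)] by simp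
  have neg1: "- 1 \<in> carrier (toric_chart L \<sigma>)" using toric_chart_uminus[of 1] T.one_closed by simp
  have J_diff: "x - y \<in> J" if "x \<in> J" "y \<in> J" for x y
    using J_add[OF that(1) J_mult[OF neg1 that(2)]] by simp
  have J_zero: "0 \<in> J" using additive_subgroup.zero_closed[OF J.is_additive_subgroup] by simp
  have J_sum: "sum f A \<in> J" if "\<And>i. i \<in> A \<Longrightarrow> f i \<in> J" for f :: "_ \<Rightarrow> _" and A
    using that by (induction A rule: infinite_finite_induct) (auto intro: J_zero J_add)
  have J_pull: "pull p * s \<in> J" if "p \<in> Q" "s \<in> carrier (toric_chart L \<sigma>)" for p s
  proof -
    have "pull p \<in> J" using T.genideal_self[OF pQ] that(1) unfolding J_def by blast
    from J_mult[OF that(2) this] show ?thesis by (simp add: mult.commute)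
  qed
  have pow_closed: "x ^ k \<in> carrier (toric_chart L \<sigma>)" if "x \<in> carrier (toric_chart L \<sigma>)" for x and k :: nat
    using T.nat_pow_closed[OF that, of k] unfolding pow_toric_chart .
  define U where "U = Poly_Mapping.keys a"
  have U: "finite U" "U \<subseteq> S" using a by (auto simp: U_def)
  obtain e b H where H: "H \<in> S'" "- (H \<circ> \<phi>) \<in> S"
    and eb: "\<forall>u\<in>U. minimal (e u) \<and> b u \<in> S' \<and> u + (H \<circ> \<phi>) = e u + (b u \<circ> \<phi>)"
    and e_inj: "\<forall>u\<in>U. \<forall>v\<in>U. coset (e u) = coset (e v) \<longrightarrow> e u = e v"
    using finite_decomposition[OF U] by blast
  have e: "minimal (e u)" and b: "b u \<in> S'" and eq: "u + (H \<circ> \<phi>) = e u + (b u \<circ> \<phi>)" if "u \<in> U" for u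
    using eb that by simp_all
  define G where "G = e ` U"
  define r where "r g = (\<Sum>u\<in>{u\<in>U. e u = g}. Poly_Mapping.single (b u) (Poly_Mapping.lookup a u))" for g
  have G: "finite G" "\<And>g. g \<in> G \<Longrightarrow> minimal g" "\<And>g g'. g \<in> G \<Longrightarrow> g' \<in> G \<Longrightarrow> coset g = coset g' \<Longrightarrow> g = g'"
    using U(1) e e_inj unfolding G_def by auto
  have G_S: "g \<in> S" if "g \<in> G" for g using G(2)[OF that] by (simp add: minimal_exponent_def)
  have r: "r g \<in> carrier (toric_chart L' \<sigma>')" for g
    unfolding r_def using b by (intro toric_chart_sum toric_chart_single) auto
  define x where "x = mon (H \<circ> \<phi>) * a"
  have H_unit: "mon (H \<circ> \<phi>) \<in> carrier (toric_chart L \<sigma>) - P" by (rule mon_unit_notin[OF P H])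
  have x_eq: "x = (\<Sum>g\<in>G. pull (r g) * mon g)"
  proof -
    have "pull (r g) * mon g = (\<Sum>u\<in>{u\<in>U. e u = g}. mon (H \<circ> \<phi>) * Poly_Mapping.single u (Poly_Mapping.lookup a u))" for g
      unfolding r_def chart_pullback_sum chart_pullback_single sum_distrib_right mult_single
      using eq by (intro sum.cong refl) (auto simp: add.commute)
    then have "(\<Sum>g\<in>G. pull (r g) * mon g) = (\<Sum>u\<in>U. mon (H \<circ> \<phi>) * Poly_Mapping.single u (Poly_Mapping.lookup a u))"
      using U(1) by (simp add: sum.group G_def)
    also have "\<dots> = mon (H \<circ> \<phi>) * a"
      using poly_mapping_eq_sum_single[of U a] unfolding sum_distrib_left[symmetric] U_def by simp
    finally show ?thesis by (simp add: x_def)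
  qed
  \<comment> \<open>The terms that survive in the fibre; the others belong to \<open>J\<close> and
    change powers only modulo \<open>J\<close>.\<close>
  define G1 where "G1 = {g \<in> G. r g \<notin> Q}"
  define y where "y = (\<Sum>g\<in>G1. pull (r g) * mon g)"
  define t where "t = (\<Sum>g\<in>G - G1. pull (r g) * mon g)"
  have G1: "finite G1" "G1 \<subseteq> G" using G(1) by (auto simp: G1_def)
  have x_yt: "x = t + y"
    unfolding x_eq y_def t_def using sum.subset_diff[OF G1(2) G(1)] by blast
  have t: "t \<in> J"
    unfolding t_def using G_S by (intro J_sum J_pull toric_chart_single) (auto simp: G1_def)
  have x_carrier: "x \<in> carrier (toric_chart L \<sigma>)" unfolding x_def using H_unit a by (intro toric_chart_mult) blast+
  have y_carrier: "y \<in> carrier (toric_chart L \<sigma>)"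
    unfolding y_def using G_S G1(2) r by (intro toric_chart_sum toric_chart_mult pull_closed toric_chart_single) blast+
  have xn: "x ^ n \<in> J"
    unfolding x_def power_mult_distrib using an H_unit unfolding J_def[symmetric] Q_def[symmetric]
    by (intro J_mult pow_closed) blast+
  have "x ^ k - y ^ k \<in> J" for k
  proof (induction k)
    case (Suc k)
    have "x ^ Suc k - y ^ Suc k = x * (x ^ k - y ^ k) + y ^ k * t"
      unfolding x_yt by (simp add: algebra_simps)
    then show ?case using J_add[OF J_mult[OF x_carrier Suc.IH] J_mult[OF pow_closed[OF y_carrier] t]] by simp
  qed (simp add: J_zero)
  from J_diff[OF xn this[of n]] have yn: "y ^ n \<in> J" by simp
  have "G1 = {}"
  proof (rule ccontr)
    assume "G1 \<noteq> {}"
    \<comment> \<open>The squared norm of a coset. A coset of maximal norm is separated from all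
      others by the inner product with it, which is \<open>\<theta>\<close> below.\<close>
    define N where "N u = (\<Sum>v\<in>ker_basis. (u v)\<^sup>2)" for u :: "'v \<Rightarrow> real"
    from ex_is_arg_min_if_finite[OF G1(1) \<open>G1 \<noteq> {}\<close>, of "\<lambda>g. - N g"]
    obtain g where g: "g \<in> G1" "\<And>g'. g' \<in> G1 \<Longrightarrow> N g' \<le> N g"
      unfolding is_arg_min_linorder by auto
    define \<theta> where "\<theta> u = (\<Sum>v\<in>ker_basis. u v * g v)" for u :: "'v \<Rightarrow> real"
    have \<theta>_add: "\<theta> (u + v) = \<theta> u + \<theta> v" for u v
      by (simp add: \<theta>_def distrib_right sum.distrib)
    have \<theta>_coset: "\<theta> u = \<theta> v" if "coset u = coset v" for u v
      unfolding \<theta>_def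
    proof (intro sum.cong refl)
      fix w assume "w \<in> ker_basis"
      then show "u w * g w = v w * g w" using fun_cong[OF that, of w] by (simp add: coset_def)
    qed
    have \<theta>_less: "\<theta> g' < \<theta> g" if g': "g' \<in> G1" "g' \<noteq> g" for g'
    proof -
      have "coset g' \<noteq> coset g" using G(3) g' g(1) G1(2) by blast
      then obtain w where w: "w \<in> ker_basis" "g' w \<noteq> g w" by (auto simp: coset_def fun_eq_iff split: if_splits)
      \<comment> \<open>Expanding a positive squared distance gives
        \<open>2 \<theta> g' < N g' + N g\<close>, and by maximality the right side is at most
        \<open>2 N g = 2 \<theta> g\<close>.\<close>
      have "0 < (\<Sum>v\<in>ker_basis. (g' v - g v)\<^sup>2)"
        using w by (intro sum_pos2[OF ker_basis(1) w(1)]) auto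
      also have "\<dots> = N g' + N g - 2 * \<theta> g'"
        unfolding N_def \<theta>_def sum_distrib_left sum.distrib[symmetric] sum_subtractf[symmetric]
        by (intro sum.cong refl) (simp add: power2_eq_square algebra_simps)
      finally have "2 * \<theta> g' < N g' + N g" by simp
      moreover have "\<theta> g = N g" by (simp add: \<theta>_def N_def power2_eq_square)
      ultimately show ?thesis using g(2)[OF g'(1)] by linarith
    qed
    define y0 z where "y0 = pull (r g) * mon g" and "z = (\<Sum>g\<in>G1 - {g}. pull (r g) * mon g)"
    have y_eq: "y = y0 + z" unfolding y_def y0_def z_def using sum.remove[OF G1(1) g(1)] .
    have y0_keys: "coset k = coset g" if "k \<in> Poly_Mapping.keys y0" for k
      using coset_keys_pull_mult[OF r] that unfolding y0_def .
    have z_keys: "\<theta> k < \<theta> g" if k: "k \<in> Poly_Mapping.keys z" for k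
    proof -
      have "k \<in> (\<Union>g'\<in>G1 - {g}. Poly_Mapping.keys (pull (r g') * mon g'))"
        using keys_sum[of "\<lambda>g. pull (r g) * mon g" "G1 - {g}"] k unfolding z_def by blast
      then obtain g' where g': "g' \<in> G1" "g' \<noteq> g" "k \<in> Poly_Mapping.keys (pull (r g') * mon g')" by blast
      then have "\<theta> k = \<theta> g'" using \<theta>_coset coset_keys_pull_mult[OF r] by blast
      then show ?thesis using \<theta>_less[OF g'(1,2)] by simp
    qed
    obtain w where w: "y ^ n = y0 ^ n + w" "\<And>k. k \<in> Poly_Mapping.keys w \<Longrightarrow> \<theta> k < real n * \<theta> g"
      using power_leading_part[of \<theta> y0 "\<theta> g" z n] \<theta>_add \<theta>_coset y0_keys z_keys unfolding y_eq by blast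
    define m where "m = (\<lambda>v. real n * g v)"
    have \<theta>m: "\<theta> m = real n * \<theta> g" by (simp add: \<theta>_def m_def sum_distrib_left mult.assoc)
    have y0n: "y0 ^ n = pull (r g ^ n) * mon m"
      unfolding y0_def power_mult_distrib single_power pull_power m_def ..
    have rn: "r g ^ k \<in> carrier (toric_chart L' \<sigma>')" for k
      using monoid.nat_pow_closed[OF _ r[of g], of k] Q.is_cring unfolding pow_toric_chart
      by (simp add: cring_def comm_monoid_def comm_monoid.axioms(1))
    have "part {k. coset k = coset m} w = 0"
    proof (rule part_eq_zero, rule ccontr)
      assume "Poly_Mapping.keys w \<inter> {k. coset k = coset m} \<noteq> {}"
      then obtain k where "k \<in> Poly_Mapping.keys w" "coset k = coset m" by blast
      then show False using w(2)[of k] \<theta>_coset[of k m] \<theta>m by simp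
    qed
    moreover have "part {k. coset k = coset m} (y0 ^ n) = y0 ^ n"
      using coset_keys_pull_mult[OF rn] unfolding y0n by (intro part_eq) blast
    ultimately have part: "part {k. coset k = coset m} (y ^ n) = pull (r g ^ n) * mon m"
      unfolding w(1) part_add y0n by simp
    have "y ^ n \<in> pull_span Q" using yn Idl_pull[OF Q_carrier] unfolding J_def by blast
    moreover have min_g: "minimal g" using G(2) g(1) G1(2) by blast
    ultimately obtain H' q where H': "H' \<in> S'" "- (H' \<circ> \<phi>) \<in> S" "q \<in> Q"
      "mon (H' \<circ> \<phi>) * part {k. coset k = coset m} (y ^ n) = pull q * mon m"
      using part_pull_span[OF Q.is_ideal, of g "y ^ n" n] unfolding m_def by blast
    have "pull (Poly_Mapping.single H' 1 * r g ^ n) * mon m = pull q * mon m"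
      using H'(4) unfolding part chart_pullback_mult chart_pullback_single by (simp add: mult.assoc)
    then have "pull (Poly_Mapping.single H' 1 * r g ^ n) = pull q" by (rule single_mult_cancel)
    then have "Poly_Mapping.single H' 1 * r g ^ n = q" using inj_chart_pullback[OF surj] by (simp add: inj_eq)
    then have in_Q: "Poly_Mapping.single H' 1 \<otimes>\<^bsub>toric_chart L' \<sigma>'\<^esub> r g ^ n \<in> Q" using H'(3) by simp
    \<comment> \<open>\<open>H'\<close> pulls back to a unit, so its monomial avoids
      \<open>Q\<close>; the prime \<open>Q\<close>, containing the product in \<open>in_Q\<close>,
      would then contain a power of \<open>r g\<close> and hence \<open>r g\<close> itself.\<close>
    have notin: "Poly_Mapping.single H' 1 \<notin> Q"
      using mon_unit_notin[OF P H'(1,2)] unfolding Q_def spec_map_def by (simp add: chart_pullback_single)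
    have "r g ^ k \<notin> Q" for k
    proof (induction k)
      case 0
      have "\<one>\<^bsub>toric_chart L' \<sigma>'\<^esub> \<notin> Q" using Q.one_imp_carrier Q.I_notcarr by blast
      then show ?case by simp
    next
      case (Suc k)
      have "r g \<notin> Q" using g(1) by (simp add: G1_def)
      then show ?case using Q.I_prime[OF r[of g] rn[of k]] Suc.IH by auto
    qed
    then show False using Q.I_prime[OF toric_chart_single[OF H'(1)] rn[of n] in_Q] notin by blast
  qed
  then have "x \<in> J" using t x_yt by (simp add: y_def)
  then show ?thesis using H_unit unfolding x_def J_def Q_def by blast
qed

theorem reduced_fibres_chart: "reduced_fibres_spec_map (toric_chart L' \<sigma>') (toric_chart L \<sigma>) pull"
proof (rule reduced_fibres_spec_mapI[OF domain_base domain_toric_chart])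
  show "pull \<in> ring_hom (toric_chart L' \<sigma>') (toric_chart L \<sigma>)"
    using L' \<sigma>' linear by (intro chart_pullback_ring_hom) auto
qed (use radical_chart in \<open>simp add: pow_toric_chart del: toric_chart_simps(1)\<close>)

end

subsection \<open>Linear forms as matrices\<close>

lemma cost_scale_right: "cost e (\<lambda>i k. r * V i k) = r * cost e V"
  by (simp add: cost_def sum_distrib_left algebra_simps)

lemma cost_scale: "cost (\<lambda>i k. n * e i k) V = real_of_int n * cost e V"
  by (simp add: cost_def sum_distrib_left algebra_simps)

abbreviation form :: "('m::finite \<Rightarrow> 'd::finite option \<Rightarrow> int) \<Rightarrow> real^'d^'m \<Rightarrow> real"
  where "form e \<equiv> \<lambda>y. cost e (coords y)"

lemma linear_form: "linear (form e)"
  by (rule linearI) (simp_all add: coords_add cost_add_right coords_scaleR cost_scale_right)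

lemma form_dual_lattice: "form e \<in> dual_lattice int_lattice"
proof -
  have "coords y i k \<in> \<int>" if "y \<in> int_lattice" for y :: "real^'a^'b" and i k
    using that by (cases k) (simp_all add: coords_None coords_Some int_lattice_def)
  then have "form e y \<in> \<int>" if "y \<in> int_lattice" for y
    unfolding cost_def using that by (intro Ints_sum Ints_mult) auto
  then show ?thesis using linear_form by (simp add: dual_lattice_def)
qed

lemma sum_option: "(\<Sum>k\<in>UNIV. f k) = f None + (\<Sum>j\<in>UNIV. f (Some j))" for f :: "'d::finite option \<Rightarrow> 'a::comm_monoid_add"
  by (simp add: UNIV_option_conv sum.reindex)

text \<open>The vertex 0 pairs to zero with every vector, so the entries in column
  \<open>None\<close> are free; they are chosen to make the row sums vanish, after which adding row
  constants to the costs changes nothing.\<close>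

lemma dual_lattice_form:
  assumes u: "u \<in> dual_lattice (int_lattice :: (real^'d::finite^'m::finite) set)"
  shows "\<exists>e. u = form e \<and> (\<forall>i. (\<Sum>k\<in>UNIV. e i k) = 0)"
proof -
  have lin: "linear u" and int: "\<And>v. v \<in> int_lattice \<Longrightarrow> u v \<in> \<int>" using u by (auto simp: dual_lattice_def)
  define c where "c i j = \<lfloor>u (axis i (axis j 1))\<rfloor>" for i :: 'm and j :: 'd
  have c: "u (axis i (axis j 1)) = c i j" for i j
    unfolding c_def using int[of "axis i (axis j 1)"]
    by (auto simp: int_lattice_def axis_def elim: Ints_cases)
  define e where "e i k = (case k of None \<Rightarrow> - (\<Sum>j\<in>UNIV. c i j) | Some j \<Rightarrow> c i j)" for i k
  have "u y = form e y" for y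
  proof -
    have inner: "(\<Sum>j\<in>UNIV. if P then g j else 0) = (if P then sum g UNIV else 0)" for P and g :: "'d \<Rightarrow> real"
      by simp
    have "y = (\<Sum>i\<in>UNIV. \<Sum>j\<in>UNIV. (y $ i $ j) *\<^sub>R axis i (axis j 1))"
      by (simp add: vec_eq_iff axis_def if_distrib[of "\<lambda>x. x $ _"] if_distrib[of "(*) _"] inner cong: if_cong)
    then have "u y = (\<Sum>i\<in>UNIV. \<Sum>j\<in>UNIV. (y $ i $ j) * c i j)"
      using c by (metis (mono_tags, lifting) linear_sum[OF lin] linear_scale[OF lin] real_scaleR_def sum.cong)
    then show ?thesis
      by (simp add: cost_def sum_option coords_None coords_Some e_def mult.commute)
  qed
  moreover have "(\<Sum>k\<in>UNIV. e i k) = 0" for i by (simp add: sum_option e_def)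
  ultimately show ?thesis by blast
qed

lemma form_diag: "form e (diag x) = (\<Sum>k\<in>UNIV. of_int (\<Sum>i\<in>UNIV. e i k) * (x \<bullet> simplex_vertex k))"
  unfolding cost_def coords_diag by (subst sum.swap) (simp add: sum_distrib_right)

lemma form_diag_balanced: "balanced e \<Longrightarrow> form e (diag x) = 0"
  unfolding form_diag by (simp add: balanced_def del: of_int_sum)

text \<open>Vanishing column sums make the form constant along the diagonal, so it descends to the
  quotient.\<close>

lemma balanced_formE:
  fixes e :: "'m::finite \<Rightarrow> 'd::finite option \<Rightarrow> int"
  assumes "balanced e"
  obtains a where "a \<in> dual_lattice quotient_lattice" "form e = a \<circ> diag_proj"
proof -
  have ker: "form e x = 0" if "diag_proj x = 0" for x :: "real^'d^'m"
  proof -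
    have "diag_proj 0 = diag_proj x" using that linear_0[OF linear_diag_proj] by simp
    then obtain x' where "x = 0 + diag x'" using diag_proj_eq_iff by blast
    then show ?thesis using form_diag_balanced[OF assms] by simp
  qed
  then show thesis
    using dual_lattice_factor[OF linear_diag_proj surj_diag_proj form_dual_lattice, of e] that
    unfolding quotient_lattice_def by blast
qed

text \<open>Because the row sums vanish, each row of \<open>coords y\<close> may be measured from
  its minimum, which is attained on the cells of \<open>b\<close>.\<close>

lemma form_nonneg_tight_cone:
  assumes rows: "\<And>i. (\<Sum>k\<in>UNIV. e i k) = 0" and e: "nonneg_off b e"
    and b: "\<And>i. \<exists>k. (i, k) \<in> b" and y: "y \<in> tight_cone b"
  shows "0 \<le> form e y"
  unfolding cost_def
proof (rule sum_nonneg)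
  fix i
  obtain k0 where k0: "(i, k0) \<in> b" using b by blast
  have min: "coords y i k \<le> coords y i l" if "(i, k) \<in> b" for k l
    using y that unfolding tight_cone_def by blast
  have "(\<Sum>k\<in>UNIV. e i k * coords y i k) = (\<Sum>k\<in>UNIV. e i k * (coords y i k - coords y i k0))"
    using rows[of i] by (simp add: right_diff_distrib sum_subtractf flip: sum_distrib_right of_int_sum)
  also have "\<dots> \<ge> 0"
  proof (rule sum_nonneg)
    fix k
    show "0 \<le> e i k * (coords y i k - coords y i k0)"
      using min[OF k0, of k] min[of k k0] e by (cases "(i, k) \<in> b") (auto simp: nonneg_off_def)
  qed
  finally show "0 \<le> (\<Sum>k\<in>UNIV. e i k * coords y i k)" .
qed

lemma form_eq_zero_tight_cone:
  assumes rows: "\<And>i. (\<Sum>k\<in>UNIV. e i k) = 0" and e: "\<And>i k. (i, k) \<notin> c \<Longrightarrow> e i k = 0"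
    and b: "\<And>i. \<exists>k. (i, k) \<in> c" and y: "y \<in> tight_cone c"
  shows "form e y = 0"
proof -
  have "0 \<le> form e y" using rows e b y by (intro form_nonneg_tight_cone) (auto simp: nonneg_off_def)
  moreover have "0 \<le> form (- e) y"
    using rows e b y by (intro form_nonneg_tight_cone) (auto simp: nonneg_off_def sum_negf)
  moreover have "form (- e) y = - form e y" by (simp add: cost_def sum_negf)
  ultimately show ?thesis by simp
qed

lemma simplex_ray_inner_vertex:
  "simplex_ray k \<bullet> simplex_vertex l = of_bool (k = l) - of_bool (k = None)"
  by (cases k; cases l)
    (simp_all add: simplex_ray_def simplex_vertex_def inner_axis_axis inner_sum_left cong: if_cong)

subsection \<open>Minimal exponents of the charts\<close>

text \<open>At the origin every set of cells is tight, so the origin lies in every chamber, and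
  diagonal translates share its type.\<close>

lemma diag_in_chamber:
  fixes y :: "real^'d::finite^'m::finite"
  shows "diag x \<in> chamber y"
proof -
  have "tight (coords (0 + diag x)) = tight (coords (0 :: real^'d^'m))"
    by (rule tight_coords_diag_proj[OF diag_proj_add_diag])
  then show ?thesis by (simp add: chamber_def coords_zero tight_zero)
qed

lemma chamber_add_diag: "z + diag x \<in> chamber y \<longleftrightarrow> z \<in> chamber y"
  using tight_coords_diag_proj[OF diag_proj_add_diag[of z x]] by (simp add: chamber_def)

text \<open>An optimal matrix \<open>e\<close> with the column sums of \<open>f\<close> has a
  support that, together with \<open>b\<close>, is tight at \<open>y\<close> and hence at every
  point of \<open>\<sigma>\<close>. So each point of \<open>\<sigma>\<close> can be translated along
  the diagonal, within \<open>\<sigma>\<close>, to a point where \<open>form e\<close> vanishes;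
  this is what makes \<open>e\<close> minimal.\<close>

lemma minimal_decomposition:
  fixes y :: "real^'d::finite^'m::finite"
  assumes b: "b \<in> tight (coords y)" "\<And>i. \<exists>k. (i, k) \<in> b"
  defines "\<sigma> \<equiv> chamber y \<inter> tight_cone b"
  assumes u: "u \<in> dual_semigroup int_lattice \<sigma>"
  shows "\<exists>e a. minimal_exponent int_lattice \<sigma> quotient_lattice diag_proj e \<and>
    a \<in> dual_lattice quotient_lattice \<and> u = e + (a \<circ> diag_proj)"
proof -
  obtain f where f: "u = form f" "\<And>i. (\<Sum>k\<in>UNIV. f i k) = 0"
    using u dual_lattice_form[of u] unfolding dual_semigroup_def by blast
  obtain i0 :: 'm where True by blast
  obtain k0 where k0: "(i0, k0) \<in> b" using b(2) by blast
  have columns: "0 \<le> (\<Sum>i\<in>UNIV. f i k)" if k: "k \<notin> snd ` b" for k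
  proof -
    \<comment> \<open>Column sums are read off on diagonal copies of rays: the \<open>k\<close>-th
      ray pairs with the vertices like the \<open>k\<close>-th unit vector, up to a constant that
      the vanishing total mass removes. The copy lies in \<open>tight_cone b\<close> because column
      \<open>k\<close> avoids \<open>b\<close>.\<close>
    define z :: "real^'d^'m" where "z = diag (simplex_ray k)"
    have "k' \<noteq> k" if "(i, k') \<in> b" for i k' using k that by force
    then have "z \<in> tight_cone b"
      by (auto simp: tight_cone_def z_def coords_diag simplex_ray_inner_vertex)
    then have "z \<in> \<sigma>" using diag_in_chamber by (simp add: \<sigma>_def z_def)
    then have "0 \<le> form f z" using u f(1) by (simp add: dual_semigroup_def)
    also have "form f z = (\<Sum>l\<in>UNIV. of_int (\<Sum>i\<in>UNIV. f i l) * of_bool (k = l)) -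
        of_bool (k = None) * of_int (\<Sum>l\<in>UNIV. \<Sum>i\<in>UNIV. f i l)"
      unfolding z_def form_diag simplex_ray_inner_vertex
      by (simp add: right_diff_distrib sum_subtractf sum_distrib_left mult.commute)
    also have "(\<Sum>l\<in>UNIV. \<Sum>i\<in>UNIV. f i l) = 0" by (subst sum.swap) (simp add: f(2))
    also have "(\<Sum>l\<in>UNIV. of_int (\<Sum>i\<in>UNIV. f i l) * of_bool (k = l)) = real_of_int (\<Sum>i\<in>UNIV. f i k)"
      using sum_of_bool_mult_UNIV[of k "\<lambda>l. real_of_int (\<Sum>i\<in>UNIV. f i l)"] by (simp add: mult.commute)
    finally have "0 \<le> real_of_int (\<Sum>i\<in>UNIV. f i k)" by (simp del: of_int_sum)
    then show ?thesis by (simp only: of_int_0_le_iff)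
  qed
  obtain e where e: "nonneg_off b e" "balanced (e - f)" "b \<union> pos_cells e \<in> tight (coords y)"
    using tight_representative[OF b(1) k0 f(2) columns] .
  have rows: "(\<Sum>k\<in>UNIV. e i k) = 0" for i
    using e(2) f(2)[of i] by (simp add: balanced_def sum_subtractf)
  have off: "e i k = 0" if "(i, k) \<notin> b \<union> pos_cells e" for i k
    using e(1) that by (force simp: nonneg_off_def pos_cells_def)
  have lift: "\<exists>x. z + diag x \<in> \<sigma> \<and> form e (z + diag x) = 0" if z: "z \<in> \<sigma>" for z
  proof -
    have "b \<union> pos_cells e \<in> tight (coords z)" using z e(3) by (auto simp: \<sigma>_def chamber_def)
    then obtain x where x: "z + diag x \<in> tight_cone (b \<union> pos_cells e)" using tight_coords_iff by blast
    have "z + diag x \<in> \<sigma>" using x z by (auto simp: \<sigma>_def chamber_add_diag tight_cone_def)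
    moreover have "form e (z + diag x) = 0"
      using b(2) by (intro form_eq_zero_tight_cone[OF rows off _ x]) auto
    ultimately show ?thesis by blast
  qed
  have min: "minimal_exponent int_lattice \<sigma> quotient_lattice diag_proj (form e)"
    unfolding minimal_exponent_def
  proof (intro conjI allI ballI impI)
    show "form e \<in> dual_semigroup int_lattice \<sigma>"
      using form_dual_lattice[of e] form_nonneg_tight_cone[OF rows e(1) b(2)] by (auto simp: dual_semigroup_def \<sigma>_def)
    fix n :: nat and a :: "('d, 'm) diag_quot \<Rightarrow> real"
    assume a: "a \<in> dual_lattice quotient_lattice"
      and n: "(\<lambda>v. real n * form e v) - (a \<circ> diag_proj) \<in> dual_semigroup int_lattice \<sigma>"
    have "a \<circ> diag_proj \<in> dual_lattice int_lattice"
      by (rule dual_lattice_comp[OF linear_diag_proj _ a]) (simp add: quotient_lattice_def)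
    then have "- (a \<circ> diag_proj) \<in> dual_lattice int_lattice" by (rule dual_lattice_uminus)
    moreover have "0 \<le> (- (a \<circ> diag_proj)) z" if z: "z \<in> \<sigma>" for z
    proof -
      obtain x where x: "z + diag x \<in> \<sigma>" "form e (z + diag x) = 0" using lift[OF z] by blast
      \<comment> \<open>At the translated point the term \<open>n e\<close> is zero for every
        \<open>n\<close>, whereas \<open>a\<close> does not notice the translation.\<close>
      have "0 \<le> real n * form e (z + diag x) - a (diag_proj (z + diag x))"
        using n x(1) by (auto simp: dual_semigroup_def)
      then show ?thesis using x(2) by (simp add: diag_proj_add_diag)
    qed
    ultimately show "- (a \<circ> diag_proj) \<in> dual_semigroup int_lattice \<sigma>"
      unfolding dual_semigroup_def by blast
  qed
  have "balanced (f - e)" using e(2) balanced_minus_commute by blast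
  then obtain a where a: "a \<in> dual_lattice quotient_lattice" "form (f - e) = a \<circ> diag_proj"
    by (rule balanced_formE)
  have "u = form e + (a \<circ> diag_proj)"
    unfolding a(2)[symmetric] f(1) by (simp add: fun_eq_iff cost_diff)
  with min a(1) show ?thesis by blast
qed

subsection \<open>Faces of the quotient fan\<close>

lemma inner_adjoint_one:
  fixes f :: "'a::euclidean_space \<Rightarrow> real"
  shows "linear f \<Longrightarrow> adjoint f 1 \<bullet> x = f x"
  using adjoint_works[of f x 1] by (simp add: inner_commute)

text \<open>A finitely generated cone is closed, so a point outside it can be strictly separated; as
  the cone contains 0 and all multiples of its generators, the separating vector is nonnegative on
  them.\<close>

lemma farkas_convex_cone_hull:
  fixes A :: "'a::euclidean_space"
  assumes H: "finite H" and A: "\<And>z. (\<forall>r\<in>H. 0 \<le> r \<bullet> z) \<Longrightarrow> 0 \<le> A \<bullet> z"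
  shows "A \<in> convex_cone hull H"
proof (rule ccontr)
  assume "A \<notin> convex_cone hull H"
  moreover have "closed (convex_cone hull H)"
    by (intro polyhedron_imp_closed polyhedron_convex_cone_hull H)
  moreover have "convex (convex_cone hull H)" by (rule convex_convex_cone_hull)
  ultimately obtain z c where z: "z \<bullet> A < c" "\<And>x. x \<in> convex_cone hull H \<Longrightarrow> c < z \<bullet> x"
    using separating_hyperplane_closed_point[of "convex_cone hull H" A] by blast
  have c: "c < 0" using z(2)[OF convex_cone_hull_contains_0] by simp
  have "0 \<le> r \<bullet> z" if r: "r \<in> H" for r
  proof (rule ccontr)
    assume "\<not> 0 \<le> r \<bullet> z"
    then have neg: "z \<bullet> r < 0" by (simp add: inner_commute)
    \<comment> \<open>The multiple is chosen to take exactly the value \<open>c\<close>, which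
      strict separation excludes.\<close>
    have "(c / (z \<bullet> r)) *\<^sub>R r \<in> convex_cone hull H"
      using neg c r by (intro convex_cone_hull_mul hull_inc) (auto simp: divide_nonpos_neg)
    from z(2)[OF this] show False using neg by simp
  qed
  then have "0 \<le> A \<bullet> z" using A by blast
  then show False using z(1) c by (simp add: inner_commute)
qed

text \<open>The forms of \<open>g - cell_matrix c\<close>, for \<open>c\<close> tight at
  \<open>y0\<close> and \<open>g\<close> a competing plan, cut out \<open>chamber y0\<close>, so by
  Farkas \<open>a\<close> is a nonnegative combination of them. For a single one,
  \<open>h = cell_matrix c - f\<close> with an optimal plan \<open>f\<close> at \<open>y1\<close>
  works, and the vectors \<open>r\<close> that admit an integral \<open>h\<close> form a convex
  cone.\<close>

lemma chamber_face:
  fixes y0 y1 :: "real^'d::finite^'m::finite"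
  assumes sub: "tight (coords y1) \<subseteq> tight (coords y0)"
    and a: "linear a" "\<And>z. z \<in> chamber y0 \<Longrightarrow> 0 \<le> a z"
  obtains h where "balanced h" "\<forall>z\<in>chamber y1. 0 \<le> form h z"
    "\<forall>z\<in>chamber y0. form h z = 0" "\<forall>z\<in>chamber y1. 0 \<le> a z + form h z"
proof -
  define good where "good r h \<longleftrightarrow> balanced h \<and> (\<forall>z\<in>chamber y1. 0 \<le> form h z) \<and> (\<forall>z\<in>chamber y0. form h z = 0) \<and>
    (\<forall>z\<in>chamber y1. 0 \<le> r \<bullet> z + form h z)" for r :: "real^'d^'m" and h
  define G where "G c = {g. nonneg_off {} g \<and> balanced (g - cell_matrix c)}" for c :: "('m \<times> 'd option) set"
  define H where "H = (\<lambda>(c, g). adjoint (form (g - cell_matrix c)) 1) ` (SIGMA c:tight (coords y0). G c)"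
  have H_inner: "adjoint (form e) 1 \<bullet> z = form e z" for e and z :: "real^'d^'m"
    by (rule inner_adjoint_one[OF linear_form])
  have "finite (G c)" for c unfolding G_def by (rule finite_transport_polytope)
  then have fin: "finite H" unfolding H_def by (intro finite_imageI finite_SigmaI) auto
  have "z \<in> chamber y0" if z: "\<forall>r\<in>H. 0 \<le> r \<bullet> z" for z
    unfolding chamber_def
  proof (intro CollectI subsetI)
    fix c assume c: "c \<in> tight (coords y0)"
    show "c \<in> tight (coords z)"
      unfolding tight_iff_optimal
    proof (intro allI impI)
      fix g assume "nonneg_off {} g" "balanced (g - cell_matrix c)"
      then have "adjoint (form (g - cell_matrix c)) 1 \<in> H" using c unfolding H_def G_def by force
      then have "0 \<le> form (g - cell_matrix c) z" using z H_inner by metis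
      then show "form (cell_matrix c) z \<le> form g z" by (simp add: cost_diff)
    qed
  qed
  then have "0 \<le> adjoint a 1 \<bullet> z" if "\<forall>r\<in>H. 0 \<le> r \<bullet> z" for z
    using a(2) that by (simp add: inner_adjoint_one[OF a(1)])
  then have "adjoint a 1 \<in> convex_cone hull H" by (rule farkas_convex_cone_hull[OF fin])
  also have "convex_cone hull H \<subseteq> {r. \<exists>h. good r h}"
  proof (rule hull_minimal)
    show "H \<subseteq> {r. \<exists>h. good r h}"
    proof
      fix r assume "r \<in> H"
      then obtain c g where c: "c \<in> tight (coords y0)" and g: "nonneg_off {} g" "balanced (g - cell_matrix c)"
        and r: "r = adjoint (form (g - cell_matrix c)) 1" unfolding H_def G_def by auto
      \<comment> \<open>On all of \<open>chamber y1\<close> the plan \<open>f\<close> stays optimal,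
        so \<open>g\<close> and \<open>c\<close> cost at least as much; on \<open>chamber y0\<close>
        also \<open>c\<close> is optimal, so there \<open>c\<close> and \<open>f\<close>
        tie.\<close>
      obtain f where f: "nonneg_off {} f" "balanced (cell_matrix c - f)" "pos_cells f \<in> tight (coords y1)"
        using optimal_transport_exists[of "cell_matrix c" "coords y1"] by (auto simp: nonneg_off_def)
      have off: "nonneg_off (pos_cells f) (g' - f)" if "nonneg_off {} g'" for g'
        using that f(1) by (auto simp: nonneg_off_def pos_cells_def not_less intro: order_trans)
      have 1: "0 \<le> form (cell_matrix c - f) z" if "z \<in> chamber y1" for z
      proof (rule cost_nonneg_of_tight)
        show "pos_cells f \<in> tight (coords z)" using f(3) that by (auto simp: chamber_def)
        show "nonneg_off (pos_cells f) (cell_matrix c - f)" by (rule off) (simp add: nonneg_off_def)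
      qed (rule f(2))
      have 2: "form (cell_matrix c - f) z = 0" if z: "z \<in> chamber y0" for z
      proof (rule antisym)
        show "0 \<le> form (cell_matrix c - f) z" using 1 z sub by (auto simp: chamber_def)
        have "0 \<le> form (f - cell_matrix c) z"
        proof (rule cost_nonneg_of_tight)
          show "c \<in> tight (coords z)" using c z by (auto simp: chamber_def)
          show "balanced (f - cell_matrix c)" using f(2) balanced_minus_commute by blast
          show "nonneg_off c (f - cell_matrix c)" using f(1) by (auto simp: nonneg_off_def)
        qed
        then show "form (cell_matrix c - f) z \<le> 0" by (simp add: cost_diff)
      qed
      have 3: "0 \<le> r \<bullet> z + form (cell_matrix c - f) z" if z: "z \<in> chamber y1" for z
      proof -
        have "0 \<le> form (g - f) z"
        proof (rule cost_nonneg_of_tight)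
          show "pos_cells f \<in> tight (coords z)" using f(3) z by (auto simp: chamber_def)
          show "balanced (g - f)" using balanced_add[OF g(2) f(2)] by simp
        qed (rule off[OF g(1)])
        then show ?thesis unfolding r H_inner by (simp add: cost_diff)
      qed
      show "r \<in> {r. \<exists>h. good r h}" unfolding good_def using f(2) 1 2 3 by blast
    qed
    show "convex_cone {r. \<exists>h. good r h}"
      unfolding convex_cone_iff
    proof (intro conjI ballI allI impI)
      have "good 0 0" by (simp add: good_def balanced_def cost_def)
      then show "0 \<in> {r. \<exists>h. good r h}" by blast
    next
      fix r r' assume "r \<in> {r. \<exists>h. good r h}" "r' \<in> {r. \<exists>h. good r h}"
      then obtain h h' where "good r h" "good r' h'" by blast
      then have "good (r + r') (h + h')"
        unfolding good_def cost_add inner_add_left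
        by (intro conjI balanced_add ballI) (fastforce simp: algebra_simps dest: add_nonneg_nonneg)+
      then show "r + r' \<in> {r. \<exists>h. good r h}" by blast
    next
      fix r and t :: real assume "r \<in> {r. \<exists>h. good r h}" and t: "0 \<le> t"
      then obtain h where h: "good r h" by blast
      \<comment> \<open>Farkas coefficients are real while \<open>h\<close> must be integral;
        rounding up adds a nonnegative multiple of \<open>h\<close>, which does no harm to any of
        the conditions.\<close>
      have "good (t *\<^sub>R r) (\<lambda>i k. \<lceil>t\<rceil> * h i k)"
        unfolding good_def cost_scale inner_scaleR_left
      proof (intro conjI ballI)
        show "balanced (\<lambda>i k. \<lceil>t\<rceil> * h i k)"
          using h by (simp add: good_def balanced_def flip: sum_distrib_left)
        fix z assume z: "z \<in> chamber y1"
        have hz: "0 \<le> form h z" "0 \<le> r \<bullet> z + form h z" using h z by (auto simp: good_def)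
        show "0 \<le> real_of_int \<lceil>t\<rceil> * form h z" using t hz by simp
        have "0 \<le> t * (r \<bullet> z + form h z)" by (rule mult_nonneg_nonneg[OF t hz(2)])
        moreover have "0 \<le> (real_of_int \<lceil>t\<rceil> - t) * form h z" by (rule mult_nonneg_nonneg[OF _ hz(1)]) simp
        ultimately show "0 \<le> t * (r \<bullet> z) + real_of_int \<lceil>t\<rceil> * form h z" by (simp add: algebra_simps)
      next
        fix z assume "z \<in> chamber y0"
        then show "real_of_int \<lceil>t\<rceil> * form h z = 0" using h by (simp add: good_def)
      qed
      then show "t *\<^sub>R r \<in> {r. \<exists>h. good r h}" by blast
    qed
  qed
  finally obtain h where "good (adjoint a 1) h" by blast
  then show thesis by (intro that[of h]) (auto simp: good_def inner_adjoint_one[OF a(1)])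
qed

lemma toric_criterion_simplex:
  fixes \<sigma> :: "(real^'d::finite^'m::finite) set"
  assumes \<sigma>: "\<sigma> \<in> refined_fan std_simplex" and \<sigma>': "\<sigma>' \<in> quotient_fan std_simplex"
    and sub: "diag_proj ` \<sigma> \<subseteq> \<sigma>'"
  shows "toric_criterion int_lattice \<sigma> quotient_lattice \<sigma>' diag_proj"
proof -
  obtain y b where y: "\<sigma> = chamber y \<inter> tight_cone b" "b \<in> tight (coords y)"
    "\<forall>i :: 'm. \<exists>k. (i, k) \<in> b" "diag_proj ` \<sigma> = diag_proj ` chamber y"
    using refined_fan_std_simplex[OF \<sigma>] .
  obtain y1 :: "real^'d^'m" where y1: "\<sigma>' = diag_proj ` chamber y1"
    using \<sigma>' unfolding quotient_fan_std_simplex by blast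
  \<comment> \<open>Since \<open>\<sigma>\<close> has the same image as \<open>chamber y\<close>,
    the class of \<open>y\<close> lies in \<open>\<sigma>'\<close>, which turns the inclusion of
    cones into one of tight sets.\<close>
  have "y \<in> chamber y" by (simp add: chamber_def)
  then have "diag_proj y \<in> diag_proj ` chamber y1" using sub unfolding y(4) y1 by blast
  then have tight: "tight (coords y1) \<subseteq> tight (coords y)"
    unfolding chamber_diag_proj by (simp add: chamber_def)
  show ?thesis
  proof (rule toric_criterion.intro)
    show "linear (diag_proj :: real^'d^'m \<Rightarrow> _)" by (rule linear_diag_proj)
    show "surj (diag_proj :: real^'d^'m \<Rightarrow> _)" by (rule surj_diag_proj)
    show "quotient_lattice = (diag_proj :: real^'d^'m \<Rightarrow> _) ` int_lattice" by (rule quotient_lattice_def)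
    show "diag_proj ` \<sigma> \<subseteq> \<sigma>'" by (rule sub)
  next
    fix u assume u: "u \<in> dual_semigroup int_lattice \<sigma>"
    show "\<exists>e a. minimal_exponent int_lattice \<sigma> quotient_lattice diag_proj e \<and>
        a \<in> dual_lattice quotient_lattice \<and> u = e + (a \<circ> diag_proj)"
      using minimal_decomposition[OF y(2), of u] y(3) u unfolding y(1) by blast
  next
    fix a :: "('d, 'm) diag_quot \<Rightarrow> real"
    assume a: "a \<in> dual_lattice quotient_lattice" "a \<circ> diag_proj \<in> dual_semigroup int_lattice \<sigma>"
    have lin: "linear (a \<circ> (diag_proj :: real^'d^'m \<Rightarrow> _))"
      using a(1) linear_diag_proj by (auto simp: dual_lattice_def intro: linear_compose)
    \<comment> \<open>Nonnegativity on \<open>\<sigma>\<close> extends to the chamber because both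
      have the same image under \<open>diag_proj\<close>.\<close>
    have nonneg: "0 \<le> (a \<circ> diag_proj) z" if z: "z \<in> chamber y" for z
    proof -
      have "diag_proj z \<in> diag_proj ` \<sigma>" unfolding y(4) using z by (rule imageI)
      then obtain s where "s \<in> \<sigma>" "diag_proj z = diag_proj s" by (rule imageE)
      then show ?thesis using a(2) by (auto simp: dual_semigroup_def)
    qed
    obtain h where h: "balanced h" "\<forall>z\<in>chamber y1. 0 \<le> form h z"
      "\<forall>z\<in>chamber y. form h z = 0" "\<forall>z\<in>chamber y1. 0 \<le> (a \<circ> diag_proj) z + form h z"
      using chamber_face[OF tight lin nonneg] .
    obtain g where g: "g \<in> dual_lattice quotient_lattice" "form h = g \<circ> diag_proj"
      using h(1) by (rule balanced_formE)
    have g_form: "g (diag_proj z) = form h z" for z using fun_cong[OF g(2), of z] by simp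
    have "g \<in> dual_semigroup quotient_lattice \<sigma>'"
      using g(1) h(2) by (auto simp: dual_semigroup_def y1 g_form)
    moreover have "- (g \<circ> diag_proj) \<in> dual_semigroup int_lattice \<sigma>"
      using dual_lattice_uminus[OF form_dual_lattice[of h]] h(3)
      by (auto simp: dual_semigroup_def y(1) g(2)[symmetric])
    moreover have "a + g \<in> dual_semigroup quotient_lattice \<sigma>'"
      using dual_lattice_add[OF a(1) g(1)] h(4) by (auto simp: dual_semigroup_def y1 g_form)
    ultimately show "\<exists>h\<in>dual_semigroup quotient_lattice \<sigma>'. - (h \<circ> diag_proj) \<in> dual_semigroup int_lattice \<sigma> \<and>
        a + h \<in> dual_semigroup quotient_lattice \<sigma>'" by blast
  qed
qed

theorem theorem3p12:
  shows "flat_toric_morphism TYPE('n) TYPE('k)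
           int_lattice (refined_fan std_simplex)
           quotient_lattice (quotient_fan std_simplex)
           (diag_proj :: real^'d^'m \<Rightarrow> ('d::finite, 'm::finite) diag_quot) \<and>
         toric_morphism_reduced_fibres
           int_lattice (refined_fan std_simplex)
           quotient_lattice (quotient_fan std_simplex)
           (diag_proj :: real^'d^'m \<Rightarrow> ('d, 'm) diag_quot)"
  unfolding flat_toric_morphism_def toric_morphism_reduced_fibres_def
  by (intro conjI ballI impI fan_morphism_diag_proj toric_criterion.flat_chart
      toric_criterion.reduced_fibres_chart toric_criterion_simplex)

end
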